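(* Let $f$ and $w$ be $C^\infty$ functions, where $w=w(x,t)$ is an exact solution of the conservation law $w_t+f(w)_x=0$, and let $\Delta t$ and $\Delta x$ be asymptotically comparable, i.e. $\mathcal O(\Delta t)=\mathcal O(\Delta x)$. Consider an explicit $\mathtt r$-derivative, $\mathtt s$-stage Jacobian-free MDRKCAT method whose underlying explicit multiderivative Runge-Kutta (MDRK) method has consistency order $q$, and whose local stencil to update $w(x_i,t^n)$ is $\{i-p,i-p+1,\ldots,i+p\}$ (i.e. the method uses the compact approximate Taylor procedure with parameter $p\ge 1$). Then the consistency order of the MDRKCAT method is $\min(2p,q)$; that is, when the exact solution is inserted into the method, $$w(x_i,t^{n+1})-w(x_i,t^n)+\frac{\Delta t}{\Delta x}\left(F^n_{i+1/2}-F^n_{i-1/2}\right)=\mathcal O(\Delta t^{q+1})+\mathcal O(\Delta x^{2p+1}).$$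
   Context: **Grid.** Uniform grid $x_i$ of size $\Delta x$, time levels $t^n=n\Delta t$; $w_i^n$ denotes the approximation of $w(x_i,t^n)$. Boundary effects are ignored. $w$ may be scalar or vector valued. **Underlying MDRK method.** For an ODE $y'=\Phi(y)$, an explicit $\mathtt r$-derivative, $\mathtt s$-stage MDRK method with real coefficients $a^{(k)}_{l\nu}$, $b^{(k)}_l$ is $$y^{n,l}=y^n+\sum_{k=1}^{\mathtt r}\Delta t^k\sum_{\nu=1}^{l-1}a^{(k)}_{l\nu}\frac{\mathrm d^{k-1}}{\mathrm dt^{k-1}}\Phi(y^{n,\nu}),\quad l=1,\dots,\mathtt s,\qquad y^{n+1}=y^n+\sum_{k=1}^{\mathtt r}\Delta t^k\sum_{l=1}^{\mathtt s}b^{(k)}_l\frac{\mathrm d^{k-1}}{\mathrm dt^{k-1}}\Phi(y^{n,l}),$$ where time derivatives of $\Phi$ are expressed recursively by the chain rule, $\frac{\mathrm d^k}{\mathrm dt^k}\Phi(y)=\frac{\mathrm d^{k-1}}{\mathrm dt^{k-1}}(\Phi'(y)\Phi(y))$. It has order $q$ if its local error is $\mathcal O(\Delta t^{q+1})$ for all smooth ODE systems. **Difference coefficients.** Let $p\ge1$ and $$L_{p,j}(\omega)=\prod_{r=-p,\,r\ne j}^{p}\frac{\omega-r}{j-r}\ (j=-p,\dots,p),\qquad \ell_{p,j}(\omega)=\prod_{r=-p+1,\,r\ne j}^{p}\frac{\omega-r}{j-r}\ (j=-p+1,\dots,p).$$ Put $\delta^k_{p,j}=L^{(k)}_{p,j}(0)$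 and $\gamma^{k,m}_{p,j}=\ell^{(k)}_{p,j}(m)$ for $m=-p+1,\dots,p$ (superscript $(k)$ is the $k$-th derivative). The numbers $\lambda^0_{p,j}$, $j=-p+1,\dots,p$, are uniquely determined by $\delta^1_{p,p}=\lambda^0_{p,p}$, $\delta^1_{p,j}=\lambda^0_{p,j}-\lambda^0_{p,j+1}$ for $j=-p+1,\dots,p-1$, and $\delta^1_{p,-p}=-\lambda^0_{p,-p+1}$. **CAT (compact approximate Taylor) procedure.** Given nodal values $v_i$, for each $i$ and $j=-p+1,\dots,p$ set $\widetilde f^{(0)}_{i,j}=f(v_{i+j})$, and recursively for $k=1,2,\dots$: $$\widetilde w^{(k)}_{i,j}=-\frac1{\Delta x}\sum_{r=-p+1}^p\gamma^{1,j}_{p,r}\widetilde f^{(k-1)}_{i,r},\qquad \widetilde f^{(k)}_{i,j}=\frac1{\Delta t^k}\sum_{r=-p+1}^p\gamma^{k,0}_{p,r}\,f\Big(v_{i+j}+\sum_{m=1}^{k}\frac{(r\Delta t)^m}{m!}\widetilde w^{(m)}_{i,j}\Big).$$ **MDRKCAT method.** Stages and update: $$w_i^{n,l}=w_i^n-\frac{\Delta t}{\Delta x}\big(F^{n,l}_{i+1/2}-F^{n,l}_{i-1/2}\big),\ l=1,\dots,\mathtt s,\qquad w_i^{n+1}=w_i^n-\frac{\Delta t}{\Delta x}\big(F^{n}_{i+1/2}-F^{n}_{i-1/2}\big),$$ $$F^{n,l}_{i+1/2}=\sum_{k=1}^{\mathtt r}\Delta t^{k-1}\sum_{\nu=1}^{l-1}a^{(k)}_{l\nu}\sum_{j=-p+1}^p\lambda^0_{p,j}(\widetilde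 f^{\nu})^{(k-1)}_{i,j},\qquad F^{n}_{i+1/2}=\sum_{k=1}^{\mathtt r}\Delta t^{k-1}\sum_{l=1}^{\mathtt s}b^{(k)}_{l}\sum_{j=-p+1}^p\lambda^0_{p,j}(\widetilde f^{l})^{(k-1)}_{i,j},$$ where $(\widetilde f^{l})^{(k)}_{i,j}$ is the output of the CAT procedure applied to the nodal values $v_i=w_i^{n,l}$, and $F_{i-1/2}$ is obtained by replacing $i$ by $i-1$. "Inserting the exact solution" means starting the step from $w_i^n=w(x_i,t^n)$ for all $i$. The method is consistent of order $m$ if the resulting residual is $\mathcal O(\Delta x^{m+1})$ (with $\Delta t$ and $\Delta x$ comparable). *)

theory Defs
  imports
    "HOL-Analysis.Analysis"
    "HOL-Computational_Algebra.Polynomial"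
    "HOL-Library.Landau_Symbols"
begin

section \<open>Smooth maps on open subsets of Euclidean spaces\<close>

text \<open>\<open>C_k_on k S g\<close> is the usual class \<open>C\<^sup>k\<close> only for open \<open>S\<close>: the derivatives are two-sided
  ones, and \<open>C\<^sup>k\<^sup>+\<^sup>1\<close> asks every directional derivative to be \<open>C\<^sup>k\<close>.\<close>

fun C_k_on :: "nat \<Rightarrow> 'a::euclidean_space set \<Rightarrow> ('a \<Rightarrow> 'b::real_normed_vector) \<Rightarrow> bool" where
  "C_k_on 0 S g \<longleftrightarrow> continuous_on S g"
| "C_k_on (Suc k) S g \<longleftrightarrow>
     (\<forall>x\<in>S. g differentiable (at x)) \<and> (\<forall>v. C_k_on k S (\<lambda>x. frechet_derivative g (at x) v))"

definition smooth_on :: "'a::euclidean_space set \<Rightarrow> ('a \<Rightarrow> 'b::real_normed_vector) \<Rightarrow> bool" where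
  "smooth_on S g \<longleftrightarrow> (\<forall>k. C_k_on k S g)"

section \<open>Smooth ODE systems of arbitrary dimension\<close>

text \<open>The order of a Runge--Kutta method quantifies over systems of every dimension \<open>d\<close>, so \<open>d\<close>
  cannot be a type here. A vector of dimension \<open>d\<close> is a sequence that vanishes from index \<open>d\<close> on;
  the product topology of \<^typ>\<open>nat \<Rightarrow> real\<close> restricts to the Euclidean one on \<open>Rd d\<close>.\<close>

definition Rd :: "nat \<Rightarrow> (nat \<Rightarrow> real) set" where
  "Rd d = {y. \<forall>i\<ge>d. y i = 0}"

definition partial :: "nat \<Rightarrow> ((nat \<Rightarrow> real) \<Rightarrow> real) \<Rightarrow> (nat \<Rightarrow> real) \<Rightarrow> real" where
  "partial i g y = deriv (\<lambda>z. g (y(i := z))) (y i)"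

fun C_k_Rd :: "nat \<Rightarrow> nat \<Rightarrow> ((nat \<Rightarrow> real) \<Rightarrow> real) \<Rightarrow> bool" where
  "C_k_Rd d 0 g \<longleftrightarrow> continuous_on (Rd d) g"
| "C_k_Rd d (Suc k) g \<longleftrightarrow> continuous_on (Rd d) g \<and>
     (\<forall>i<d. (\<forall>y\<in>Rd d. (\<lambda>z. g (y(i := z))) differentiable (at (y i))) \<and> C_k_Rd d k (partial i g))"

definition smooth_system :: "nat \<Rightarrow> ((nat \<Rightarrow> real) \<Rightarrow> nat \<Rightarrow> real) \<Rightarrow> bool" where
  "smooth_system d \<Phi> \<longleftrightarrow> \<Phi> \<in> Rd d \<rightarrow> Rd d \<and> (\<forall>c<d. \<forall>k. C_k_Rd d k (\<lambda>y. \<Phi> y c))"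

definition ode_solution ::
  "nat \<Rightarrow> ((nat \<Rightarrow> real) \<Rightarrow> nat \<Rightarrow> real) \<Rightarrow> real \<Rightarrow> (real \<Rightarrow> nat \<Rightarrow> real) \<Rightarrow> bool" where
  "ode_solution d \<Phi> T y \<longleftrightarrow> (\<forall>t\<in>{0..<T}. y t \<in> Rd d \<and>
     (\<forall>c<d. ((\<lambda>t. y t c) has_real_derivative \<Phi> (y t) c) (at t within {0..<T})))"

text \<open>\<open>along d \<Phi> G\<close> is \<open>G' \<Phi>\<close>, the time derivative of \<open>G(y)\<close> along solutions of \<open>y' = \<Phi>(y)\<close>.\<close>

definition along :: "nat \<Rightarrow> ((nat \<Rightarrow> real) \<Rightarrow> nat \<Rightarrow> real) \<Rightarrow>
    ((nat \<Rightarrow> real) \<Rightarrow> nat \<Rightarrow> real) \<Rightarrow> (nat \<Rightarrow> real) \<Rightarrow> nat \<Rightarrow> real" where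
  "along d \<Phi> G y c = (\<Sum>i<d. partial i (\<lambda>z. G z c) y * \<Phi> y i)"

definition time_deriv :: "nat \<Rightarrow> ((nat \<Rightarrow> real) \<Rightarrow> nat \<Rightarrow> real) \<Rightarrow> nat \<Rightarrow>
    (nat \<Rightarrow> real) \<Rightarrow> nat \<Rightarrow> real" where
  "time_deriv d \<Phi> k = (along d \<Phi> ^^ k) \<Phi>"

section \<open>Multiderivative Runge--Kutta methods\<close>

text \<open>The coefficients are \<open>a k l \<nu>\<close> for \<open>a\<^sup>(\<^sup>k\<^sup>)\<^sub>l\<^sub>\<nu>\<close> and \<open>b k l\<close> for \<open>b\<^sup>(\<^sup>k\<^sup>)\<^sub>l\<close>, with \<open>1 \<le> k \<le> r\<close> and
  \<open>1 \<le> l, \<nu> \<le> s\<close>; only the entries with \<open>\<nu> < l\<close> are used (explicit method).\<close>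

fun mdrk_stage :: "nat \<Rightarrow> (nat \<Rightarrow> nat \<Rightarrow> nat \<Rightarrow> real) \<Rightarrow> nat \<Rightarrow>
    ((nat \<Rightarrow> real) \<Rightarrow> nat \<Rightarrow> real) \<Rightarrow> real \<Rightarrow> (nat \<Rightarrow> real) \<Rightarrow> nat \<Rightarrow> nat \<Rightarrow> real" where
  "mdrk_stage r a d \<Phi> dt y l =
     (\<lambda>c. y c + (\<Sum>k = 1..r. dt ^ k * (\<Sum>\<nu> = 1..<l.
        a k l \<nu> * time_deriv d \<Phi> (k - 1) (mdrk_stage r a d \<Phi> dt y \<nu>) c)))"

declare mdrk_stage.simps [simp del]

definition mdrk_step :: "nat \<Rightarrow> nat \<Rightarrow> (nat \<Rightarrow> nat \<Rightarrow> nat \<Rightarrow> real) \<Rightarrow> (nat \<Rightarrow> nat \<Rightarrow> real) \<Rightarrow> nat \<Rightarrow>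
    ((nat \<Rightarrow> real) \<Rightarrow> nat \<Rightarrow> real) \<Rightarrow> real \<Rightarrow> (nat \<Rightarrow> real) \<Rightarrow> nat \<Rightarrow> real" where
  "mdrk_step r s a b d \<Phi> dt y =
     (\<lambda>c. y c + (\<Sum>k = 1..r. dt ^ k * (\<Sum>l = 1..s.
        b k l * time_deriv d \<Phi> (k - 1) (mdrk_stage r a d \<Phi> dt y l) c)))"

definition mdrk_has_order ::
  "nat \<Rightarrow> nat \<Rightarrow> (nat \<Rightarrow> nat \<Rightarrow> nat \<Rightarrow> real) \<Rightarrow> (nat \<Rightarrow> nat \<Rightarrow> real) \<Rightarrow> nat \<Rightarrow> bool" where
  "mdrk_has_order r s a b q \<longleftrightarrow>
     (\<forall>d \<Phi> T y. smooth_system d \<Phi> \<longrightarrow> 0 < T \<longrightarrow> ode_solution d \<Phi> T y \<longrightarrow>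
        (\<forall>c<d. (\<lambda>dt. y dt c - mdrk_step r s a b d \<Phi> dt (y 0) c) \<in> O[at_right 0](\<lambda>dt. dt ^ (q + 1))))"

section \<open>Difference coefficients\<close>

definition lagrange :: "int set \<Rightarrow> int \<Rightarrow> real poly" where
  "lagrange A j = (\<Prod>r\<in>A - {j}. smult (1 / (of_int j - of_int r)) [:- of_int r, 1:])"

definition delta :: "nat \<Rightarrow> nat \<Rightarrow> int \<Rightarrow> real" where
  "delta p k j = poly ((pderiv ^^ k) (lagrange {- int p..int p} j)) 0"

definition gam :: "nat \<Rightarrow> nat \<Rightarrow> int \<Rightarrow> int \<Rightarrow> real" where
  "gam p k m j = poly ((pderiv ^^ k) (lagrange {- int p + 1..int p} j)) (of_int m)"

text \<open>The support condition only makes the function \<^typ>\<open>int \<Rightarrow> real\<close> unique outside the index range.\<close>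

definition is_lambda0 :: "nat \<Rightarrow> (int \<Rightarrow> real) \<Rightarrow> bool" where
  "is_lambda0 p lam \<longleftrightarrow>
     delta p 1 (int p) = lam (int p) \<and>
     (\<forall>j\<in>{- int p + 1..int p - 1}. delta p 1 j = lam j - lam (j + 1)) \<and>
     delta p 1 (- int p) = - lam (- int p + 1) \<and>
     (\<forall>j. j \<notin> {- int p + 1..int p} \<longrightarrow> lam j = 0)"

definition lambda0 :: "nat \<Rightarrow> int \<Rightarrow> real" where
  "lambda0 p = (THE lam. is_lambda0 p lam)"

lemma poly_lagrange:
  "poly (lagrange A j) x = (\<Prod>r\<in>A - {j}. (x - of_int r) / (of_int j - of_int r))"
  by (simp add: lagrange_def poly_prod diff_divide_distrib)

lemma sum_lagrange:
  assumes "finite A" "A \<noteq> {}"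
  shows "(\<Sum>j\<in>A. lagrange A j) = 1"
proof (rule ccontr)
  define P where "P = (\<Sum>j\<in>A. lagrange A j) - 1"
  assume "(\<Sum>j\<in>A. lagrange A j) \<noteq> 1"
  then have "P \<noteq> 0" by (simp add: P_def)
  have node: "poly (lagrange A j) (of_int i) = (if i = j then 1 else 0)"
    if "i \<in> A" "j \<in> A" for i j
  proof (cases "i = j")
    case True
    then show ?thesis unfolding poly_lagrange by (simp add: prod.neutral)
  next
    case False
    then have "i \<in> A - {j}" using that by simp
    then show ?thesis using False \<open>finite A\<close>
      by (auto simp: poly_lagrange intro!: prod_zero bexI[of _ i])
  qed
  have "poly P (of_int i) = 0" if "i \<in> A" for i
    using that \<open>finite A\<close> by (simp add: P_def poly_sum node)
  then have "of_int ` A \<subseteq> {x. poly P x = 0}" by auto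
  then have "card (of_int ` A :: real set) \<le> card {x. poly P x = 0}"
    using \<open>P \<noteq> 0\<close> poly_roots_finite by (intro card_mono) auto
  also have "\<dots> \<le> degree P" by (rule card_poly_roots_bound[OF \<open>P \<noteq> 0\<close>])
  also have "\<dots> \<le> card A - 1"
  proof -
    have "degree (lagrange A j) \<le> card A - 1" if "j \<in> A" for j
    proof -
      have "degree (lagrange A j) \<le>
          (\<Sum>r\<in>A - {j}. degree (smult (1 / (of_int j - of_int r)) [:- of_int r, 1 :: real:]))"
        unfolding lagrange_def using \<open>finite A\<close>
        by (intro order.trans[OF degree_prod_sum_le]) (simp_all only: finite_Diff o_def order.refl)
      also have "\<dots> \<le> (\<Sum>r\<in>A - {j}. 1)"
        by (intro sum_mono) (auto simp: order.trans[OF degree_smult_le])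
      finally show ?thesis using that \<open>finite A\<close> by simp
    qed
    then show ?thesis unfolding P_def
      using \<open>finite A\<close> by (intro degree_diff_le degree_sum_le) auto
  qed
  finally have "card (of_int ` A :: real set) \<le> card A - 1" .
  moreover have "card (of_int ` A :: real set) = card A"
    by (intro card_image) (simp add: inj_on_def)
  ultimately show False using assms by (simp add: card_gt_0_iff Suc_leI le_diff_conv2 leD)
qed

lemma sum_delta_1: "(\<Sum>j\<in>{- int p..int p}. delta p 1 j) = 0"
proof -
  have "(\<Sum>j\<in>{- int p..int p}. delta p 1 j)
      = poly (pderiv (\<Sum>j\<in>{- int p..int p}. lagrange {- int p..int p} j)) 0"
    using higher_pderiv_sum[of 1 "lagrange {- int p..int p}" "{- int p..int p}"]
    by (simp add: delta_def poly_sum)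
  then show ?thesis by (simp add: sum_lagrange pderiv_1)
qed

lemma ex1_lambda0:
  assumes "1 \<le> p"
  shows "\<exists>!lam. is_lambda0 p lam"
proof -
  define lam where
    "lam = (\<lambda>j. if j \<in> {- int p + 1..int p} then \<Sum>i\<in>{j..int p}. delta p 1 i else 0)"
  have step: "(\<Sum>i\<in>{j..int p}. delta p 1 i) = delta p 1 j + (\<Sum>i\<in>{j + 1..int p}. delta p 1 i)"
    if "j \<le> int p" for j
  proof -
    have "{j..int p} = insert j {j + 1..int p}" using that by auto
    then show ?thesis by simp
  qed
  have "is_lambda0 p lam"
    unfolding is_lambda0_def
  proof (intro conjI ballI allI impI)
    show "delta p 1 (- int p) = - lam (- int p + 1)"
      using step[of "- int p"] sum_delta_1[of p] assms by (simp add: lam_def)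
  qed (use assms step in \<open>auto simp: lam_def\<close>)
  moreover have "mu = lam" if mu: "is_lambda0 p mu" for mu
  proof
    fix j
    have "mu (int p - int n) = lam (int p - int n)" if "n < 2 * p" for n
      using that
    proof (induction n)
      case 0
      then show ?case using mu assms by (simp add: is_lambda0_def lam_def)
    next
      case (Suc n)
      define j where "j = int p - int (Suc n)"
      have j: "j \<in> {- int p + 1..int p - 1}" "j + 1 = int p - int n"
        using Suc.prems by (auto simp: j_def)
      have "delta p 1 j = mu j - mu (j + 1)"
        "delta p 1 j = lam j - lam (j + 1)"
        using mu \<open>is_lambda0 p lam\<close> j(1) unfolding is_lambda0_def by blast+
      moreover have "mu (j + 1) = lam (j + 1)" using Suc j(2) by simp
      ultimately show ?case by (simp only: flip: j_def)
    qed
    from this[of "nat (int p - j)"] show "mu j = lam j"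
      using mu \<open>is_lambda0 p lam\<close>
      by (cases "j \<in> {- int p + 1..int p}") (auto simp: is_lambda0_def)
  qed
  ultimately show ?thesis by blast
qed

lemma is_lambda0_lambda0: "1 \<le> p \<Longrightarrow> is_lambda0 p (lambda0 p)"
  unfolding lambda0_def by (rule theI'[OF ex1_lambda0])

section \<open>The compact approximate Taylor procedure\<close>

text \<open>\<open>cat_f p f dx dt v k i j\<close> and \<open>cat_w p f dx dt v k i j\<close> are the approximations with upper
  index \<open>(k)\<close> and lower indices \<open>i, j\<close> computed from the nodal values \<open>v\<close>.
  The value \<open>cat_w\<close> at \<open>k = 0\<close> is never used.\<close>

function (sequential)
  cat_w :: "nat \<Rightarrow> ('a \<Rightarrow> 'a) \<Rightarrow> real \<Rightarrow> real \<Rightarrow> (int \<Rightarrow> 'a) \<Rightarrow> nat \<Rightarrow> int \<Rightarrow> int \<Rightarrow> 'a::real_vector" and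
  cat_f :: "nat \<Rightarrow> ('a \<Rightarrow> 'a) \<Rightarrow> real \<Rightarrow> real \<Rightarrow> (int \<Rightarrow> 'a) \<Rightarrow> nat \<Rightarrow> int \<Rightarrow> int \<Rightarrow> 'a" where
  "cat_w p f dx dt v 0 i j = v (i + j)"
| "cat_w p f dx dt v (Suc k) i j =
     - ((1 / dx) *\<^sub>R (\<Sum>r = - int p + 1..int p. gam p 1 j r *\<^sub>R cat_f p f dx dt v k i r))"
| "cat_f p f dx dt v 0 i j = f (v (i + j))"
| "cat_f p f dx dt v (Suc k) i j =
     (1 / dt ^ Suc k) *\<^sub>R (\<Sum>r = - int p + 1..int p. gam p (Suc k) 0 r *\<^sub>R
        f (v (i + j) + (\<Sum>m = 1..Suc k.
             ((of_int r * dt) ^ m / fact m) *\<^sub>R cat_w p f dx dt v m i j)))"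
  by pat_completeness auto
termination
  by (relation "Wellfounded.measure (\<lambda>z. case z of Inl (p, f, dx, dt, v, k, i, j) \<Rightarrow> 2 * k
                             | Inr (p, f, dx, dt, v, k, i, j) \<Rightarrow> 2 * k + 1)") auto

section \<open>The MDRKCAT method\<close>

text \<open>\<open>mdrkcat_flux p r f dx dt c N V i\<close> is the numerical flux at \<open>i + 1/2\<close> built from the stages
  \<open>V \<nu>\<close>, \<open>\<nu> \<in> N\<close>, with weights \<open>c k \<nu>\<close>; it serves both the stages and the final update.\<close>

definition mdrkcat_flux :: "nat \<Rightarrow> nat \<Rightarrow> ('a \<Rightarrow> 'a) \<Rightarrow> real \<Rightarrow> real \<Rightarrow> (nat \<Rightarrow> nat \<Rightarrow> real) \<Rightarrow> nat set \<Rightarrow>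
    (nat \<Rightarrow> int \<Rightarrow> 'a) \<Rightarrow> int \<Rightarrow> 'a::real_vector" where
  "mdrkcat_flux p r f dx dt c N V i =
     (\<Sum>k = 1..r. dt ^ (k - 1) *\<^sub>R (\<Sum>\<nu>\<in>N. c k \<nu> *\<^sub>R
        (\<Sum>j = - int p + 1..int p. lambda0 p j *\<^sub>R cat_f p f dx dt (V \<nu>) (k - 1) i j)))"

lemma mdrkcat_flux_cong [fundef_cong]:
  assumes "p = p'" "r = r'" "f = f'" "dx = dx'" "dt = dt'" "c = c'" "N = N'" "i = i'"
    "\<And>\<nu>. \<nu> \<in> N' \<Longrightarrow> V \<nu> = V' \<nu>"
  shows "mdrkcat_flux p r f dx dt c N V i = mdrkcat_flux p' r' f' dx' dt' c' N' V' i'"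
  using assms by (simp add: mdrkcat_flux_def cong: sum.cong)

function mdrkcat_stage :: "nat \<Rightarrow> nat \<Rightarrow> (nat \<Rightarrow> nat \<Rightarrow> nat \<Rightarrow> real) \<Rightarrow> ('a \<Rightarrow> 'a) \<Rightarrow> real \<Rightarrow> real \<Rightarrow>
    (int \<Rightarrow> 'a) \<Rightarrow> nat \<Rightarrow> int \<Rightarrow> 'a::real_vector" where
  "mdrkcat_stage p r a f dx dt u l =
     (\<lambda>i. u i - (dt / dx) *\<^sub>R
        (mdrkcat_flux p r f dx dt (\<lambda>k \<nu>. a k l \<nu>) {1..<l} (\<lambda>\<nu>. mdrkcat_stage p r a f dx dt u \<nu>) i -
         mdrkcat_flux p r f dx dt (\<lambda>k \<nu>. a k l \<nu>) {1..<l} (\<lambda>\<nu>. mdrkcat_stage p r a f dx dt u \<nu>) (i - 1)))"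
  by auto
termination
  by (relation "Wellfounded.measure (\<lambda>(p, r, a, f, dx, dt, u, l). l)") auto

declare mdrkcat_stage.simps [simp del]

definition mdrkcat_final_flux :: "nat \<Rightarrow> nat \<Rightarrow> nat \<Rightarrow> (nat \<Rightarrow> nat \<Rightarrow> nat \<Rightarrow> real) \<Rightarrow>
    (nat \<Rightarrow> nat \<Rightarrow> real) \<Rightarrow> ('a \<Rightarrow> 'a) \<Rightarrow> real \<Rightarrow> real \<Rightarrow> (int \<Rightarrow> 'a) \<Rightarrow> int \<Rightarrow> 'a::real_vector" where
  "mdrkcat_final_flux p r s a b f dx dt u i =
     mdrkcat_flux p r f dx dt b {1..s} (mdrkcat_stage p r a f dx dt u) i"

section \<open>Consistency\<close>

text \<open>The residual at node \<open>i\<close> of the grid \<open>x\<^sub>i = x0 + i dx\<close> and time level \<open>t\<close>, with the step started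
  from the exact nodal values.\<close>

definition mdrkcat_residual :: "nat \<Rightarrow> nat \<Rightarrow> nat \<Rightarrow> (nat \<Rightarrow> nat \<Rightarrow> nat \<Rightarrow> real) \<Rightarrow>
    (nat \<Rightarrow> nat \<Rightarrow> real) \<Rightarrow> ('a \<Rightarrow> 'a) \<Rightarrow> (real \<Rightarrow> real \<Rightarrow> 'a) \<Rightarrow> real \<Rightarrow> real \<Rightarrow> real \<Rightarrow> real \<Rightarrow> int \<Rightarrow>
    'a::real_vector" where
  "mdrkcat_residual p r s a b f w dx dt x0 t i =
     (let x = (\<lambda>i. x0 + of_int i * dx); F = mdrkcat_final_flux p r s a b f dx dt (\<lambda>i. w (x i) t)
      in w (x i) (t + dt) - w (x i) t + (dt / dx) *\<^sub>R (F i - F (i - 1)))"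

text \<open>The time step is a function \<open>\<tau>\<close> of \<open>dx\<close>. The estimate is uniform over all grid points lying in
  the compact set \<open>K\<close>, since the nodes move as \<open>dx\<close> tends to zero.\<close>

definition mdrkcat_residual_bounded_by :: "nat \<Rightarrow> nat \<Rightarrow> nat \<Rightarrow> (nat \<Rightarrow> nat \<Rightarrow> nat \<Rightarrow> real) \<Rightarrow>
    (nat \<Rightarrow> nat \<Rightarrow> real) \<Rightarrow> ('a \<Rightarrow> 'a) \<Rightarrow> (real \<Rightarrow> real \<Rightarrow> 'a::real_normed_vector) \<Rightarrow>
    (real \<Rightarrow> real) \<Rightarrow> (real \<times> real) set \<Rightarrow> (real \<Rightarrow> real) \<Rightarrow> bool" where
  "mdrkcat_residual_bounded_by p r s a b f w \<tau> K g \<longleftrightarrow>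
     (\<exists>C. \<forall>\<^sub>F dx in at_right 0. \<forall>x0 t i. (x0 + of_int i * dx, t) \<in> K \<longrightarrow>
        norm (mdrkcat_residual p r s a b f w dx (\<tau> dx) x0 t i) \<le> C * g dx)"

definition exact_solution :: "('a \<Rightarrow> 'a) \<Rightarrow> (real \<Rightarrow> real \<Rightarrow> 'a::real_normed_vector) \<Rightarrow>
    (real \<times> real) set \<Rightarrow> bool" where
  "exact_solution f w \<Omega> \<longleftrightarrow> (\<forall>(x, t)\<in>\<Omega>.
     vector_derivative (\<lambda>t. w x t) (at t) + vector_derivative (\<lambda>x. f (w x t)) (at x) = 0)"

end

theory Submission
  imports Defs "HOL-Library.Function_Algebras"
begin

text \<open>Once the approximate time derivatives are multiplied by powers of the time step, only
  \<open>\<sigma> = dt / dx\<close> enters the method. It can therefore be run on formal data: vectors of polynomials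
  in the space variable \<open>x\<close> and the step size \<open>h\<close>, with the flux replaced by its Taylor polynomial and
  the node \<open>i\<close> realised by the translation \<open>x \<mapsto> x + i h\<close>. Accuracy becomes divisibility by powers
  of \<open>h\<close>. The difference formulas make errors divisible by \<open>h ^ (2 * p)\<close>; in the flux difference
  between neighbouring nodes these errors gain one more factor \<open>h\<close>, so that modulo \<open>h ^ (2 * p + 1)\<close> every
  stage is a stage of the underlying Runge--Kutta method applied formally to the conservation law.

  Truncated at total degree \<open>q\<close>, the formal conservation law \<open>y' = - h (f y)\<^sub>x\<close> is a nilpotent polynomial
  system of ordinary differential equations, to which the hypothesis on the order applies. The actual
  residual differs from the value of the formal one by Taylor remainders, uniformly on compact sets.\<close>

section \<open>Vector space structure of polynomials and functions\<close>

text \<open>Two obstacles shape the proof. The order hypothesis concerns finite systems of ordinary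
  differential equations and is asymptotic as the time step tends to zero, whereas \<sigma> stays
  away from zero. Truncation makes the system finite. Since every time derivative is traded for one
  application of \<open>h d/dx\<close>, a step of size \<mu> on data free of \<open>h\<close>
  multiplies the coefficient of \<open>h ^ n\<close> in the formal local error by
  \<open>\<mu> ^ n\<close>. For \<open>n \<le> q\<close>, a bound of size
  \<open>\<mu> ^ (q + 1)\<close> forces that coefficient to vanish for small \<mu>, hence for every
  \<mu>, in particular for \<sigma>.

  The compact differences, on the other hand, are one order short: they reach only
  \<open>h ^ (2 * p)\<close>. But the whole formal method commutes with translations, so the error
  at the neighbouring node is the translate of the error at the given one, and a polynomial minus
  its translate is divisible by \<open>h\<close>. The centred difference encoded in
  \<open>lambda0\<close> already has the higher order.

  Both arguments cover the coefficients with \<open>n \<le> min (2 * p) q\<close>, whence the order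
  of the method.\<close>

instantiation poly :: (real_vector) real_vector
begin

definition scaleR_poly :: "real \<Rightarrow> 'a poly \<Rightarrow> 'a poly" where
  "scaleR_poly c p = map_poly (scaleR c) p"

lemma coeff_scaleR [simp]: "coeff (c *\<^sub>R p) n = c *\<^sub>R coeff (p :: 'a poly) n"
  by (simp add: scaleR_poly_def coeff_map_poly)

instance
  by standard (simp_all add: poly_eq_iff scaleR_add_right scaleR_add_left)

end

text \<open>With the instance for polynomials, \<open>'i \<Rightarrow> real poly poly\<close>
  becomes a legal value type of \<open>cat_f\<close> and \<open>mdrkcat_stage\<close>: formal data
  run through the very definitions used for real vectors.\<close>

instantiation "fun" :: (type, real_vector) real_vector
begin

definition scaleR_fun :: "real \<Rightarrow> ('a \<Rightarrow> 'b) \<Rightarrow> 'a \<Rightarrow> 'b" where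
  "scaleR_fun c f = (\<lambda>x. c *\<^sub>R f x)"

instance
  by standard (simp_all add: scaleR_fun_def fun_eq_iff scaleR_add_right scaleR_add_left)

end

lemma scaleR_fun_apply [simp]: "(c *\<^sub>R f) x = c *\<^sub>R f x"
  by (simp add: scaleR_fun_def)

lemma sum_fun_apply: "(\<Sum>i\<in>A. f i) x = (\<Sum>i\<in>A. f i x)"
  by (induction A rule: infinite_finite_induct) auto

section \<open>Polynomial maps\<close>

text \<open>Monomials are indexed by words \<open>bs\<close> of variables, not by exponent vectors.
  Every ordering of a monomial occurs separately, so Taylor coefficients need only the denominator
  \<open>fact (length bs)\<close>, and differentiation amounts to prepending a letter.\<close>

definition pmap :: "'i set \<Rightarrow> nat \<Rightarrow> ('i \<Rightarrow> 'i list \<Rightarrow> 'r) \<Rightarrow> ('i \<Rightarrow> 'r) \<Rightarrow> 'i \<Rightarrow> 'r::comm_ring_1" where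
  "pmap I N C v c = (\<Sum>bs | set bs \<subseteq> I \<and> length bs \<le> N. C c bs * prod_list (map v bs))"

text \<open>The main tool for polynomial maps: ring homomorphisms, congruences modulo ideals and subrings
  are all instances of a relation respected by the ring operations.\<close>

lemma pmap_param:
  assumes "rel 0 0" "rel 1 1"
    and "\<And>x x' y y'. rel x x' \<Longrightarrow> rel y y' \<Longrightarrow> rel (x + y) (x' + y')"
    and "\<And>x x' y y'. rel x x' \<Longrightarrow> rel y y' \<Longrightarrow> rel (x * y) (x' * y')"
    and C: "\<And>bs. rel (C c bs) (C' c bs)"
    and v: "\<And>b. b \<in> I \<Longrightarrow> rel (v b) (v' b)"
  shows "rel (pmap I N C v c) (pmap I N C' v' c)"
proof -
  have "rel (prod_list (map v bs)) (prod_list (map v' bs))" if "set bs \<subseteq> I" for bs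
    using that by (induction bs) (simp_all add: assms)
  then have *: "rel (C c bs * prod_list (map v bs)) (C' c bs * prod_list (map v' bs))"
    if "set bs \<subseteq> I" for bs
    using that assms(4,5) by blast
  have "rel (\<Sum>bs\<in>B. C c bs * prod_list (map v bs)) (\<Sum>bs\<in>B. C' c bs * prod_list (map v' bs))"
    if "B \<subseteq> {bs. set bs \<subseteq> I}" for B
    using that
  proof (induction B rule: infinite_finite_induct)
    case (insert bs B)
    then show ?case using assms(3)[OF *[of bs] insert.IH] by simp
  qed (simp_all add: assms(1))
  from this[of "{bs. set bs \<subseteq> I \<and> length bs \<le> N}"] show ?thesis
    unfolding pmap_def by auto
qed

text \<open>Functions form a ring under pointwise operations, and evaluation at \<omega> is a
  homomorphism. A family of polynomial maps thus becomes one polynomial map over a function ring, to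
  which \<open>pmap_param\<close> applies.\<close>

lemma pmap_apply: "pmap I N C v c \<omega> = pmap I N (\<lambda>c bs. C c bs \<omega>) (\<lambda>b. v b \<omega>) c"
  by (rule pmap_param[where rel = "\<lambda>x y. x \<omega> = y"]) auto

section \<open>Bivariate polynomials in space and step size\<close>

text \<open>The outer variable is \<open>x\<close>, the inner one \<open>h\<close>:
  \<open>coeff2 g j n\<close> belongs to \<open>x ^ j * h ^ n\<close>.\<close>

abbreviation coeff2 :: "real poly poly \<Rightarrow> nat \<Rightarrow> nat \<Rightarrow> real" where
  "coeff2 g j n \<equiv> coeff (coeff g j) n"

definition hh :: "real poly poly" where "hh = [:[:0, 1:]:]"

lemma coeff2_mult:
  "coeff2 (g * g') j n = (\<Sum>i\<le>j. \<Sum>k\<le>n. coeff2 g i k * coeff2 g' (j - i) (n - k))"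
  by (simp add: coeff_mult coeff_sum)

lemma coeff_hh_power_mult: "coeff (hh ^ m * g) j = [:0, 1:] ^ m * coeff g j"
proof (induction m arbitrary: g)
  case (Suc m)
  have "coeff (hh * f) j = [:0, 1:] * coeff f j" for f by (simp add: hh_def)
  with Suc[of g] show ?case by (simp only: power_Suc mult.assoc)
qed simp

lemma coeff2_hh_power_mult: "coeff2 (hh ^ m * g) j n = (if n < m then 0 else coeff2 g j (n - m))"
proof -
  have "[:0, 1:] ^ m = (monom 1 m :: real poly)" by (simp add: monom_altdef)
  then show ?thesis by (simp add: coeff_hh_power_mult coeff_monom_mult)
qed

lemma hh_power_dvd_iff: "hh ^ m dvd g \<longleftrightarrow> (\<forall>j. \<forall>n<m. coeff2 g j n = 0)"
proof
  assume "hh ^ m dvd g"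
  then show "\<forall>j. \<forall>n<m. coeff2 g j n = 0" by (auto simp: coeff2_hh_power_mult elim!: dvdE)
next
  assume *: "\<forall>j. \<forall>n<m. coeff2 g j n = 0"
  \<comment> \<open>\<open>poly_shift m\<close> divides each coefficient, a polynomial in
    \<open>h\<close>, by \<open>h ^ m\<close>; by assumption nothing is lost.\<close>
  have "g = hh ^ m * map_poly (poly_shift m) g"
    by (intro poly_eqI)
      (use * in \<open>auto simp: coeff2_hh_power_mult coeff_map_poly coeff_poly_shift\<close>)
  then show "hh ^ m dvd g" by (metis dvd_triv_left)
qed

lemma pderiv_hh_power [simp]: "pderiv (hh ^ n) = 0"
proof (induction n)
  case (Suc n)
  have "pderiv hh = 0" by (simp add: hh_def pderiv_pCons)
  with Suc show ?case by (simp add: pderiv_mult)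
qed simp

lemma scaleR_eq_smult: "c *\<^sub>R (g :: real poly poly) = smult [:c:] g"
  by (intro poly_eqI) simp

lemma pderiv_scaleR [simp]: "pderiv (c *\<^sub>R (g :: real poly poly)) = c *\<^sub>R pderiv g"
  by (simp add: scaleR_eq_smult pderiv_smult)

lemma scaleR_mult_poly2 [simp]:
  "c *\<^sub>R g * g' = c *\<^sub>R (g * g')" "g * c *\<^sub>R g' = c *\<^sub>R (g * g' :: real poly poly)"
  by (auto simp: scaleR_eq_smult algebra_simps)

lemma dvd_scaleR: "d dvd g \<Longrightarrow> d dvd c *\<^sub>R (g :: real poly poly)"
  by (simp add: scaleR_eq_smult dvd_smult)

lemma coeff2_pderiv: "coeff2 (pderiv g) j n = real (Suc j) * coeff2 g (Suc j) n"
  by (simp add: coeff_pderiv of_nat_poly del: of_nat_Suc)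

text \<open>Closure is asked for \<open>hh * pderiv\<close>, the only form in which derivatives
  enter. This operator preserves the total degree in \<open>x\<close> and \<open>h\<close>, so
  truncation at a total degree qualifies, although \<open>pderiv\<close> alone would leave that
  ideal.\<close>

definition diff_ideal :: "real poly poly set \<Rightarrow> bool" where
  "diff_ideal J \<longleftrightarrow> 0 \<in> J \<and> (\<forall>x\<in>J. \<forall>y\<in>J. x + y \<in> J) \<and> (\<forall>x\<in>J. \<forall>r. r * x \<in> J) \<and>
     (\<forall>x\<in>J. hh * pderiv x \<in> J)"

lemma diff_idealD:
  assumes "diff_ideal J"
  shows "0 \<in> J" "x \<in> J \<Longrightarrow> y \<in> J \<Longrightarrow> x + y \<in> J" "x \<in> J \<Longrightarrow> r * x \<in> J"
    "x \<in> J \<Longrightarrow> hh * pderiv x \<in> J" "x \<in> J \<Longrightarrow> c *\<^sub>R x \<in> J"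
    "x \<in> J \<Longrightarrow> y \<in> J \<Longrightarrow> x - y \<in> J"
proof -
  show *: "0 \<in> J" "x \<in> J \<Longrightarrow> y \<in> J \<Longrightarrow> x + y \<in> J" "x \<in> J \<Longrightarrow> r * x \<in> J" for x y r
    using assms by (auto simp: diff_ideal_def)
  show "x \<in> J \<Longrightarrow> hh * pderiv x \<in> J" using assms by (auto simp: diff_ideal_def)
  show "x \<in> J \<Longrightarrow> c *\<^sub>R x \<in> J" using *(3)[of x "[:[:c:]:]"] by (simp add: scaleR_eq_smult)
  show "x \<in> J \<Longrightarrow> y \<in> J \<Longrightarrow> x - y \<in> J" using *(2)[of x "(-1) * y"] *(3)[of y "-1"] by simp
qed

lemma diff_ideal_sum:
  assumes "diff_ideal J" "\<And>i. i \<in> A \<Longrightarrow> f i \<in> J"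
  shows "sum f A \<in> J"
  using assms(2) by (induction A rule: infinite_finite_induct) (auto intro: diff_idealD[OF assms(1)])

lemma diff_ideal_mult_cong:
  assumes "diff_ideal J" "x - x' \<in> J" "y - y' \<in> J"
  shows "x * y - x' * y' \<in> J"
proof -
  have "x * y - x' * y' = x * (y - y') + y' * (x - x')" by (simp add: algebra_simps)
  then show ?thesis using assms by (auto intro: diff_idealD[OF assms(1)])
qed

lemma diff_ideal_hh_power: "diff_ideal {g. hh ^ n dvd g}"
proof -
  have "hh ^ n dvd hh * pderiv x" if "hh ^ n dvd x" for x
  proof -
    obtain y where "x = hh ^ n * y" using \<open>hh ^ n dvd x\<close> by (elim dvdE)
    then have "hh * pderiv x = hh ^ n * (hh * pderiv y)" by (simp add: pderiv_mult)
    then show ?thesis by (metis dvd_triv_left)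
  qed
  then show ?thesis by (simp add: diff_ideal_def dvd_add dvd_mult)
qed

text \<open>The power with exponent \<open>M + 1\<close> of the ideal generated by \<open>x\<close>
  and \<open>h\<close>.\<close>

definition trunc_ideal :: "nat \<Rightarrow> real poly poly set" where
  "trunc_ideal M = {g. \<forall>j n. j + n \<le> M \<longrightarrow> coeff2 g j n = 0}"

lemma diff_ideal_trunc_ideal: "diff_ideal (trunc_ideal M)"
proof -
  have "r * x \<in> trunc_ideal M" if "x \<in> trunc_ideal M" for r x
    using that by (auto simp: trunc_ideal_def coeff2_mult intro!: sum.neutral)
  moreover have "hh * pderiv x \<in> trunc_ideal M" if "x \<in> trunc_ideal M" for x
  proof -
    have "coeff2 (hh * pderiv x) j n = 0" if "j + n \<le> M" for j n
      using that \<open>x \<in> trunc_ideal M\<close> coeff2_hh_power_mult[of 1 "pderiv x" j n]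
      by (auto simp: trunc_ideal_def coeff2_pderiv)
    then show ?thesis by (auto simp: trunc_ideal_def)
  qed
  ultimately show ?thesis
    by (auto simp: diff_ideal_def) (auto simp: trunc_ideal_def)
qed

section \<open>Moments of the difference coefficients\<close>

lemma poly_lagrange_node:
  assumes "finite A" "i \<in> A" "j \<in> A"
  shows "poly (lagrange A j) (of_int i) = (if i = j then 1 else 0)"
proof (cases "i = j")
  case True
  then show ?thesis unfolding poly_lagrange by (simp add: prod.neutral)
next
  case False
  then have "i \<in> A - {j}" using assms by simp
  then show ?thesis using False \<open>finite A\<close>
    by (auto simp: poly_lagrange intro!: prod_zero bexI[of _ i])
qed

lemma degree_lagrange_less:
  assumes "finite A" "j \<in> A"
  shows "degree (lagrange A j) < card A"
proof -
  have "degree (lagrange A j) \<le>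
      (\<Sum>r\<in>A - {j}. degree (smult (1 / (of_int j - of_int r)) [:- of_int r, 1 :: real:]))"
    unfolding lagrange_def using \<open>finite A\<close>
    by (intro order.trans[OF degree_prod_sum_le]) (simp_all only: finite_Diff o_def order.refl)
  also have "\<dots> \<le> (\<Sum>r\<in>A - {j}. 1)"
    by (intro sum_mono) (auto simp: order.trans[OF degree_smult_le])
  also have "\<dots> < card A" using assms by (auto simp: card_gt_0_iff intro!: diff_less)
  finally show ?thesis .
qed

lemma lagrange_interpolation:
  assumes "finite A" "degree q < card A"
  shows "(\<Sum>j\<in>A. smult (poly q (of_int j)) (lagrange A j)) = q"
proof (rule poly_eqI_degree[of "of_int ` A"])
  fix x :: real assume "x \<in> of_int ` A"
  then obtain i where i: "i \<in> A" "x = of_int i" by auto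
  have "poly (\<Sum>j\<in>A. smult (poly q (of_int j)) (lagrange A j)) x =
      (\<Sum>j\<in>A. if i = j then poly q (of_int j) else 0)"
    unfolding poly_sum poly_smult i(2)
    by (intro sum.cong refl) (use assms i in \<open>simp add: poly_lagrange_node\<close>)
  then show "poly (\<Sum>j\<in>A. smult (poly q (of_int j)) (lagrange A j)) x = poly q x"
    using assms i by simp
next
  have card: "card (of_int ` A :: real set) = card A"
    by (intro card_image) (simp add: inj_on_def)
  then show "degree q < card (of_int ` A :: real set)" using assms by simp
  show "degree (\<Sum>j\<in>A. smult (poly q (of_int j)) (lagrange A j)) < card (of_int ` A :: real set)"
    unfolding card using assms
    by (intro degree_sum_less le_less_trans[OF degree_smult_le]) (auto simp: degree_lagrange_less)
qed

text \<open>Interpolation on \<open>A\<close> reproduces \<open>x ^ n\<close> for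
  \<open>n < card A\<close>; differentiate this identity \<open>k\<close> times and
  evaluate.\<close>

lemma lagrange_moment:
  assumes "finite A" "n < card A"
  shows "(\<Sum>r\<in>A. poly ((pderiv ^^ k) (lagrange A r)) x * of_int r ^ n) =
    poly ((pderiv ^^ k) (monom 1 n)) x"
proof -
  have "(\<Sum>r\<in>A. smult (of_int r ^ n) (lagrange A r)) = (monom 1 n :: real poly)"
    using lagrange_interpolation[of A "monom 1 n"] assms
    by (simp add: poly_monom degree_monom_eq)
  from arg_cong[OF this, of "\<lambda>q. poly ((pderiv ^^ k) q) x"] show ?thesis
    by (simp add: higher_pderiv_sum higher_pderiv_smult poly_sum mult.commute)
qed

lemma poly_higher_pderiv_monom_0:
  "poly ((pderiv ^^ k) (monom 1 n)) (0::real) = (if n = k then fact k else 0)"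
  by (simp add: poly_0_coeff_0 coeff_higher_pderiv pochhammer_fact)

lemma gam_1_moment:
  assumes "n < 2 * p"
  shows "(\<Sum>r = - int p + 1..int p. gam p 1 m r * of_int r ^ n) = of_nat n * of_int m ^ (n - 1)"
  using lagrange_moment[of "{- int p + 1..int p}" n 1 "of_int m"] assms
  by (simp add: gam_def pderiv_monom poly_monom)

lemma gam_0_moment:
  assumes "n < 2 * p"
  shows "(\<Sum>r = - int p + 1..int p. gam p k 0 r * of_int r ^ n) = (if n = k then fact k else 0)"
  using lagrange_moment[of "{- int p + 1..int p}" n k 0] assms
  by (simp add: gam_def poly_higher_pderiv_monom_0)

text \<open>The stencil has one node more than that of \<open>gam\<close>, so exactness extends to
  degree \<open>2 * p\<close>. This supplies the exponent \<open>2 * p + 1\<close> in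
  \<open>delta_1_consistent\<close>.\<close>

lemma delta_1_moment:
  assumes "n \<le> 2 * p"
  shows "(\<Sum>j = - int p..int p. delta p 1 j * of_int j ^ n) = (if n = 1 then 1 else 0)"
  using lagrange_moment[of "{- int p..int p}" n 1 0] assms poly_higher_pderiv_monom_0[of 1 n]
  by (simp add: delta_def)

text \<open>Summation by parts: the defining relations of \<open>lambda0\<close> make the flux
  difference reproduce the centred formula for the first derivative on the larger stencil.\<close>

lemma sum_lambda0:
  fixes G :: "int \<Rightarrow> 'a::real_vector"
  assumes "1 \<le> p"
  shows "(\<Sum>j = - int p + 1..int p. lambda0 p j *\<^sub>R (G j - G (j - 1))) =
    (\<Sum>j = - int p..int p. delta p 1 j *\<^sub>R G j)"
proof -
  note lam = is_lambda0_lambda0[OF assms, unfolded is_lambda0_def]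
  \<comment> \<open>One formula covers the end points too, because \<open>lambda0\<close> vanishes
    at \<open>- int p\<close> and at \<open>int p + 1\<close>.\<close>
  have delta: "delta p 1 j = lambda0 p j - lambda0 p (j + 1)" if "j \<in> {- int p..int p}" for j
  proof -
    have "j = int p \<or> j = - int p \<or> j \<in> {- int p + 1..int p - 1}" using that by auto
    then show ?thesis using lam by (elim disjE) (auto simp: add.commute)
  qed
  have "(\<Sum>j = - int p..int p. delta p 1 j *\<^sub>R G j) =
      (\<Sum>j = - int p..int p. lambda0 p j *\<^sub>R G j) - (\<Sum>j = - int p..int p. lambda0 p (j + 1) *\<^sub>R G j)"
    by (simp add: delta scaleR_diff_left sum_subtractf del: One_nat_def)
  also have "(\<Sum>j = - int p..int p. lambda0 p j *\<^sub>R G j) =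
      (\<Sum>j = - int p + 1..int p. lambda0 p j *\<^sub>R G j)"
    using lam by (intro sum.mono_neutral_right) auto
  also have "(\<Sum>j = - int p..int p. lambda0 p (j + 1) *\<^sub>R G j) =
      (\<Sum>j = - int p + 1..int p + 1. lambda0 p j *\<^sub>R G (j - 1))"
    by (rule sum.reindex_bij_witness[of _ "\<lambda>j. j - 1" "\<lambda>j. j + 1"]) auto
  also have "\<dots> = (\<Sum>j = - int p + 1..int p. lambda0 p j *\<^sub>R G (j - 1))"
    using lam by (intro sum.mono_neutral_right) auto
  finally show ?thesis by (simp add: sum_subtractf scaleR_diff_right)
qed

section \<open>Translations by multiples of the step size\<close>

definition translate :: "int \<Rightarrow> real poly poly \<Rightarrow> real poly poly" where
  "translate j g = pcompose g [:[:0, of_int j:], 1:]"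

lemma translate_simps [simp]:
  "translate j 0 = 0" "translate j (g + g') = translate j g + translate j g'" "translate j (g - g') = translate j g - translate j g'"
  "translate j (g * g') = translate j g * translate j g'" "translate j [:a:] = [:a:]" "translate j hh = hh"
  "translate j (c *\<^sub>R g) = c *\<^sub>R translate j g" "translate j 1 = 1" "translate j (hh ^ n) = hh ^ n"
proof -
  show *: "translate j (g * g') = translate j g * translate j g'" for g g'
    by (simp add: translate_def pcompose_mult)
  show **: "translate j hh = hh" by (simp add: translate_def hh_def)
  show 1: "translate j 1 = 1" by (simp add: translate_def pcompose_1)
  show "translate j (hh ^ n) = hh ^ n" by (induction n) (simp_all add: * ** 1)
qed (simp_all add: translate_def pcompose_add pcompose_diff pcompose_smult scaleR_eq_smult)

lemma translate_sum [simp]: "translate j (sum g A) = (\<Sum>x\<in>A. translate j (g x))"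
  by (simp add: translate_def pcompose_sum)

lemma translate_translate [simp]: "translate i (translate j g) = translate (i + j) g"
proof -
  have "pcompose [:[:0, of_int j:], 1:] [:[:0, of_int i:], 1:] = [:[:0, of_int (i + j) :: real:], 1:]"
    by (simp add: pcompose_pCons pcompose_1)
  then show ?thesis unfolding translate_def by (simp only: flip: pcompose_assoc)
qed

lemma translate_0 [simp]: "translate 0 g = g"
  by (simp add: translate_def)

definition hD :: "real poly poly \<Rightarrow> real poly poly" where
  "hD g = hh * pderiv g"

lemma hD_simps [simp]: "hD 0 = 0" "hD (g + g') = hD g + hD g'" "hD (c *\<^sub>R g) = c *\<^sub>R hD g"
  "hD (hh * g) = hh * hD g"
  using pderiv_hh_power[of 1]
  by (simp_all add: hD_def pderiv_add pderiv_mult algebra_simps del: pderiv_hh_power)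

lemma hD_power: "(hD ^^ n) g = hh ^ n * (pderiv ^^ n) g"
  by (induction n) (simp_all add: hD_def pderiv_mult algebra_simps)

lemma hD_power_eq_0: "degree g < n \<Longrightarrow> (hD ^^ n) g = 0"
proof -
  assume "degree g < n"
  then have "(pderiv ^^ n) g = 0"
    by (intro poly_eqI) (simp add: coeff_higher_pderiv coeff_eq_0)
  then show ?thesis by (simp add: hD_power)
qed

text \<open>Leibniz rule for \<open>a + x * g\<close>: since \<open>hD x = hh\<close> and
  \<open>hD hh = 0\<close>, at most one of the derivations falls on \<open>x\<close>.\<close>

lemma hD_power_pCons:
  "(hD ^^ Suc n) (pCons a g) = real (Suc n) *\<^sub>R (hh * (hD ^^ n) g) + pCons 0 ((hD ^^ Suc n) g)"
proof (induction n)
  have hD_pCons: "hD (pCons a g) = hh * g + pCons 0 (hD g)" for a g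
    by (simp add: hD_def pderiv_pCons algebra_simps)
  {
    case 0
    show ?case by (simp add: hD_pCons)
  next
    case (Suc n)
    have "(hD ^^ Suc (Suc n)) (pCons a g) = hD ((hD ^^ Suc n) (pCons a g))" by simp
    also have "\<dots> = real (Suc n) *\<^sub>R (hh * hD ((hD ^^ n) g)) + hD (pCons 0 ((hD ^^ Suc n) g))"
      unfolding Suc.IH by simp
    also have "\<dots> = real (Suc (Suc n)) *\<^sub>R (hh * (hD ^^ Suc n) g) + pCons 0 ((hD ^^ Suc (Suc n)) g)"
      using scaleR_add_left[of "real (Suc n)" 1 "hh * hD ((hD ^^ n) g)"] by (simp add: hD_pCons add.commute)
    finally show ?case .
  }
qed

text \<open>Translation is the exponential of \<open>j\<close> times \<open>hD\<close>, and on a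
  polynomial the series terminates. The induction splits off one factor \<open>x\<close>, which
  translation turns into \<open>x + j * h\<close>.\<close>

lemma translate_taylor:
  assumes "degree g \<le> K"
  shows "translate j g = (\<Sum>n\<le>K. (of_int j ^ n / fact n) *\<^sub>R (hD ^^ n) g)"
  using assms
proof (induction g arbitrary: K)
  case (pCons a g)
  show ?case
  proof (cases "g = 0")
    case True
    have *: "(hD ^^ n) [:a:] = 0" if "n \<noteq> 0" for n using that by (intro hD_power_eq_0) simp
    have "(\<Sum>n\<le>K. (of_int j ^ n / fact n) *\<^sub>R (hD ^^ n) [:a:]) = (\<Sum>n\<in>{0::nat}. [:a:])"
      by (intro sum.mono_neutral_cong_right) (auto simp: *)
    then show ?thesis using True by simp
  next
    case False
    then obtain K' where K: "K = Suc K'" "degree g \<le> K'" using pCons.prems by (cases K) auto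
    define t where "t = (\<lambda>n. (of_int j ^ n / fact n) *\<^sub>R (hD ^^ n) g)"
    have pCons_sum: "pCons 0 (sum f A) = (\<Sum>n\<in>A. pCons 0 (f n))" for f :: "nat \<Rightarrow> real poly poly" and A
      by (rule sum_comp_morphism[symmetric, unfolded o_def]) auto
    have "(\<Sum>n\<le>K. (of_int j ^ n / fact n) *\<^sub>R (hD ^^ n) (pCons a g)) =
        pCons a g + (\<Sum>n\<le>K'. (of_int j ^ Suc n / fact (Suc n)) *\<^sub>R (hD ^^ Suc n) (pCons a g))"
      unfolding K by (subst sum.atMost_Suc_shift) simp
    \<comment> \<open>The factor \<open>Suc n\<close> of the Leibniz term cancels in
      \<open>fact (Suc n)\<close>, leaving the Taylor term of index \<open>n\<close> times
      \<open>j * h\<close>.\<close>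
    also have "(\<Sum>n\<le>K'. (of_int j ^ Suc n / fact (Suc n)) *\<^sub>R (hD ^^ Suc n) (pCons a g)) =
        (\<Sum>n\<le>K'. of_int j *\<^sub>R (hh * t n) + pCons 0 (t (Suc n)))"
    proof (intro sum.cong refl)
      fix n
      have gen: "c *\<^sub>R (d *\<^sub>R y + pCons 0 z) = (d * c) *\<^sub>R y + pCons 0 (c *\<^sub>R z)"
        for c d :: real and y z :: "real poly poly"
        by (simp add: scaleR_eq_smult smult_add_right mult.commute)
      have "real (Suc n) * (of_int j ^ Suc n / fact (Suc n)) = of_int j * (of_int j ^ n / fact n)"
        by (simp add: divide_simps)
      then show "(of_int j ^ Suc n / fact (Suc n)) *\<^sub>R (hD ^^ Suc n) (pCons a g) =
          of_int j *\<^sub>R (hh * t n) + pCons 0 (t (Suc n))"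
        unfolding hD_power_pCons t_def gen
        by (simp only: scaleR_mult_poly2 scaleR_scaleR)
    qed
    also have "\<dots> = of_int j *\<^sub>R (hh * translate j g) + pCons 0 (\<Sum>n\<le>K'. t (Suc n))"
      by (simp add: sum.distrib pCons_sum pCons.IH[OF K(2)] t_def sum_distrib_left scaleR_sum_right)
    also have "pCons a g + \<dots> = of_int j *\<^sub>R (hh * translate j g) + [:a:] + pCons 0 (t 0 + (\<Sum>n\<le>K'. t (Suc n)))"
      by (simp add: t_def)
    also have "t 0 + (\<Sum>n\<le>K'. t (Suc n)) = translate j g"
      using pCons.IH[of K] K by (simp add: t_def sum.atMost_Suc_shift del: sum.atMost_Suc)
    also have "of_int j *\<^sub>R (hh * translate j g) + [:a:] + pCons 0 (translate j g) = translate j (pCons a g)"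
      by (simp add: translate_def pcompose_pCons scaleR_eq_smult hh_def)
    finally show ?thesis by simp
  qed
qed (simp add: hD_power)

lemma hh_power_dvd_hD_power: "n \<le> m \<Longrightarrow> hh ^ n dvd (hD ^^ m) g"
  unfolding hD_power by (intro dvd_mult2 le_imp_power_dvd)

text \<open>Only the moments below \<open>L\<close> have to be right: the term of index
  \<open>n\<close> in the Taylor expansion carries \<open>hh ^ n\<close> by \<open>hD_power\<close>,
  so all later ones are divisible anyway.\<close>

lemma stencil_consistent:
  assumes "finite A" "\<And>n. n < L \<Longrightarrow> (\<Sum>r\<in>A. c r * of_int r ^ n) = e n" "degree g \<le> K"
  shows "hh ^ L dvd (\<Sum>r\<in>A. c r *\<^sub>R translate r g) - (\<Sum>n\<le>K. (e n / fact n) *\<^sub>R (hD ^^ n) g)"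
proof -
  have "(\<Sum>r\<in>A. c r *\<^sub>R translate r g) - (\<Sum>n\<le>K. (e n / fact n) *\<^sub>R (hD ^^ n) g) =
      (\<Sum>n\<le>K. ((\<Sum>r\<in>A. c r * of_int r ^ n) / fact n) *\<^sub>R (hD ^^ n) g) -
      (\<Sum>n\<le>K. (e n / fact n) *\<^sub>R (hD ^^ n) g)"
    by (simp add: translate_taylor[OF assms(3)] scaleR_sum_right scaleR_sum_left sum_divide_distrib
        sum.swap[of _ _ A])
  also have "\<dots> = (\<Sum>n\<le>K. (((\<Sum>r\<in>A. c r * of_int r ^ n) - e n) / fact n) *\<^sub>R (hD ^^ n) g)"
    by (simp add: sum_subtractf scaleR_diff_left diff_divide_distrib)
  also have "hh ^ L dvd \<dots>"
  proof (intro dvd_sum)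
    fix n
    show "hh ^ L dvd (((\<Sum>r\<in>A. c r * of_int r ^ n) - e n) / fact n) *\<^sub>R (hD ^^ n) g"
      using assms(2)[of n] by (cases "n < L") (auto intro!: dvd_scaleR hh_power_dvd_hD_power)
  qed
  finally show ?thesis .
qed

lemma gam_1_consistent:
  "hh ^ (2 * p) dvd (\<Sum>r = - int p + 1..int p. gam p 1 j r *\<^sub>R translate r g) - translate j (hD g)"
proof -
  define K where "K = degree g"
  have "degree (hD g) \<le> K"
    by (rule degree_le) (auto simp: hD_def hh_def coeff_pderiv K_def coeff_eq_0)
  from translate_taylor[OF this, of j]
  have "translate j (hD g) = (\<Sum>n\<le>K. (of_int j ^ n / fact n) *\<^sub>R (hD ^^ Suc n) g)"
    by (simp add: funpow_swap1)
  \<comment> \<open>Index shift by one to exhibit the moments of \<open>gam_1_moment\<close>; the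
    new term at index 0 vanishes because of the factor \<open>of_nat n\<close>.\<close>
  also have "\<dots> = (\<Sum>n\<le>Suc K. ((of_nat n * of_int j ^ (n - 1)) / fact n) *\<^sub>R (hD ^^ n) g)"
    by (subst sum.atMost_Suc_shift) (simp add: divide_simps)
  finally show ?thesis
    using stencil_consistent[of "{- int p + 1..int p}" "2 * p" "gam p 1 j" _ g "Suc K", OF _ gam_1_moment]
    by (simp add: K_def)
qed

lemma delta_1_consistent:
  "hh ^ (2 * p + 1) dvd (\<Sum>r = - int p..int p. delta p 1 r *\<^sub>R translate r g) - hD g"
proof -
  define K where "K = Suc (degree g)"
  have "(\<Sum>n\<le>K. ((if n = 1 then 1 else 0) / fact n) *\<^sub>R (hD ^^ n) g) = (\<Sum>n\<in>{1::nat}. hD g)"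
    by (rule sum.mono_neutral_cong_right) (auto simp: K_def)
  then show ?thesis
    using stencil_consistent[of "{- int p..int p}" "2 * p + 1" "delta p 1" _ g K, OF _ delta_1_moment]
    by (simp add: K_def)
qed

lemma hh_dvd_translate_diff: "hh dvd translate i g - translate j g"
proof -
  have "hh dvd translate i g - g" for i
    using stencil_consistent[of "{i}" 1 "\<lambda>_. 1" "\<lambda>n. if n = 0 then 1 else 0" g "degree g"]
      sum.mono_neutral_cong_right[of "{..degree g}" "{0}"
        "\<lambda>n. ((if n = 0 then 1 else 0) / fact n) *\<^sub>R (hD ^^ n) g" "\<lambda>n. (hD ^^ n) g"]
    by simp
  from dvd_diff[OF this[of i] this[of j]] show ?thesis by simp
qed

section \<open>Symmetries of the MDRKCAT method\<close>

text \<open>The values are computed in the order \<open>f\<close> at 0, \<open>w\<close> at 1,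
  \<open>f\<close> at 1, \<open>w\<close> at 2, and so on; accordingly \<open>Pw\<close> is claimed
  from index 1 on.\<close>

lemma cat_induct:
  assumes f0: "\<And>i j. Pf 0 i j"
    and w: "\<And>k i j. (\<And>i j. Pf k i j) \<Longrightarrow> Pw (Suc k) i j"
    and f: "\<And>k i j. (\<And>m i j. m \<in> {1..Suc k} \<Longrightarrow> Pw m i j) \<Longrightarrow> Pf (Suc k) i j"
  shows "Pf k i j" "1 \<le> k \<Longrightarrow> Pw k i j"
proof -
  have "(\<forall>i j. Pf k i j) \<and> (1 \<le> k \<longrightarrow> (\<forall>i j. Pw k i j))" for k
  proof (induction k rule: less_induct)
    case (less k)
    show ?case
    proof (cases k)
      case (Suc k')
      have w': "Pw (Suc k') i j" for i j using w less[of k'] Suc by auto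
      have "Pw m i j" if "m \<in> {1..Suc k'}" for m i j
        using less[of m] w' that Suc by (cases "m = Suc k'") auto
      with f w' show ?thesis unfolding Suc by blast
    qed (simp add: f0)
  qed
  then show "Pf k i j" "1 \<le> k \<Longrightarrow> Pw k i j" by auto
qed

text \<open>Common shape of a stage and of the final update, so that each symmetry of one update
  serves both.\<close>

definition mdrkcat_update :: "nat \<Rightarrow> nat \<Rightarrow> ('a \<Rightarrow> 'a) \<Rightarrow> real \<Rightarrow> real \<Rightarrow> (nat \<Rightarrow> nat \<Rightarrow> real) \<Rightarrow> nat set \<Rightarrow>
    (nat \<Rightarrow> int \<Rightarrow> 'a) \<Rightarrow> (int \<Rightarrow> 'a) \<Rightarrow> int \<Rightarrow> 'a::real_vector" where
  "mdrkcat_update p r f dx dt c N V u i = u i - (dt / dx) *\<^sub>R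
     (mdrkcat_flux p r f dx dt c N V i - mdrkcat_flux p r f dx dt c N V (i - 1))"

lemma mdrkcat_stage_eq_update:
  "mdrkcat_stage p r a f dx dt u l =
    mdrkcat_update p r f dx dt (\<lambda>k \<nu>. a k l \<nu>) {1..<l} (mdrkcat_stage p r a f dx dt u) u"
  by (subst mdrkcat_stage.simps) (simp add: mdrkcat_update_def fun_eq_iff)

lemma mdrkcat_update_cong:
  "(\<And>\<nu>. \<nu> \<in> N \<Longrightarrow> V \<nu> = V' \<nu>) \<Longrightarrow>
    mdrkcat_update p r f dx dt c N V u = mdrkcat_update p r f dx dt c N V' u"
  unfolding mdrkcat_update_def by (intro ext arg_cong2[of _ _ _ _ minus] arg_cong2[of _ _ _ _ scaleR])
    (auto cong: mdrkcat_flux_cong)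

section \<open>Shifting the nodes, rescaling the grid, and shifting the origin of the values\<close>

lemma cat_f_shift_nodes:
  "cat_f p f dx dt v k (i + n) j = cat_f p f dx dt (\<lambda>m. v (m + n)) k i j"
  by (rule cat_induct(1)[where Pf = "\<lambda>k i j. cat_f p f dx dt v k (i + n) j = cat_f p f dx dt (\<lambda>m. v (m + n)) k i j"
      and Pw = "\<lambda>k i j. cat_w p f dx dt v k (i + n) j = cat_w p f dx dt (\<lambda>m. v (m + n)) k i j"])
    (simp_all add: algebra_simps)

lemma mdrkcat_update_shift_nodes:
  "mdrkcat_update p r f dx dt c N V u (i + n) =
    mdrkcat_update p r f dx dt c N (\<lambda>\<nu> m. V \<nu> (m + n)) (\<lambda>m. u (m + n)) i"
proof -
  have "i + n - 1 = (i - 1) + n" by simp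
  then show ?thesis by (simp only: mdrkcat_update_def mdrkcat_flux_def cat_f_shift_nodes)
qed

lemma mdrkcat_stage_shift_nodes:
  "mdrkcat_stage p r a f dx dt u l (i + n) = mdrkcat_stage p r a f dx dt (\<lambda>m. u (m + n)) l i"
proof (induction l arbitrary: i rule: less_induct)
  case (less l)
  have "mdrkcat_stage p r a f dx dt u l (i + n) =
      mdrkcat_update p r f dx dt (\<lambda>k \<nu>. a k l \<nu>) {1..<l}
        (\<lambda>\<nu> m. mdrkcat_stage p r a f dx dt u \<nu> (m + n)) (\<lambda>m. u (m + n)) i"
    by (subst mdrkcat_stage_eq_update) (rule mdrkcat_update_shift_nodes)
  also have "\<dots> = mdrkcat_stage p r a f dx dt (\<lambda>m. u (m + n)) l i"
    by (subst (2) mdrkcat_stage_eq_update)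
      (intro fun_cong[OF mdrkcat_update_cong], auto simp: less fun_eq_iff)
  finally show ?case .
qed

text \<open>Each space difference contributes one factor \<open>1 / dx\<close>, while time enters
  through products of \<open>dt ^ m\<close> with \<open>w\<close> at index \<open>m\<close>, which
  depend on \<open>dt / dx\<close> only.\<close>

lemma cat_f_rescale:
  assumes "dx \<noteq> 0" "dt \<noteq> 0"
  shows "cat_f p f dx dt v k i j = (1 / dx) ^ k *\<^sub>R cat_f p f 1 (dt / dx) v k i j"
proof (rule cat_induct(1)[where Pf = "\<lambda>k i j. cat_f p f dx dt v k i j = (1 / dx) ^ k *\<^sub>R cat_f p f 1 (dt / dx) v k i j"
      and Pw = "\<lambda>k i j. cat_w p f dx dt v k i j = (1 / dx) ^ k *\<^sub>R cat_w p f 1 (dt / dx) v k i j"])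
  fix k i j
  assume "\<And>i j. cat_f p f dx dt v k i j = (1 / dx) ^ k *\<^sub>R cat_f p f 1 (dt / dx) v k i j"
  then show "cat_w p f dx dt v (Suc k) i j = (1 / dx) ^ Suc k *\<^sub>R cat_w p f 1 (dt / dx) v (Suc k) i j"
    by (simp add: scaleR_sum_right mult_ac)
next
  fix k i j
  assume IH: "\<And>m i j. m \<in> {1..Suc k} \<Longrightarrow>
    cat_w p f dx dt v m i j = (1 / dx) ^ m *\<^sub>R cat_w p f 1 (dt / dx) v m i j"
  have 1: "((of_int r * dt) ^ m / fact m) *\<^sub>R cat_w p f dx dt v m i j =
      ((of_int r * (dt / dx)) ^ m / fact m) *\<^sub>R cat_w p f 1 (dt / dx) v m i j"
    if "m \<in> {1..Suc k}" for r m
    using IH[OF that] by (simp add: power_divide power_mult_distrib)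
  have 2: "1 / dt ^ Suc k = (1 / dx) ^ Suc k * (1 / (dt / dx) ^ Suc k)"
    using assms by (simp add: power_divide)
  show "cat_f p f dx dt v (Suc k) i j = (1 / dx) ^ Suc k *\<^sub>R cat_f p f 1 (dt / dx) v (Suc k) i j"
    unfolding cat_f.simps scaleR_scaleR 2 by (simp only: 1 cong: sum.cong)
qed simp

lemma mdrkcat_update_rescale:
  assumes "dx \<noteq> 0" "dt \<noteq> 0"
  shows "mdrkcat_update p r f dx dt c N V u = mdrkcat_update p r f 1 (dt / dx) c N V u"
proof -
  have "mdrkcat_flux p r f dx dt c N V = mdrkcat_flux p r f 1 (dt / dx) c N V"
    unfolding mdrkcat_flux_def fun_eq_iff cat_f_rescale[OF assms]
    by (simp add: scaleR_sum_right power_divide power_one_over mult_ac divide_simps)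
  then show ?thesis by (simp add: mdrkcat_update_def fun_eq_iff)
qed

lemma mdrkcat_stage_rescale:
  assumes "dx \<noteq> 0" "dt \<noteq> 0"
  shows "mdrkcat_stage p r a f dx dt u l = mdrkcat_stage p r a f 1 (dt / dx) u l"
proof (induction l rule: less_induct)
  case (less l)
  show ?case
    by (subst (1 2) mdrkcat_stage_eq_update, subst mdrkcat_update_rescale[OF assms])
      (rule mdrkcat_update_cong, simp add: less)
qed

text \<open>The zeroth moments of the difference formulas vanish, so constants are visible only in
  the flux at index 0, where they cancel in the flux difference. This allows centring the data at
  the value of the solution at the node, where the flux is replaced by a Taylor polynomial without
  constant term.\<close>

lemma cat_f_shift_origin:
  fixes f :: "'a::real_vector \<Rightarrow> 'a"
  assumes "1 \<le> p"
  shows "cat_f p f dx dt v k i j =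
    cat_f p (\<lambda>y. f (w + y) - f w) dx dt (\<lambda>i. v i - w) k i j + (if k = 0 then f w else 0)"
    (is "?f k i j = ?f' k i j + ?c k")
proof -
  let ?w = "cat_w p f dx dt v" and ?w' = "cat_w p (\<lambda>y. f (w + y) - f w) dx dt (\<lambda>i. v i - w)"
  have sum_gam_1: "(\<Sum>r = - int p + 1..int p. gam p 1 m r) = 0" for m
    using gam_1_moment[of 0 p m] assms by simp
  have sum_gam_0: "(\<Sum>r = - int p + 1..int p. gam p (Suc k) 0 r) = 0" for k
    using gam_0_moment[of 0 p "Suc k"] assms by simp
  show ?thesis
  proof (rule cat_induct(1)[where Pf = "\<lambda>k i j. ?f k i j = ?f' k i j + ?c k" and Pw = "\<lambda>k i j. ?w k i j = ?w' k i j"])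
    fix k i j
    assume "\<And>i j. ?f k i j = ?f' k i j + ?c k"
    then show "?w (Suc k) i j = ?w' (Suc k) i j"
      using sum_gam_1[of j]
      by (simp only: cat_w.simps scaleR_add_right sum.distrib flip: scaleR_sum_left) simp
  next
    fix k i j
    assume "\<And>m i j. m \<in> {1..Suc k} \<Longrightarrow> ?w m i j = ?w' m i j"
    then have "(\<Sum>m = 1..Suc k. ((of_int r * dt) ^ m / fact m) *\<^sub>R ?w m i j) =
        (\<Sum>m = 1..Suc k. ((of_int r * dt) ^ m / fact m) *\<^sub>R ?w' m i j)" for r
      by (intro sum.cong) auto
    moreover have "w + (v (i + j) - w + y) = v (i + j) + y" for y by simp
    ultimately show "?f (Suc k) i j = ?f' (Suc k) i j + ?c (Suc k)"
      using sum_gam_0[of k]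
      by (simp only: cat_f.simps scaleR_diff_right sum_subtractf flip: scaleR_sum_left) simp
  qed simp
qed

lemma mdrkcat_update_shift_origin:
  assumes "1 \<le> p"
  shows "mdrkcat_update p r f dx dt c N V u i =
    mdrkcat_update p r (\<lambda>y. f (w + y) - f w) dx dt c N (\<lambda>\<nu> i. V \<nu> i - w) (\<lambda>i. u i - w) i + w"
proof -
  have "mdrkcat_flux p r f dx dt c N V i - mdrkcat_flux p r f dx dt c N V (i - 1) =
    mdrkcat_flux p r (\<lambda>y. f (w + y) - f w) dx dt c N (\<lambda>\<nu> i. V \<nu> i - w) i -
    mdrkcat_flux p r (\<lambda>y. f (w + y) - f w) dx dt c N (\<lambda>\<nu> i. V \<nu> i - w) (i - 1)"
    unfolding mdrkcat_flux_def cat_f_shift_origin[OF assms, of f dx dt _ _ _ _ w]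
    by (simp add: scaleR_add_right sum.distrib)
  then show ?thesis by (simp add: mdrkcat_update_def)
qed

lemma mdrkcat_stage_shift_origin:
  assumes "1 \<le> p"
  shows "mdrkcat_stage p r a f dx dt u l i =
    mdrkcat_stage p r a (\<lambda>y. f (w + y) - f w) dx dt (\<lambda>i. u i - w) l i + w"
proof (induction l arbitrary: i rule: less_induct)
  case (less l)
  have "mdrkcat_stage p r a f dx dt u l i =
      mdrkcat_update p r (\<lambda>y. f (w + y) - f w) dx dt (\<lambda>k \<nu>. a k l \<nu>) {1..<l}
        (\<lambda>\<nu> i. mdrkcat_stage p r a f dx dt u \<nu> i - w) (\<lambda>i. u i - w) i + w"
    by (subst mdrkcat_stage_eq_update) (rule mdrkcat_update_shift_origin[OF assms])
  also have "\<dots> = mdrkcat_stage p r a (\<lambda>y. f (w + y) - f w) dx dt (\<lambda>i. u i - w) l i + w"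
    by (subst (2) mdrkcat_stage_eq_update)
      (intro arg_cong[of _ _ "\<lambda>x. x + w"] fun_cong[OF mdrkcat_update_cong], auto simp: less fun_eq_iff)
  finally show ?case .
qed

text \<open>A relation between families of vectors, indexed by \<open>'o\<close>, that respects linear combinations with
  coefficients from \<open>S\<close> and the flux functions is respected by the whole method.\<close>

locale cat_relation =
  fixes R :: "('o \<Rightarrow> 'a::real_vector) \<Rightarrow> ('o \<Rightarrow> 'b::real_vector) \<Rightarrow> bool"
    and S :: "('o \<Rightarrow> real) set" and f :: "'o \<Rightarrow> 'a \<Rightarrow> 'a" and f' :: "'o \<Rightarrow> 'b \<Rightarrow> 'b"
    and \<sigma> :: "'o \<Rightarrow> real"
  assumes zero: "R (\<lambda>_. 0) (\<lambda>_. 0)"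
    and add: "R x y \<Longrightarrow> R x' y' \<Longrightarrow> R (\<lambda>\<omega>. x \<omega> + x' \<omega>) (\<lambda>\<omega>. y \<omega> + y' \<omega>)"
    and scale: "c \<in> S \<Longrightarrow> R x y \<Longrightarrow> R (\<lambda>\<omega>. c \<omega> *\<^sub>R x \<omega>) (\<lambda>\<omega>. c \<omega> *\<^sub>R y \<omega>)"
    and flux: "R x y \<Longrightarrow> R (\<lambda>\<omega>. f \<omega> (x \<omega>)) (\<lambda>\<omega>. f' \<omega> (y \<omega>))"
    and S_const: "(\<lambda>_. e) \<in> S"
    and S_mult: "c \<in> S \<Longrightarrow> d \<in> S \<Longrightarrow> (\<lambda>\<omega>. c \<omega> * d \<omega>) \<in> S"
    and S_\<sigma>: "\<sigma> \<in> S" "(\<lambda>\<omega>. 1 / \<sigma> \<omega>) \<in> S"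
begin

lemma S_power: "c \<in> S \<Longrightarrow> (\<lambda>\<omega>. c \<omega> ^ n) \<in> S"
  by (induction n) (auto intro: S_const S_mult)

lemma sum: "(\<And>i. i \<in> A \<Longrightarrow> R (x i) (y i)) \<Longrightarrow> R (\<lambda>\<omega>. \<Sum>i\<in>A. x i \<omega>) (\<lambda>\<omega>. \<Sum>i\<in>A. y i \<omega>)"
  by (induction A rule: infinite_finite_induct) (auto intro: zero add)

lemma scale_const: "R x y \<Longrightarrow> R (\<lambda>\<omega>. c *\<^sub>R x \<omega>) (\<lambda>\<omega>. c *\<^sub>R y \<omega>)"
  using scale[OF S_const] .

lemma uminus: "R x y \<Longrightarrow> R (\<lambda>\<omega>. - x \<omega>) (\<lambda>\<omega>. - y \<omega>)"
  using scale_const[of x y "-1"] by simp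

lemma diff: "R x y \<Longrightarrow> R x' y' \<Longrightarrow> R (\<lambda>\<omega>. x \<omega> - x' \<omega>) (\<lambda>\<omega>. y \<omega> - y' \<omega>)"
  using add[OF _ uminus, of x y x' y'] by simp

lemma cat_f:
  assumes v: "\<And>i. R (\<lambda>\<omega>. v \<omega> i) (\<lambda>\<omega>. v' \<omega> i)"
  shows "R (\<lambda>\<omega>. cat_f p (f \<omega>) 1 (\<sigma> \<omega>) (v \<omega>) k i j) (\<lambda>\<omega>. cat_f p (f' \<omega>) 1 (\<sigma> \<omega>) (v' \<omega>) k i j)"
proof (rule cat_induct(1)[where Pw = "\<lambda>k i j. R (\<lambda>\<omega>. cat_w p (f \<omega>) 1 (\<sigma> \<omega>) (v \<omega>) k i j) (\<lambda>\<omega>. cat_w p (f' \<omega>) 1 (\<sigma> \<omega>) (v' \<omega>) k i j)"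
    and Pf = "\<lambda>k i j. R (\<lambda>\<omega>. cat_f p (f \<omega>) 1 (\<sigma> \<omega>) (v \<omega>) k i j) (\<lambda>\<omega>. cat_f p (f' \<omega>) 1 (\<sigma> \<omega>) (v' \<omega>) k i j)"])
  fix k i j
  assume *: "\<And>m i j. m \<in> {1..Suc k} \<Longrightarrow>
    R (\<lambda>\<omega>. cat_w p (f \<omega>) 1 (\<sigma> \<omega>) (v \<omega>) m i j) (\<lambda>\<omega>. cat_w p (f' \<omega>) 1 (\<sigma> \<omega>) (v' \<omega>) m i j)"
  have S1: "(\<lambda>\<omega>. (of_int r * \<sigma> \<omega>) ^ m / fact m) \<in> S" for r m
    using S_mult[OF S_const[of "of_int r ^ m / fact m"] S_power[OF S_\<sigma>(1), of m]]
    by (simp add: power_mult_distrib)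
  have S2: "(\<lambda>\<omega>. 1 / \<sigma> \<omega> ^ Suc k) \<in> S"
    using S_power[OF S_\<sigma>(2), of "Suc k"] by (simp add: power_one_over)
  show "R (\<lambda>\<omega>. cat_f p (f \<omega>) 1 (\<sigma> \<omega>) (v \<omega>) (Suc k) i j) (\<lambda>\<omega>. cat_f p (f' \<omega>) 1 (\<sigma> \<omega>) (v' \<omega>) (Suc k) i j)"
    unfolding cat_f.simps
    by (intro scale[OF S2] sum scale_const flux add v scale[OF S1] *)
qed (simp_all only: cat_w.simps cat_f.simps, (intro uminus scale_const sum flux v; assumption?)+)

lemma mdrkcat_update:
  assumes V: "\<And>\<nu> i. \<nu> \<in> N \<Longrightarrow> R (\<lambda>\<omega>. V \<omega> \<nu> i) (\<lambda>\<omega>. V' \<omega> \<nu> i)"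
    and u: "\<And>i. R (\<lambda>\<omega>. u \<omega> i) (\<lambda>\<omega>. u' \<omega> i)"
  shows "R (\<lambda>\<omega>. mdrkcat_update p r (f \<omega>) 1 (\<sigma> \<omega>) c N (V \<omega>) (u \<omega>) i)
    (\<lambda>\<omega>. mdrkcat_update p r (f' \<omega>) 1 (\<sigma> \<omega>) c N (V' \<omega>) (u' \<omega>) i)"
proof -
  have \<sigma>: "(\<lambda>\<omega>. \<sigma> \<omega> / 1) \<in> S" by (simp add: S_\<sigma>)
  show ?thesis
    unfolding mdrkcat_update_def mdrkcat_flux_def
    by (intro diff u scale[OF \<sigma>] sum scale_const cat_f V scale[OF S_power[OF S_\<sigma>(1)]])
qed

lemma mdrkcat_stage:
  assumes u: "\<And>i. R (\<lambda>\<omega>. u \<omega> i) (\<lambda>\<omega>. u' \<omega> i)"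
  shows "R (\<lambda>\<omega>. mdrkcat_stage p r a (f \<omega>) 1 (\<sigma> \<omega>) (u \<omega>) l i)
    (\<lambda>\<omega>. mdrkcat_stage p r a (f' \<omega>) 1 (\<sigma> \<omega>) (u' \<omega>) l i)"
proof (induction l arbitrary: i rule: less_induct)
  case (less l)
  then show ?case
    by (subst (1 2) mdrkcat_stage_eq_update) (intro mdrkcat_update u, simp)
qed

end

section \<open>Formal Taylor expansion in time\<close>

lemma hD_diff: "hD (x - y) = hD x - hD y"
  by (simp add: hD_def pderiv_diff algebra_simps)

lemma pmap_cong_ideal:
  assumes J: "diff_ideal J" and v: "\<And>b. b \<in> I \<Longrightarrow> v b - v' b \<in> J"
  shows "pmap I N C v c - pmap I N C v' c \<in> J"
proof (rule pmap_param[where rel = "\<lambda>x y. x - y \<in> J"])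
  fix x x' y y' :: "real poly poly"
  assume "x - x' \<in> J" "y - y' \<in> J"
  then show "x + y - (x' + y') \<in> J" using diff_idealD(2)[OF J, of "x - x'" "y - y'"]
    by (simp add: algebra_simps)
qed (use assms diff_idealD(1)[OF J] in \<open>auto intro: diff_ideal_mult_cong[OF J]\<close>)

locale polynomial_flux =
  fixes I :: "'i set" and N :: nat and C :: "'i \<Rightarrow> 'i list \<Rightarrow> real"
begin

text \<open>The flux polynomial over the bivariate polynomials, and over polynomials in a further variable,
  time, with such coefficients.\<close>

definition P2 :: "('i \<Rightarrow> real poly poly) \<Rightarrow> 'i \<Rightarrow> real poly poly" where
  "P2 = pmap I N (\<lambda>c bs. [:[:C c bs:]:])"

definition P3 :: "('i \<Rightarrow> real poly poly poly) \<Rightarrow> 'i \<Rightarrow> real poly poly poly" where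
  "P3 = pmap I N (\<lambda>c bs. [:[:[:C c bs:]:]:])"

text \<open>The coefficients of the solution, as a power series in time, of the conservation law with
  initial value \<open>v\<close>; time and space are both measured in units of the step size.\<close>

fun U :: "('i \<Rightarrow> real poly poly) \<Rightarrow> nat \<Rightarrow> 'i \<Rightarrow> real poly poly" where
  "U v 0 = v"
| "U v (Suc m) =
     (\<lambda>b. - (1 / real (Suc m)) *\<^sub>R hD (coeff (P3 (\<lambda>b. \<Sum>i\<le>m. monom (U v i b) i) b) m))"

definition Upoly :: "('i \<Rightarrow> real poly poly) \<Rightarrow> nat \<Rightarrow> 'i \<Rightarrow> real poly poly poly" where
  "Upoly v K b = (\<Sum>i\<le>K. monom (U v i b) i)"

text \<open>Coefficient of \<open>t ^ k\<close> of the flux along the formal solution. Cutting the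
  solution at \<open>t ^ k\<close> does not affect it, as \<open>coeff_P3_Upoly\<close>
  shows.\<close>

definition G :: "('i \<Rightarrow> real poly poly) \<Rightarrow> nat \<Rightarrow> 'i \<Rightarrow> real poly poly" where
  "G v k b = coeff (P3 (Upoly v k) b) k"

declare U.simps(2) [simp del]

lemma U_Suc: "U v (Suc m) b = - (1 / real (Suc m)) *\<^sub>R hD (G v m b)"
  by (simp add: G_def Upoly_def[abs_def] U.simps(2))

lemma fact_U_Suc: "fact (Suc k) *\<^sub>R U v (Suc k) b = - (fact k *\<^sub>R hD (G v k b))"
  by (simp add: U_Suc)

lemma coeff_Upoly: "coeff (Upoly v K b) m = (if m \<le> K then U v m b else 0)"
  by (auto simp: Upoly_def coeff_sum)

lemma coeff_P3_Upoly:
  assumes "k \<le> K"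
  shows "coeff (P3 (Upoly v K) b) k = G v k b"
proof -
  have "\<forall>i\<le>k. coeff (P3 (Upoly v K) b) i = coeff (P3 (Upoly v k) b) i"
    unfolding P3_def
    by (rule pmap_param[where rel = "\<lambda>x y. \<forall>i\<le>k. coeff x i = coeff y i"])
      (use assms in \<open>auto simp: coeff_mult coeff_Upoly\<close>)
  then show ?thesis by (simp add: G_def)
qed

text \<open>Polynomials in time whose coefficient of \<open>t ^ n\<close> is divisible by
  \<open>h ^ n\<close> form a subring. The formal solution lies in it, since each step of its
  recursion applies \<open>hD\<close> and so adds one factor \<open>h\<close>.\<close>

lemma hh_power_dvd_P3:
  assumes "\<And>b n. hh ^ n dvd coeff (v b) n"
  shows "hh ^ n dvd coeff (P3 v b) n"
proof -
  have "\<forall>n. hh ^ n dvd coeff (P3 v b) n"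
    unfolding P3_def
  proof (rule pmap_param[where rel = "\<lambda>x y. \<forall>n. hh ^ n dvd coeff x n"])
    fix x x' y y' :: "real poly poly poly"
    assume "\<forall>n. hh ^ n dvd coeff x n" "\<forall>n. hh ^ n dvd coeff y n"
    then have "hh ^ (i + j) dvd coeff x i * coeff y j" for i j
      unfolding power_add by (intro mult_dvd_mono) auto
    then show "\<forall>n. hh ^ n dvd coeff (x * y) n"
      unfolding coeff_mult by (metis (no_types, lifting) atMost_iff dvd_sum le_add_diff_inverse)
  qed (use assms in \<open>auto simp: coeff_pCons split: nat.splits\<close>)
  then show ?thesis by simp
qed

lemma hh_power_dvd_hD: "hh ^ n dvd g \<Longrightarrow> hh ^ Suc n dvd hD g"
  by (auto simp: hD_def pderiv_mult elim!: dvdE)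

lemma hh_power_dvd_U: "hh ^ m dvd U v m b"
proof (induction m arbitrary: b rule: less_induct)
  case (less m)
  show ?case
  proof (cases m)
    case (Suc m')
    have "hh ^ m' dvd G v m' b"
      unfolding G_def by (rule hh_power_dvd_P3) (use less Suc in \<open>auto simp: coeff_Upoly\<close>)
    then show ?thesis unfolding Suc U_Suc by (intro dvd_scaleR hh_power_dvd_hD)
  qed simp
qed

lemma hh_power_dvd_coeff_P3_Upoly: "hh ^ n dvd coeff (P3 (Upoly v K) b) n"
  by (rule hh_power_dvd_P3) (simp add: coeff_Upoly hh_power_dvd_U)

lemma U_cong:
  assumes J: "diff_ideal J" and v: "\<And>b. b \<in> I \<Longrightarrow> v b - v' b \<in> J" and "b \<in> I"
  shows "U v m b - U v' m b \<in> J"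
  using \<open>b \<in> I\<close>
proof (induction m arbitrary: b rule: less_induct)
  case (less m)
  show ?case
  proof (cases m)
    case 0
    then show ?thesis using v less.prems by simp
  next
    case (Suc k)
    have "\<forall>n. coeff (P3 (Upoly v k) b) n - coeff (P3 (Upoly v' k) b) n \<in> J"
      unfolding P3_def
    proof (rule pmap_param[where rel = "\<lambda>x y. \<forall>n. coeff x n - coeff y n \<in> J"])
      fix x x' y y' :: "real poly poly poly"
      assume *: "\<forall>n. coeff x n - coeff x' n \<in> J" "\<forall>n. coeff y n - coeff y' n \<in> J"
      show "\<forall>n. coeff (x * y) n - coeff (x' * y') n \<in> J"
        using * by (auto simp: coeff_mult simp flip: sum_subtractf
            intro!: diff_ideal_sum[OF J] diff_ideal_mult_cong[OF J])
      show "\<forall>n. coeff (x + y) n - coeff (x' + y') n \<in> J"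
        using * diff_idealD(2)[OF J, of "coeff x n - coeff x' n" "coeff y n - coeff y' n" for n]
        by (simp add: algebra_simps)
    qed (use less Suc diff_idealD(1)[OF J] in \<open>auto simp: coeff_Upoly\<close>)
    then have "hD (G v k b - G v' k b) \<in> J"
      unfolding hD_def G_def by (intro diff_idealD(4)[OF J]) simp
    then have "(- (1 / real (Suc k))) *\<^sub>R hD (G v k b - G v' k b) \<in> J"
      by (rule diff_idealD(5)[OF J])
    then show ?thesis by (simp only: Suc U_Suc hD_diff scaleR_diff_right)
  qed
qed

lemma P2_translate: "P2 (\<lambda>b. translate j (v b)) c = translate j (P2 v c)"
  unfolding P2_def by (rule pmap_param[where rel = "\<lambda>x y. x = translate j y"]) auto

text \<open>Fixing time at the number \<open>c\<close> is a ring homomorphism and therefore commutes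
  with the flux polynomial.\<close>

lemma P2_eval_Upoly:
  assumes "degree (P3 (Upoly v K) b) \<le> D"
  shows "P2 (\<lambda>b. \<Sum>m\<le>K. c ^ m *\<^sub>R U v m b) b = (\<Sum>n\<le>D. c ^ n *\<^sub>R coeff (P3 (Upoly v K) b) n)"
proof -
  have scale: "c ^ n *\<^sub>R g = g * [:[:c:]:] ^ n" for n and g :: "real poly poly"
  proof -
    have "[:[:c:]:] ^ n = [:[:c ^ n:]:]" by (induction n) (auto simp: one_pCons)
    then show ?thesis by (simp add: scaleR_eq_smult)
  qed
  have "poly (Upoly v K b) [:[:c:]:] = (\<Sum>m\<le>K. c ^ m *\<^sub>R U v m b)" for b
    by (simp add: Upoly_def poly_sum poly_monom scale)
  moreover have "P2 (\<lambda>b. poly (Upoly v K b) [:[:c:]:]) b = poly (P3 (Upoly v K) b) [:[:c:]:]"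
    unfolding P2_def P3_def by (rule pmap_param[where rel = "\<lambda>x y. x = poly y [:[:c:]:]"]) auto
  moreover have "poly (P3 (Upoly v K) b) [:[:c:]:] = (\<Sum>n\<le>D. c ^ n *\<^sub>R coeff (P3 (Upoly v K) b) n)"
    unfolding poly_altdef scale using assms
    by (intro sum.mono_neutral_left) (auto simp: coeff_eq_0)
  ultimately show ?thesis by simp
qed

section \<open>The numerical and the formal method agree up to order 2p\<close>

lemma hh_power_dvd_translate: "hh ^ n dvd g \<Longrightarrow> hh ^ n dvd translate j g"
  by (auto elim!: dvdE)

text \<open>\<open>hh ^ n\<close> is invariant under translation, so the difference falls on the
  cofactor, where \<open>hh_dvd_translate_diff\<close> supplies the additional factor.\<close>

lemma hh_power_dvd_translate_diff: "hh ^ n dvd g \<Longrightarrow> hh ^ (n + 1) dvd g - translate j g"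
proof -
  assume "hh ^ n dvd g"
  then obtain e where e: "g = hh ^ n * e" by (elim dvdE)
  then have "g - translate j g = hh ^ n * (translate 0 e - translate j e)" by (simp add: algebra_simps)
  then show ?thesis by (simp only: power_add power_one_right) (intro mult_dvd_mono hh_dvd_translate_diff, simp)
qed

lemma cat_f_formal:
  assumes "\<sigma> \<noteq> 0"
  shows "hh ^ (2 * p) dvd cat_f p P2 1 \<sigma> (\<lambda>i b. translate i (v b)) k i j b - fact k *\<^sub>R translate (i + j) (G v k b)"
proof -
  let ?f = "cat_f p P2 1 \<sigma> (\<lambda>i b. translate i (v b))" and ?w = "cat_w p P2 1 \<sigma> (\<lambda>i b. translate i (v b))"
  let ?J = "{g. hh ^ (2 * p) dvd g}"
  note J = diff_ideal_hh_power[of "2 * p"]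
  have tr: "g \<in> ?J \<Longrightarrow> translate m g \<in> ?J" for g m by (simp add: hh_power_dvd_translate)
  have "\<forall>b. ?f k i j b - fact k *\<^sub>R translate (i + j) (G v k b) \<in> ?J"
  proof (rule cat_induct(1)[where Pf = "\<lambda>k i j. \<forall>b. ?f k i j b - fact k *\<^sub>R translate (i + j) (G v k b) \<in> ?J"
        and Pw = "\<lambda>k i j. \<forall>b. ?w k i j b - fact k *\<^sub>R translate (i + j) (U v k b) \<in> ?J"])
    fix i j
    have "G v 0 b = P2 v b" for b
      using P2_eval_Upoly[of v 0 b "degree (P3 (Upoly v 0) b)" 0]
      by (simp add: G_def power_0_left if_distrib[where f = "\<lambda>c. c *\<^sub>R _"] cong: if_cong)
    then show "\<forall>b. ?f 0 i j b - fact 0 *\<^sub>R translate (i + j) (G v 0 b) \<in> ?J"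
      by (simp add: P2_translate)
  next
    fix k i j
    assume IH: "\<And>i j. \<forall>b. ?f k i j b - fact k *\<^sub>R translate (i + j) (G v k b) \<in> ?J"
    show "\<forall>b. ?w (Suc k) i j b - fact (Suc k) *\<^sub>R translate (i + j) (U v (Suc k) b) \<in> ?J"
    proof
      fix b
      define g where "g = G v k b"
      define E where "E = (\<lambda>r. ?f k i r b - fact k *\<^sub>R translate (i + r) g)"
      define D where "D = (\<Sum>r = - int p + 1..int p. gam p 1 j r *\<^sub>R translate r g) - translate j (hD g)"
      have "?w (Suc k) i j b = - (\<Sum>r = - int p + 1..int p. gam p 1 j r *\<^sub>R (E r + fact k *\<^sub>R translate (i + r) g))"
        by (simp add: E_def sum_fun_apply)
      also have "\<dots> = - (\<Sum>r = - int p + 1..int p. gam p 1 j r *\<^sub>R E r) -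
          fact k *\<^sub>R translate i (\<Sum>r = - int p + 1..int p. gam p 1 j r *\<^sub>R translate r g)"
        by (simp add: sum.distrib scaleR_add_right scaleR_sum_right mult.commute)
      also have "(\<Sum>r = - int p + 1..int p. gam p 1 j r *\<^sub>R translate r g) = D + translate j (hD g)"
        by (simp add: D_def)
      finally have "?w (Suc k) i j b - fact (Suc k) *\<^sub>R translate (i + j) (U v (Suc k) b) =
          - (\<Sum>r = - int p + 1..int p. gam p 1 j r *\<^sub>R E r) - fact k *\<^sub>R translate i D"
        using arg_cong[OF fact_U_Suc[of k v b], of "translate (i + j)"]
        by (simp add: g_def scaleR_add_right translate_simps(7)[of _ "-1", simplified] del: fact_Suc)
      moreover have "E r \<in> ?J" for r using IH[of i r] by (simp add: E_def g_def)
      moreover have "translate i D \<in> ?J"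
        using gam_1_consistent[of p j g] by (simp add: D_def hh_power_dvd_translate del: translate_simps)
      ultimately show "?w (Suc k) i j b - fact (Suc k) *\<^sub>R translate (i + j) (U v (Suc k) b) \<in> ?J"
        by (auto intro!: dvd_diff dvd_sum dvd_scaleR)
    qed
  next
    fix k i j
    assume IH: "\<And>m i j. m \<in> {1..Suc k} \<Longrightarrow> \<forall>b. ?w m i j b - fact m *\<^sub>R translate (i + j) (U v m b) \<in> ?J"
    define Q where "Q = (\<lambda>b. P3 (Upoly v (Suc k)) b)"
    define arg where "arg = (\<lambda>r b. translate (i + j) (v b) +
      (\<Sum>m = 1..Suc k. ((of_int r * \<sigma>) ^ m / fact m) *\<^sub>R ?w m i j b))"
    have arg: "arg r b - translate (i + j) (\<Sum>m\<le>Suc k. (of_int r * \<sigma>) ^ m *\<^sub>R U v m b) \<in> ?J" for r b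
    proof -
      have "(\<Sum>m\<le>Suc k. (of_int r * \<sigma>) ^ m *\<^sub>R U v m b) = v b + (\<Sum>m = 1..Suc k. (of_int r * \<sigma>) ^ m *\<^sub>R U v m b)"
        unfolding atMost_atLeast0 sum.atLeast_Suc_atMost[OF le0] by simp
      then have "arg r b - translate (i + j) (\<Sum>m\<le>Suc k. (of_int r * \<sigma>) ^ m *\<^sub>R U v m b) =
          (\<Sum>m = 1..Suc k. ((of_int r * \<sigma>) ^ m / fact m) *\<^sub>R (?w m i j b - fact m *\<^sub>R translate (i + j) (U v m b)))"
        by (simp add: arg_def scaleR_diff_right sum_subtractf del: sum.cl_ivl_Suc)
      also have "\<dots> \<in> ?J" by (intro diff_ideal_sum[OF J] diff_idealD(5)[OF J] IH[rule_format])
      finally show ?thesis .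
    qed
    show "\<forall>b. ?f (Suc k) i j b - fact (Suc k) *\<^sub>R translate (i + j) (G v (Suc k) b) \<in> ?J"
    proof
      fix b
      \<comment> \<open>The maximum puts the index \<open>Suc k\<close> into the range of summation
        even if the degree in time is smaller.\<close>
      define D where "D = max (Suc k) (degree (Q b))"
      define q where "q = coeff (Q b)"
      define E where "E = (\<lambda>r. P2 (arg r) b - translate (i + j) (\<Sum>n\<le>D. (of_int r * \<sigma>) ^ n *\<^sub>R q n))"
      define c where "c = (\<lambda>n. (\<Sum>r = - int p + 1..int p. gam p (Suc k) 0 r * of_int r ^ n))"
      have E: "E r \<in> ?J" for r
      proof -
        have "P2 (arg r) b - P2 (\<lambda>b. translate (i + j) (\<Sum>m\<le>Suc k. (of_int r * \<sigma>) ^ m *\<^sub>R U v m b)) b \<in> ?J"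
          unfolding P2_def by (rule pmap_cong_ideal[OF J]) (rule arg)
        moreover have "degree (P3 (Upoly v (Suc k)) b) \<le> D" by (simp add: D_def Q_def)
        ultimately show ?thesis
          unfolding P2_translate E_def q_def Q_def by (simp only: P2_eval_Upoly)
      qed
      have "?f (Suc k) i j b = (1 / \<sigma> ^ Suc k) *\<^sub>R (\<Sum>r = - int p + 1..int p. gam p (Suc k) 0 r *\<^sub>R P2 (arg r) b)"
      proof -
        have "arg r = (\<lambda>b. translate (i + j) (v b)) + (\<Sum>m = 1..Suc k. ((of_int r * \<sigma>) ^ m / fact m) *\<^sub>R ?w m i j)" for r
          by (simp add: arg_def fun_eq_iff sum_fun_apply del: sum.cl_ivl_Suc)
        then show ?thesis by (simp only: cat_f.simps scaleR_fun_apply sum_fun_apply)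
      qed
      also have "\<dots> = (1 / \<sigma> ^ Suc k) *\<^sub>R ((\<Sum>r = - int p + 1..int p. gam p (Suc k) 0 r *\<^sub>R E r) +
          translate (i + j) (\<Sum>r = - int p + 1..int p. gam p (Suc k) 0 r *\<^sub>R (\<Sum>n\<le>D. (of_int r * \<sigma>) ^ n *\<^sub>R q n)))"
        by (simp add: E_def scaleR_diff_right sum_subtractf)
      also have "(\<Sum>r = - int p + 1..int p. gam p (Suc k) 0 r *\<^sub>R (\<Sum>n\<le>D. (of_int r * \<sigma>) ^ n *\<^sub>R q n)) =
          (\<Sum>n\<le>D. (c n * \<sigma> ^ n) *\<^sub>R q n)"
        unfolding c_def scaleR_sum_right scaleR_scaleR sum_distrib_right scaleR_sum_left
        by (subst sum.swap) (simp add: power_mult_distrib mult_ac)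
      \<comment> \<open>Separate the ideal moments, which give exactly the coefficient at
        \<open>Suc k\<close>, from their defects.\<close>
      also have "\<dots> = (\<Sum>n\<le>D. ((c n - (if n = Suc k then fact (Suc k) else 0)) * \<sigma> ^ n) *\<^sub>R q n) +
          (\<Sum>n\<le>D. (if n = Suc k then (fact (Suc k) * \<sigma> ^ Suc k) *\<^sub>R q (Suc k) else 0))"
        by (subst sum.distrib[symmetric], intro sum.cong refl) (auto simp: algebra_simps simp del: fact_Suc power_Suc)
      also have "(\<Sum>n\<le>D. (if n = Suc k then (fact (Suc k) * \<sigma> ^ Suc k) *\<^sub>R q (Suc k) else 0)) =
          (fact (Suc k) * \<sigma> ^ Suc k) *\<^sub>R G v (Suc k) b"
        by (simp add: D_def q_def Q_def G_def del: fact_Suc power_Suc)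
      finally have "?f (Suc k) i j b - fact (Suc k) *\<^sub>R translate (i + j) (G v (Suc k) b) =
          (1 / \<sigma> ^ Suc k) *\<^sub>R ((\<Sum>r = - int p + 1..int p. gam p (Suc k) 0 r *\<^sub>R E r) +
            translate (i + j) (\<Sum>n\<le>D. ((c n - (if n = Suc k then fact (Suc k) else 0)) * \<sigma> ^ n) *\<^sub>R q n))"
        using assms by (simp add: scaleR_add_right del: fact_Suc power_Suc)
      moreover have "((c n - (if n = Suc k then fact (Suc k) else 0)) * \<sigma> ^ n) *\<^sub>R q n \<in> ?J" for n
      proof (cases "n < 2 * p")
        case True
        then show ?thesis using gam_0_moment[of n p "Suc k"] by (simp add: c_def del: fact_Suc)
      next
        \<comment> \<open>From \<open>2 * p\<close> on the moments are uncontrolled, also at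
          \<open>n = Suc k\<close> if that is so large; but then \<open>q n\<close> itself contains
          \<open>hh ^ n\<close>.\<close>
        case False
        then have "hh ^ (2 * p) dvd q n"
          using hh_power_dvd_coeff_P3_Upoly[of n v "Suc k" b]
          by (metis Q_def le_imp_power_dvd linorder_not_less power_le_dvd q_def)
        then show ?thesis by (simp add: dvd_scaleR)
      qed
      ultimately show "?f (Suc k) i j b - fact (Suc k) *\<^sub>R translate (i + j) (G v (Suc k) b) \<in> ?J"
        by (simp only:) (rule diff_idealD(5)[OF J], rule diff_idealD(2)[OF J],
          intro diff_ideal_sum[OF J] diff_idealD(5)[OF J] E, intro tr diff_ideal_sum[OF J], assumption)
    qed
  qed
  then show ?thesis by simp
qed

section \<open>Translation invariance and formal Runge--Kutta updates\<close>

lemma cat_relation_translate: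
  "cat_relation (\<lambda>x y. \<forall>\<omega>::unit. y \<omega> = (\<lambda>b. translate n (x \<omega> b))) UNIV (\<lambda>_. P2) (\<lambda>_. P2) (\<lambda>_. \<sigma>)"
  by unfold_locales (auto simp: P2_translate intro!: ext)

text \<open>On data of this form, translating by \<open>i\<close> and shifting the nodes by
  \<open>i\<close> have the same effect, so node 0 determines all nodes.\<close>

lemma mdrkcat_stage_translate:
  "mdrkcat_stage p r a P2 1 \<sigma> (\<lambda>i b. translate i (v b)) l i b =
    translate i (mdrkcat_stage p r a P2 1 \<sigma> (\<lambda>i b. translate i (v b)) l 0 b)"
  using cat_relation.mdrkcat_stage[OF cat_relation_translate[of i \<sigma>], where u = "\<lambda>_ j b. translate j (v b)" and
      u' = "\<lambda>_ j b. translate (j + i) (v b)" and p = p and r = r and a = a and l = l and i = 0]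
    mdrkcat_stage_shift_nodes[of p r a P2 1 \<sigma> "\<lambda>i b. translate i (v b)" l 0 i]
  by (simp add: add.commute)

lemma cat_f_translate:
  "cat_f p P2 1 \<sigma> (\<lambda>i b. translate i (v b)) k (i + n) j b =
    translate n (cat_f p P2 1 \<sigma> (\<lambda>i b. translate i (v b)) k i j b)"
  using cat_relation.cat_f[OF cat_relation_translate[of n \<sigma>], where v = "\<lambda>_ j b. translate j (v b)" and
      v' = "\<lambda>_ j b. translate (j + n) (v b)" and p = p and k = k and i = i and j = j]
    cat_f_shift_nodes[of p P2 1 \<sigma> "\<lambda>i b. translate i (v b)" k i n j]
  by (simp add: add.commute)

text \<open>A multiderivative Runge--Kutta update of step \<sigma> for the formal conservation law:
  \<open>fact k\<close> times \<open>U (z \<nu>) k\<close> is the time derivative of order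
  \<open>k\<close> at stage \<nu>, that is, the one of order \<open>k - 1\<close> of the right-hand
  side.\<close>

definition formal_update :: "nat \<Rightarrow> real \<Rightarrow> (nat \<Rightarrow> nat \<Rightarrow> real) \<Rightarrow> nat set \<Rightarrow> (nat \<Rightarrow> 'i \<Rightarrow> real poly poly) \<Rightarrow>
    ('i \<Rightarrow> real poly poly) \<Rightarrow> 'i \<Rightarrow> real poly poly" where
  "formal_update r \<sigma> c M z w b =
    w b + (\<Sum>k = 1..r. \<sigma> ^ k *\<^sub>R (\<Sum>\<nu>\<in>M. c k \<nu> *\<^sub>R (fact k *\<^sub>R U (z \<nu>) k b)))"

text \<open>Two errors meet here. The formula encoded in \<open>lambda0\<close> is exact to order
  \<open>2 * p + 1\<close> on the formal flux; the errors of \<open>cat_f\<close>, only of order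
  \<open>2 * p\<close>, enter through differences of translates and gain one factor
  \<open>hh\<close>.\<close>

lemma mdrkcat_update_formal:
  assumes "1 \<le> p" "\<sigma> \<noteq> 0"
  shows "hh ^ (2 * p + 1) dvd
    mdrkcat_update p r P2 1 \<sigma> c M (\<lambda>\<nu> i b. translate i (z \<nu> b)) (\<lambda>i b. translate i (w b)) 0 b -
    formal_update r \<sigma> c M z w b"
proof -
  let ?A = "\<lambda>\<nu> k i j. cat_f p P2 1 \<sigma> (\<lambda>i b. translate i (z \<nu> b)) k i j b"
  let ?J = "{g. hh ^ (2 * p + 1) dvd g}"
  note J = diff_ideal_hh_power[of "2 * p + 1"]
  define B where "B = (\<lambda>\<nu> k. \<Sum>j = - int p + 1..int p. lambda0 p j *\<^sub>R (?A \<nu> k 0 j - ?A \<nu> k (- 1) j))"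
  have B: "B \<nu> k + fact (Suc k) *\<^sub>R U (z \<nu>) (Suc k) b \<in> ?J" for \<nu> k
  proof -
    define g where "g = G (z \<nu>) k b"
    define E where "E = (\<lambda>j. ?A \<nu> k 0 j - fact k *\<^sub>R translate j g)"
    \<comment> \<open>The left interface uses the same stencil one node further left, so its flux,
      error included, is the translate by -1.\<close>
    have "?A \<nu> k (- 1) j = translate (- 1) (?A \<nu> k 0 j)" for j
      using cat_f_translate[of p \<sigma> "z \<nu>" k 0 "-1" j b] by simp
    then have "?A \<nu> k 0 j - ?A \<nu> k (- 1) j =
        (E j - translate (- 1) (E j)) + fact k *\<^sub>R (translate j g - translate (j - 1) g)" for j
      by (simp add: E_def scaleR_diff_right)
    then have "B \<nu> k = (\<Sum>j = - int p + 1..int p. lambda0 p j *\<^sub>R (E j - translate (- 1) (E j))) +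
        fact k *\<^sub>R (\<Sum>j = - int p + 1..int p. lambda0 p j *\<^sub>R (translate j g - translate (j - 1) g))"
      by (simp add: B_def scaleR_add_right sum.distrib scaleR_sum_right mult.commute)
    also have "(\<Sum>j = - int p + 1..int p. lambda0 p j *\<^sub>R (translate j g - translate (j - 1) g)) =
        (\<Sum>j = - int p..int p. delta p 1 j *\<^sub>R translate j g)"
      by (rule sum_lambda0[OF assms(1)])
    finally have "B \<nu> k + fact (Suc k) *\<^sub>R U (z \<nu>) (Suc k) b =
        (\<Sum>j = - int p + 1..int p. lambda0 p j *\<^sub>R (E j - translate (- 1) (E j))) +
        fact k *\<^sub>R ((\<Sum>j = - int p..int p. delta p 1 j *\<^sub>R translate j g) - hD g)"
      by (simp only: fact_U_Suc g_def scaleR_diff_right)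
    also have "\<dots> \<in> ?J"
      using delta_1_consistent[of p g] cat_f_formal[OF assms(2), of p "z \<nu>" k 0 _ b]
      by (intro diff_idealD(2,5)[OF J] diff_ideal_sum[OF J])
        (auto simp: E_def g_def intro!: hh_power_dvd_translate_diff[of "2 * p", simplified] simp del: translate_simps)
    finally show ?thesis .
  qed
  have "mdrkcat_update p r P2 1 \<sigma> c M (\<lambda>\<nu> i b. translate i (z \<nu> b)) (\<lambda>i b. translate i (w b)) 0 b =
      w b - \<sigma> *\<^sub>R (\<Sum>k = 1..r. \<sigma> ^ (k - 1) *\<^sub>R (\<Sum>\<nu>\<in>M. c k \<nu> *\<^sub>R B \<nu> (k - 1)))"
    unfolding mdrkcat_update_def mdrkcat_flux_def B_def
    by (simp add: sum_fun_apply scaleR_diff_right sum_subtractf)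
  also have "\<sigma> *\<^sub>R (\<Sum>k = 1..r. \<sigma> ^ (k - 1) *\<^sub>R (\<Sum>\<nu>\<in>M. c k \<nu> *\<^sub>R B \<nu> (k - 1))) =
      (\<Sum>k = 1..r. \<sigma> ^ k *\<^sub>R (\<Sum>\<nu>\<in>M. c k \<nu> *\<^sub>R B \<nu> (k - 1)))"
    unfolding scaleR_sum_right[of \<sigma>] scaleR_scaleR
    by (intro sum.cong refl) (simp add: power_eq_if[of \<sigma>])
  finally have "mdrkcat_update p r P2 1 \<sigma> c M (\<lambda>\<nu> i b. translate i (z \<nu> b)) (\<lambda>i b. translate i (w b)) 0 b -
      formal_update r \<sigma> c M z w b =
      - (\<Sum>k = 1..r. \<sigma> ^ k *\<^sub>R (\<Sum>\<nu>\<in>M. c k \<nu> *\<^sub>R (B \<nu> (k - 1) + fact k *\<^sub>R U (z \<nu>) k b)))"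
    by (simp add: formal_update_def sum.distrib scaleR_add_right)
  moreover have "B \<nu> (k - 1) + fact k *\<^sub>R U (z \<nu>) k b \<in> ?J" if "k \<in> {1..r}" for \<nu> k
    using B[of \<nu> "k - 1"] that by (cases k) auto
  ultimately show ?thesis
    by (simp only: mem_Collect_eq dvd_minus_iff) (intro dvd_sum dvd_scaleR)
qed

lemma formal_update_cong:
  assumes J: "diff_ideal J" and "\<And>\<nu> b. \<nu> \<in> M \<Longrightarrow> b \<in> I \<Longrightarrow> z \<nu> b - z' \<nu> b \<in> J"
    and "w b - w' b \<in> J" "b \<in> I"
  shows "formal_update r \<sigma> c M z w b - formal_update r \<sigma> c M z' w' b \<in> J"
proof -
  have "formal_update r \<sigma> c M z w b - formal_update r \<sigma> c M z' w' b = (w b - w' b) +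
    (\<Sum>k = 1..r. \<sigma> ^ k *\<^sub>R (\<Sum>\<nu>\<in>M. c k \<nu> *\<^sub>R (fact k *\<^sub>R (U (z \<nu>) k b - U (z' \<nu>) k b))))"
    by (simp add: formal_update_def scaleR_diff_right sum_subtractf)
  also have "\<dots> \<in> J"
    by (intro diff_idealD(2,5)[OF J] diff_ideal_sum[OF J] U_cong[OF J] assms) auto
  finally show ?thesis .
qed

text \<open>The guard makes the decrease of the stage index visible to the termination proof;
  \<open>formal_stage_eq_update\<close> removes it.\<close>

function formal_stage :: "nat \<Rightarrow> (nat \<Rightarrow> nat \<Rightarrow> nat \<Rightarrow> real) \<Rightarrow> real \<Rightarrow> ('i \<Rightarrow> real poly poly) \<Rightarrow> nat \<Rightarrow>
    'i \<Rightarrow> real poly poly" where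
  "formal_stage r a \<sigma> w l =
    formal_update r \<sigma> (\<lambda>k \<nu>. a k l \<nu>) {1..<l} (\<lambda>\<nu>. if \<nu> < l then formal_stage r a \<sigma> w \<nu> else 0) w"
  by auto
termination by (relation "Wellfounded.measure (\<lambda>(r, a, \<sigma>, w, l). l)") auto

declare formal_stage.simps [simp del]

lemma formal_stage_eq_update:
  "formal_stage r a \<sigma> w l = formal_update r \<sigma> (\<lambda>k \<nu>. a k l \<nu>) {1..<l} (formal_stage r a \<sigma> w) w"
  by (subst formal_stage.simps) (simp add: formal_update_def fun_eq_iff)

text \<open>No order is lost from stage to stage, because \<open>formal_update\<close> respects the
  ideal (\<open>formal_update_cong\<close>).\<close>

lemma mdrkcat_stage_formal:
  assumes "1 \<le> p" "\<sigma> \<noteq> 0" "b \<in> I"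
  shows "hh ^ (2 * p + 1) dvd
    mdrkcat_stage p r a P2 1 \<sigma> (\<lambda>i b. translate i (w b)) l 0 b - formal_stage r a \<sigma> w l b"
  using assms(3)
proof (induction l arbitrary: b rule: less_induct)
  case (less l)
  let ?z = "\<lambda>l. mdrkcat_stage p r a P2 1 \<sigma> (\<lambda>i b. translate i (w b)) l 0"
  let ?J = "{g. hh ^ (2 * p + 1) dvd g}"
  note J = diff_ideal_hh_power[of "2 * p + 1"]
  have "?z l b = mdrkcat_update p r P2 1 \<sigma> (\<lambda>k \<nu>. a k l \<nu>) {1..<l}
      (\<lambda>\<nu> i b. translate i (?z \<nu> b)) (\<lambda>i b. translate i (w b)) 0 b"
    by (subst mdrkcat_stage_eq_update) (simp only: flip: mdrkcat_stage_translate)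
  then have "?z l b - formal_update r \<sigma> (\<lambda>k \<nu>. a k l \<nu>) {1..<l} ?z w b \<in> ?J"
    using mdrkcat_update_formal[OF assms(1,2), of r "\<lambda>k \<nu>. a k l \<nu>" "{1..<l}" ?z w b] by simp
  moreover have "formal_update r \<sigma> (\<lambda>k \<nu>. a k l \<nu>) {1..<l} ?z w b - formal_stage r a \<sigma> w l b \<in> ?J"
    by (subst formal_stage_eq_update, rule formal_update_cong[OF J])
      (use less diff_idealD(1)[OF J] in auto)
  ultimately show ?case using diff_idealD(2)[OF J] by fastforce
qed

lemma mdrkcat_final_formal:
  assumes "1 \<le> p" "\<sigma> \<noteq> 0" "b \<in> I"
  shows "hh ^ (2 * p + 1) dvd
    mdrkcat_update p r P2 1 \<sigma> c M (mdrkcat_stage p r a P2 1 \<sigma> (\<lambda>i b. translate i (w b))) (\<lambda>i b. translate i (w b)) 0 b -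
    formal_update r \<sigma> c M (formal_stage r a \<sigma> w) w b"
proof -
  let ?z = "\<lambda>l. mdrkcat_stage p r a P2 1 \<sigma> (\<lambda>i b. translate i (w b)) l 0"
  let ?J = "{g. hh ^ (2 * p + 1) dvd g}"
  note J = diff_ideal_hh_power[of "2 * p + 1"]
  have "mdrkcat_update p r P2 1 \<sigma> c M (mdrkcat_stage p r a P2 1 \<sigma> (\<lambda>i b. translate i (w b))) (\<lambda>i b. translate i (w b)) 0 b -
      formal_update r \<sigma> c M ?z w b \<in> ?J"
    using mdrkcat_update_formal[OF assms(1,2), of r c M ?z w b]
    by (simp flip: mdrkcat_stage_translate)
  moreover have "formal_update r \<sigma> c M ?z w b - formal_update r \<sigma> c M (formal_stage r a \<sigma> w) w b \<in> ?J"
    by (rule formal_update_cong[OF J])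
      (use mdrkcat_stage_formal[OF assms(1,2)] assms diff_idealD(1)[OF J] in auto)
  ultimately show ?thesis using diff_idealD(2)[OF J] by fastforce
qed

end

section \<open>Polynomial vector fields\<close>

inductive_set polyfun :: "nat \<Rightarrow> ((nat \<Rightarrow> real) \<Rightarrow> real) set" for d where
  polyfun_const: "(\<lambda>_. c) \<in> polyfun d"
| polyfun_var: "i < d \<Longrightarrow> (\<lambda>y. y i) \<in> polyfun d"
| polyfun_add: "g \<in> polyfun d \<Longrightarrow> g' \<in> polyfun d \<Longrightarrow> (\<lambda>y. g y + g' y) \<in> polyfun d"
| polyfun_mult: "g \<in> polyfun d \<Longrightarrow> g' \<in> polyfun d \<Longrightarrow> (\<lambda>y. g y * g' y) \<in> polyfun d"

lemma polyfun_sum: "(\<And>i. i \<in> A \<Longrightarrow> g i \<in> polyfun d) \<Longrightarrow> (\<lambda>y. \<Sum>i\<in>A. g i y) \<in> polyfun d"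
  by (induction A rule: infinite_finite_induct) (auto intro: polyfun.intros)

text \<open>The gradient is characterised by the chain rule along all curves: coordinate lines
  recover \<open>partial\<close>, and trajectories of the system give derivatives in time.\<close>

definition has_gradient :: "nat \<Rightarrow> ((nat \<Rightarrow> real) \<Rightarrow> real) \<Rightarrow> (nat \<Rightarrow> (nat \<Rightarrow> real) \<Rightarrow> real) \<Rightarrow> bool" where
  "has_gradient d g g' \<longleftrightarrow> (\<forall>Y Y' s A.
    (\<forall>i<d. ((\<lambda>s. Y s i) has_real_derivative Y' i) (at s within A)) \<longrightarrow>
    ((\<lambda>s. g (Y s)) has_real_derivative (\<Sum>i<d. g' i (Y s) * Y' i)) (at s within A))"

lemma has_gradientD:
  "has_gradient d g g' \<Longrightarrow>
    (\<And>i. i < d \<Longrightarrow> ((\<lambda>s. Y s i) has_real_derivative Y' i) (at s within A)) \<Longrightarrow>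
    ((\<lambda>s. g (Y s)) has_real_derivative (\<Sum>i<d. g' i (Y s) * Y' i)) (at s within A)"
  by (simp add: has_gradient_def)

lemma polyfun_gradient:
  assumes "g \<in> polyfun d"
  shows "\<exists>g'. (\<forall>i. g' i \<in> polyfun d) \<and> has_gradient d g g'"
  using assms
proof induction
  case (polyfun_const c)
  show ?case
    by (intro exI[of _ "\<lambda>_ _. 0"] conjI) (auto simp: has_gradient_def intro: polyfun.intros)
next
  case (polyfun_var i)
  have "(\<Sum>j<d. (if j = i then 1 else 0) * Y' j) = Y' i" for Y' :: "nat \<Rightarrow> real"
    using polyfun_var by (simp add: if_distrib[where f = "\<lambda>c. c * _"] cong: if_cong)
  then have "has_gradient d (\<lambda>y. y i) (\<lambda>j _. if j = i then 1 else 0)"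
    using polyfun_var by (simp add: has_gradient_def)
  then show ?case by (intro exI conjI) (auto intro: polyfun.intros)
next
  case (polyfun_add g1 g2)
  obtain g1' where g1': "\<And>i. g1' i \<in> polyfun d" "has_gradient d g1 g1'"
    using polyfun_add.IH(1) by blast
  obtain g2' where g2': "\<And>i. g2' i \<in> polyfun d" "has_gradient d g2 g2'"
    using polyfun_add.IH(2) by blast
  have "has_gradient d (\<lambda>y. g1 y + g2 y) (\<lambda>i y. g1' i y + g2' i y)"
    unfolding has_gradient_def
    using DERIV_add[OF has_gradientD[OF g1'(2)] has_gradientD[OF g2'(2)]]
    by (simp add: sum.distrib distrib_right)
  then show ?case using g1'(1) g2'(1) by (intro exI conjI) (auto intro: polyfun.intros)
next
  case (polyfun_mult g1 g2)
  obtain g1' where g1': "\<And>i. g1' i \<in> polyfun d" "has_gradient d g1 g1'"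
    using polyfun_mult.IH(1) by blast
  obtain g2' where g2': "\<And>i. g2' i \<in> polyfun d" "has_gradient d g2 g2'"
    using polyfun_mult.IH(2) by blast
  have "has_gradient d (\<lambda>y. g1 y * g2 y) (\<lambda>i y. g1' i y * g2 y + g1 y * g2' i y)"
    unfolding has_gradient_def
  proof (intro allI impI)
    fix Y Y' and s :: real and A
    assume "\<forall>i<d. ((\<lambda>s. Y s i) has_real_derivative Y' i) (at s within A)"
    then have Y: "i < d \<Longrightarrow> ((\<lambda>s. Y s i) has_real_derivative Y' i) (at s within A)" for i by blast
    show "((\<lambda>s. g1 (Y s) * g2 (Y s)) has_real_derivative
        (\<Sum>i<d. (g1' i (Y s) * g2 (Y s) + g1 (Y s) * g2' i (Y s)) * Y' i)) (at s within A)"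
      by (rule DERIV_cong[OF DERIV_mult'[OF has_gradientD[OF g1'(2) Y] has_gradientD[OF g2'(2) Y]]])
        (simp_all add: sum.distrib sum_distrib_left sum_distrib_right algebra_simps)
  qed
  moreover have "(\<lambda>y. g1' i y * g2 y + g1 y * g2' i y) \<in> polyfun d" for i
    using polyfun_mult.hyps g1'(1) g2'(1) by (intro polyfun.intros)
  ultimately show ?case by (intro exI conjI) auto
qed

lemma polyfun_partial_gradient:
  assumes "g \<in> polyfun d"
  shows "i < d \<Longrightarrow> partial i g \<in> polyfun d"
    and "i < d \<Longrightarrow> (\<lambda>z. g (y(i := z))) differentiable (at z)"
    and "(\<And>i. i < d \<Longrightarrow> ((\<lambda>s. Y s i) has_real_derivative Y' i) (at s within A)) \<Longrightarrow>
      ((\<lambda>s. g (Y s)) has_real_derivative (\<Sum>i<d. partial i g (Y s) * Y' i)) (at s within A)"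
proof -
  obtain g' where g': "\<And>i. g' i \<in> polyfun d" "has_gradient d g g'"
    using polyfun_gradient[OF assms] by blast
  have deriv: "((\<lambda>z. g (y(i := z))) has_real_derivative g' i (y(i := z))) (at z)" if "i < d" for i y z
  proof -
    have "((\<lambda>z. (y(i := z)) j) has_real_derivative (if j = i then 1 else 0)) (at z)" for j
      by (auto intro!: derivative_eq_intros)
    from has_gradientD[OF g'(2), of "\<lambda>z. y(i := z)", OF this] show ?thesis
      using that by (simp add: fun_upd_def if_distrib[where f = "\<lambda>c. _ * c"] cong: if_cong)
  qed
  have partial: "partial i g = g' i" if "i < d" for i
    using DERIV_imp_deriv[OF deriv[OF that]] by (simp add: partial_def fun_eq_iff)
  show "i < d \<Longrightarrow> partial i g \<in> polyfun d" by (simp add: partial g')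
  show "i < d \<Longrightarrow> (\<lambda>z. g (y(i := z))) differentiable (at z)"
    using deriv real_differentiable_def by blast
  show "((\<lambda>s. g (Y s)) has_real_derivative (\<Sum>i<d. partial i g (Y s) * Y' i)) (at s within A)"
    if "\<And>i. i < d \<Longrightarrow> ((\<lambda>s. Y s i) has_real_derivative Y' i) (at s within A)"
    using has_gradientD[OF g'(2) that] by (simp add: partial)
qed

lemma continuous_on_polyfun:
  assumes "g \<in> polyfun d"
  shows "continuous_on S g"
  using assms
proof induction
  case (polyfun_var i)
  show ?case by (rule continuous_on_subset[OF continuous_on_product_coordinates]) simp
qed (auto intro!: continuous_intros)

lemma C_k_Rd_polyfun: "g \<in> polyfun d \<Longrightarrow> C_k_Rd d k g"
  by (induction k arbitrary: g) (auto simp: continuous_on_polyfun polyfun_partial_gradient)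

lemma polyfun_time_deriv:
  assumes "\<And>i. (\<lambda>y. \<Phi> y i) \<in> polyfun d"
  shows "(\<lambda>y. time_deriv d \<Phi> k y i) \<in> polyfun d"
proof (induction k arbitrary: i)
  case (Suc k)
  have "(\<lambda>y. \<Sum>j<d. partial j (\<lambda>y. time_deriv d \<Phi> k y i) y * \<Phi> y j) \<in> polyfun d"
    by (intro polyfun_sum polyfun_mult polyfun_partial_gradient Suc assms) simp
  then show ?case by (simp add: time_deriv_def along_def)
qed (simp add: time_deriv_def assms)

section \<open>The formal method inherits the order of the Runge--Kutta method\<close>

lemma coeff2_hD: "coeff2 (hD g) j n = (if n = 0 then 0 else real (Suc j) * coeff2 g (Suc j) (n - 1))"
  using coeff2_hh_power_mult[of 1 "pderiv g" j n] by (auto simp: hD_def coeff2_pderiv)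

lemma trunc_ideal_coeff2: "x - y \<in> trunc_ideal q \<Longrightarrow> j + n \<le> q \<Longrightarrow> coeff2 x j n = coeff2 y j n"
  by (auto simp: trunc_ideal_def)

lemma poly_pderiv_sum_monom:
  "poly (pderiv (\<Sum>m\<le>q. monom (c m) m)) s = (\<Sum>m<q. s ^ m * (real (Suc m) * (c (Suc m) :: real)))"
proof (induction q)
  case (Suc q)
  have "pderiv (monom (c (Suc q)) (Suc q)) = monom (real (Suc q) * c (Suc q)) q"
    by (simp add: pderiv_monom)
  then show ?case
    by (simp only: sum.atMost_Suc pderiv_add poly_add poly_monom Suc.IH sum.lessThan_Suc mult_ac)
qed (simp add: pderiv_monom)

context polynomial_flux
begin

text \<open>Homogeneity in the step size turns the asymptotic bound on the local error of the Runge--Kutta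
  method into the vanishing of the coefficients of the formal local error.\<close>

lemma U_homogeneous:
  assumes "\<And>b j n. coeff2 (v' b) j n = \<mu> ^ n * coeff2 (v b) j n"
  shows "\<mu> ^ m * coeff2 (U v' m b) j n = \<mu> ^ n * coeff2 (U v m b) j n"
proof (induction m arbitrary: b j n rule: less_induct)
  case (less m)
  show ?case
  proof (cases m)
    case 0
    then show ?thesis by (simp add: assms)
  next
    case (Suc k)
    \<comment> \<open>In terms of coefficients of \<open>t ^ i * x ^ j * h ^ n\<close>: the second
      polynomial with time scaled by \<mu> equals the first one with \<open>h\<close> scaled by
      \<mu>.\<close>
    let ?rel = "\<lambda>x y. \<forall>i j n. \<mu> ^ i * coeff2 (coeff y i) j n = \<mu> ^ n * coeff2 (coeff x i) j n"
    have "?rel (P3 (Upoly v k) b) (P3 (Upoly v' k) b)"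
      unfolding P3_def
    proof (rule pmap_param[where rel = ?rel])
      fix x x' y y' :: "real poly poly poly"
      assume x: "?rel x x'" and y: "?rel y y'"
      have coeff3: "coeff2 (coeff (x * y) i) j n = (\<Sum>i'\<le>i. \<Sum>j'\<le>j. \<Sum>n'\<le>n.
        coeff2 (coeff x i') j' n' * coeff2 (coeff y (i - i')) (j - j') (n - n'))" for x y i j n
        by (simp add: coeff_mult[of x] coeff_sum coeff2_mult)
      have "\<mu> ^ i * (coeff2 (coeff x' i') j' n' * coeff2 (coeff y' (i - i')) (j - j') (n - n')) =
        \<mu> ^ n * (coeff2 (coeff x i') j' n' * coeff2 (coeff y (i - i')) (j - j') (n - n'))"
        if "i' \<le> i" "n' \<le> n" for i i' j j' n n'
      proof -
        have "\<mu> ^ i = \<mu> ^ i' * \<mu> ^ (i - i')" using that by (simp flip: power_add)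
        then have "\<mu> ^ i * (coeff2 (coeff x' i') j' n' * coeff2 (coeff y' (i - i')) (j - j') (n - n')) =
            (\<mu> ^ i' * coeff2 (coeff x' i') j' n') * (\<mu> ^ (i - i') * coeff2 (coeff y' (i - i')) (j - j') (n - n'))"
          by (simp only: mult_ac)
        also have "\<dots> = (\<mu> ^ n' * coeff2 (coeff x i') j' n') * (\<mu> ^ (n - n') * coeff2 (coeff y (i - i')) (j - j') (n - n'))"
          by (simp only: x y)
        also have "\<dots> = (\<mu> ^ n' * \<mu> ^ (n - n')) * (coeff2 (coeff x i') j' n' * coeff2 (coeff y (i - i')) (j - j') (n - n'))"
          by (simp only: mult_ac)
        also have "\<mu> ^ n' * \<mu> ^ (n - n') = \<mu> ^ n" using that by (simp flip: power_add)
        finally show ?thesis .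
      qed
      then show "?rel (x * y) (x' * y')"
        unfolding coeff3 sum_distrib_left by (intro allI sum.cong refl) auto
    qed (use less Suc in \<open>auto simp: coeff_Upoly one_pCons coeff_pCons algebra_simps split: nat.splits\<close>)
    then have G: "\<mu> ^ k * coeff2 (G v' k b) j n = \<mu> ^ n * coeff2 (G v k b) j n" for j n
      by (simp add: G_def)
    show ?thesis
      using G[of "Suc j" "n - 1"]
      by (cases n) (simp_all add: Suc U_Suc coeff2_hD del: of_nat_Suc)
  qed
qed

lemma formal_update_homogeneous:
  assumes "\<And>\<nu> b j n. \<nu> \<in> M \<Longrightarrow> coeff2 (z' \<nu> b) j n = \<mu> ^ n * coeff2 (z \<nu> b) j n"
    and "\<And>b j n. coeff2 (w' b) j n = \<mu> ^ n * coeff2 (w b) j n"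
  shows "coeff2 (formal_update r \<mu> c M z' w' b) j n = \<mu> ^ n * coeff2 (formal_update r 1 c M z w b) j n"
proof -
  have eq: "\<mu> ^ k * (c k \<nu> * fact k * coeff2 (U (z' \<nu>) k b) j n) =
      \<mu> ^ n * (c k \<nu> * fact k * coeff2 (U (z \<nu>) k b) j n)" if "\<nu> \<in> M" for k \<nu>
    using U_homogeneous[of "z' \<nu>" \<mu> "z \<nu>" k b j n] assms(1)[OF that] by (simp add: algebra_simps)
  show ?thesis
    by (simp add: formal_update_def coeff_sum assms(2) distrib_left sum_distrib_left)
      (intro sum.cong refl eq)
qed

lemma formal_stage_homogeneous:
  assumes "\<And>b j n. coeff2 (w' b) j n = \<mu> ^ n * coeff2 (w b) j n"
  shows "coeff2 (formal_stage r a \<mu> w' l b) j n = \<mu> ^ n * coeff2 (formal_stage r a 1 w l b) j n"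
proof (induction l arbitrary: b j n rule: less_induct)
  case (less l)
  show ?case
    unfolding formal_stage_eq_update[of r a _ _ l]
    by (rule formal_update_homogeneous) (use less assms in auto)
qed

end

text \<open>The conservation law truncated at total degree \<open>q\<close> in space and step size: a nilpotent system of
  ordinary differential equations, all of whose solutions are polynomials in time. The coordinate
  \<open>i\<close> of a state is the coefficient with index \<open>e i\<close>.\<close>

locale truncated_system = polynomial_flux I N C
  for I :: "'i set" and N :: nat and C :: "'i \<Rightarrow> 'i list \<Rightarrow> real" +
  fixes q D :: nat and e :: "nat \<Rightarrow> 'i \<times> nat \<times> nat" and ix :: "'i \<Rightarrow> nat \<Rightarrow> nat \<Rightarrow> nat"
  assumes e: "i < D \<Longrightarrow> e i = (b, j, n) \<Longrightarrow> b \<in> I \<and> j + n \<le> q \<and> ix b j n = i"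
    and ix: "b \<in> I \<Longrightarrow> j + n \<le> q \<Longrightarrow> ix b j n < D \<and> e (ix b j n) = (b, j, n)"
begin

definition emb :: "(nat \<Rightarrow> real) \<Rightarrow> 'i \<Rightarrow> real poly poly" where
  "emb y b = (\<Sum>j\<le>q. \<Sum>n\<le>q - j. monom (monom (y (ix b j n)) n) j)"

lemma coeff2_emb: "coeff2 (emb y b) j n = (if j + n \<le> q then y (ix b j n) else 0)"
proof -
  have "coeff2 (emb y b) j n = (\<Sum>i\<le>q. if i = j then (\<Sum>m\<le>q - i. if m = n then y (ix b i m) else 0) else 0)"
    unfolding emb_def coeff_sum by (intro sum.cong refl) (auto simp: coeff_sum cong: if_cong)
  then show ?thesis by auto
qed

definition \<Phi> :: "(nat \<Rightarrow> real) \<Rightarrow> nat \<Rightarrow> real" where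
  "\<Phi> y i = (if i < D then case e i of (b, j, n) \<Rightarrow> - coeff2 (hD (P2 (emb y) b)) j n else 0)"

lemma polyfun_\<Phi>: "(\<lambda>y. \<Phi> y i) \<in> polyfun D"
proof (cases "i < D")
  case True
  obtain b j n where i: "e i = (b, j, n)" by (cases "e i")
  let ?reg = "\<lambda>g. \<forall>j n. (\<lambda>y. coeff2 (g y) j n) \<in> polyfun D"
  have "?reg (pmap I N (\<lambda>c bs (y::nat\<Rightarrow>real). [:[:C c bs:]:]) (\<lambda>b y. emb y b) b)"
  proof (rule pmap_param[where rel = "\<lambda>x y. ?reg x"])
    show "?reg (\<lambda>y. emb y b)" if "b \<in> I" for b
      using ix[OF that]
      by (intro allI, rename_tac j n, case_tac "j + n \<le> q") (auto simp: coeff2_emb intro: polyfun.intros)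
    show "?reg (\<lambda>y. [:[:C c bs:]:])" for c bs
      by (auto simp: coeff_pCons split: nat.splits intro: polyfun.intros)
  qed (auto simp: coeff2_mult one_pCons coeff_pCons split: nat.splits intro!: polyfun.intros polyfun_sum)
  then have "?reg (\<lambda>y. P2 (emb y) b)" unfolding pmap_apply P2_def .
  then have "(\<lambda>y. - real (Suc j) * coeff2 (P2 (emb y) b) (Suc j) (n - 1)) \<in> polyfun D"
    by (intro polyfun_mult polyfun_const) auto
  then show ?thesis
    using True by (cases n) (simp_all add: \<Phi>_def i coeff2_hD polyfun_const del: of_nat_Suc)
qed (simp add: \<Phi>_def polyfun_const)

lemma smooth_system_\<Phi>: "smooth_system D \<Phi>"
proof -
  have "\<Phi> y i = 0" if "\<not> i < D" for y i using that by (simp add: \<Phi>_def)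
  then show ?thesis by (auto simp: smooth_system_def Rd_def C_k_Rd_polyfun[OF polyfun_\<Phi>])
qed

text \<open>The solution in closed form. Terms of the formal solution beyond \<open>t ^ q\<close>
  contain \<open>hh ^ (q + 1)\<close> and are invisible after truncation, so a polynomial in time
  remains.\<close>

definition flow_poly :: "(nat \<Rightarrow> real) \<Rightarrow> nat \<Rightarrow> real poly" where
  "flow_poly y i = (case e i of (b, j, n) \<Rightarrow> \<Sum>m\<le>q. monom (coeff2 (U (emb y) m b) j n) m)"

definition flow :: "(nat \<Rightarrow> real) \<Rightarrow> real \<Rightarrow> nat \<Rightarrow> real" where
  "flow y s i = (if i < D then poly (flow_poly y i) s else y i)"

lemma coeff_flow_poly:
  "e i = (b, j, n) \<Longrightarrow> coeff (flow_poly y i) m = (if m \<le> q then coeff2 (U (emb y) m b) j n else 0)"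
  by (auto simp: flow_poly_def coeff_sum)

lemma flow_0: "flow y 0 = y"
proof
  fix i
  obtain b j n where i: "e i = (b, j, n)" by (cases "e i")
  show "flow y 0 i = y i"
    using e[OF _ i] by (auto simp: flow_def poly_0_coeff_0 coeff_flow_poly[OF i] coeff2_emb)
qed

lemma poly_flow_poly:
  "e i = (b, j, n) \<Longrightarrow> poly (flow_poly y i) s = coeff2 (\<Sum>m\<le>q. s ^ m *\<^sub>R U (emb y) m b) j n"
  by (simp add: flow_poly_def poly_sum poly_monom coeff_sum mult.commute)

lemma emb_flow:
  assumes "b \<in> I"
  shows "emb (flow y s) b - (\<Sum>m\<le>q. s ^ m *\<^sub>R U (emb y) m b) \<in> trunc_ideal q"
  using ix[OF assms] poly_flow_poly[of _ b _ _ y s]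
  by (auto simp: trunc_ideal_def coeff2_emb flow_def simp del: coeff_sum)

lemma flow_deriv:
  assumes "i < D"
  shows "poly (pderiv (flow_poly y i)) s = \<Phi> (flow y s) i"
proof -
  obtain b j n where i: "e i = (b, j, n)" by (cases "e i")
  note bjn = e[OF assms i]
  note J = diff_ideal_trunc_ideal[of q]
  define Q where "Q = coeff (P3 (Upoly (emb y) q) b)"
  define K where "K = max q (degree (P3 (Upoly (emb y) q) b))"
  have "hD (P2 (emb (flow y s)) b - P2 (\<lambda>b. \<Sum>m\<le>q. s ^ m *\<^sub>R U (emb y) m b) b) \<in> trunc_ideal q"
    unfolding hD_def P2_def by (intro diff_idealD(4)[OF J] pmap_cong_ideal[OF J] emb_flow)
  then have "coeff2 (hD (P2 (emb (flow y s)) b)) j n =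
      coeff2 (hD (P2 (\<lambda>b. \<Sum>m\<le>q. s ^ m *\<^sub>R U (emb y) m b) b)) j n"
    unfolding hD_diff by (rule trunc_ideal_coeff2) (use bjn in simp)
  also have "P2 (\<lambda>b. \<Sum>m\<le>q. s ^ m *\<^sub>R U (emb y) m b) b = (\<Sum>m\<le>K. s ^ m *\<^sub>R Q m)"
    unfolding Q_def by (rule P2_eval_Upoly) (simp add: K_def)
  also have "coeff2 (hD (\<Sum>m\<le>K. s ^ m *\<^sub>R Q m)) j n = (\<Sum>m\<le>K. s ^ m * coeff2 (hD (Q m)) j n)"
    by (simp add: coeff2_hD coeff_sum sum_distrib_left mult_ac)
  also have "\<dots> = (\<Sum>m<q. s ^ m * coeff2 (hD (G (emb y) m b)) j n)"
  proof (intro sum.mono_neutral_cong_right ballI)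
    \<comment> \<open>From \<open>m = q\<close> on, \<open>hD (Q m)\<close> contains
      \<open>hh ^ Suc m\<close>, beyond the retained powers \<open>n \<le> q\<close>.\<close>
    fix m assume "m \<in> {..K} - {..<q}"
    moreover have "hh ^ Suc m dvd hD (Q m)"
      unfolding Q_def by (intro hh_power_dvd_hD hh_power_dvd_coeff_P3_Upoly)
    ultimately show "s ^ m * coeff2 (hD (Q m)) j n = 0"
      using bjn by (auto simp: hh_power_dvd_iff simp del: power_Suc)
  qed (auto simp: K_def Q_def coeff_P3_Upoly)
  also have "\<dots> = - (\<Sum>m<q. s ^ m * (real (Suc m) * coeff2 (U (emb y) (Suc m) b) j n))"
    by (simp add: U_Suc sum_negf del: of_nat_Suc)
  also have "(\<Sum>m<q. s ^ m * (real (Suc m) * coeff2 (U (emb y) (Suc m) b) j n)) = poly (pderiv (flow_poly y i)) s"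
    by (simp only: flow_poly_def i prod.case poly_pderiv_sum_monom)
  finally show ?thesis using assms by (simp add: \<Phi>_def i)
qed

lemma flow_has_derivative:
  "i < D \<Longrightarrow> ((\<lambda>s. flow y s i) has_real_derivative \<Phi> (flow y s) i) (at s within A)"
  using poly_DERIV[of "flow_poly y i" s, THEN has_field_derivative_at_within[where s = A]]
  by (simp add: flow_def flow_deriv)

text \<open>Differentiating along the vector field agrees with differentiating the explicit flow in
  time. The index \<open>Suc k\<close> arises because \<open>time_deriv\<close> at 0 is already the
  first derivative of the state.\<close>

lemma time_deriv_flow:
  "i < D \<Longrightarrow> time_deriv D \<Phi> k (flow y s) i = poly ((pderiv ^^ Suc k) (flow_poly y i)) s"
proof (induction k arbitrary: i s)
  case 0
  then show ?case by (simp add: time_deriv_def flow_deriv)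
next
  case (Suc k)
  have "((\<lambda>s. time_deriv D \<Phi> k (flow y s) i) has_real_derivative
      (\<Sum>j<D. partial j (\<lambda>y. time_deriv D \<Phi> k y i) (flow y s) * \<Phi> (flow y s) j)) (at s)"
    by (intro polyfun_partial_gradient(3) polyfun_time_deriv polyfun_\<Phi> flow_has_derivative)
  then have "((\<lambda>s. time_deriv D \<Phi> k (flow y s) i) has_real_derivative time_deriv D \<Phi> (Suc k) (flow y s) i) (at s)"
    by (simp add: time_deriv_def along_def)
  moreover have "((\<lambda>s. time_deriv D \<Phi> k (flow y s) i) has_real_derivative
      poly (pderiv ((pderiv ^^ Suc k) (flow_poly y i))) s) (at s)"
    unfolding Suc.IH[OF Suc.prems] by (rule poly_DERIV)
  ultimately show ?case using DERIV_unique by fastforce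
qed

lemma time_deriv_eq_U:
  assumes "b \<in> I" "j + n \<le> q"
  shows "time_deriv D \<Phi> k y (ix b j n) = fact (Suc k) * coeff2 (U (emb y) (Suc k) b) j n"
proof -
  let ?i = "ix b j n"
  note i = ix[OF assms]
  have "time_deriv D \<Phi> k (flow y 0) ?i = fact (Suc k) * coeff (flow_poly y ?i) (Suc k)"
    using i by (simp add: time_deriv_flow poly_0_coeff_0 coeff_higher_pderiv pochhammer_fact[symmetric]
        del: funpow.simps fact_Suc)
  \<comment> \<open>Beyond \<open>q\<close> the flow polynomial has no coefficients; the formal ones
    vanish at the retained positions as well.\<close>
  moreover have "coeff2 (U (emb y) (Suc k) b) j n = 0" if "\<not> Suc k \<le> q"
    using hh_power_dvd_U[of "Suc k" "emb y" b] that assms by (auto simp: hh_power_dvd_iff simp del: power_Suc)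
  ultimately show ?thesis using i coeff_flow_poly[of ?i b j n y "Suc k"] by (auto simp: flow_0)
qed

lemma emb_update:
  assumes "b \<in> I"
    and z: "z = (\<lambda>i. y i + (\<Sum>k = 1..r. dt ^ k * (\<Sum>\<nu>\<in>M. c k \<nu> * time_deriv D \<Phi> (k - 1) (Z \<nu>) i)))"
  shows "emb z b - formal_update r dt c M (\<lambda>\<nu>. emb (Z \<nu>)) (emb y) b \<in> trunc_ideal q"
proof -
  have "coeff2 (emb z b) j n = coeff2 (formal_update r dt c M (\<lambda>\<nu>. emb (Z \<nu>)) (emb y) b) j n"
    if "j + n \<le> q" for j n
  proof -
    have "time_deriv D \<Phi> (k - 1) (Z \<nu>) (ix b j n) = fact k * coeff2 (U (emb (Z \<nu>)) k b) j n"
      if "k \<in> {1..r}" for k \<nu>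
      using time_deriv_eq_U[OF assms(1) \<open>j + n \<le> q\<close>, of "k - 1" "Z \<nu>"] that by (cases k) auto
    then show ?thesis
      using that by (simp add: coeff2_emb z formal_update_def coeff_sum mult.assoc)
  qed
  then show ?thesis by (auto simp: trunc_ideal_def)
qed

lemma emb_mdrk_stage:
  "b \<in> I \<Longrightarrow> emb (mdrk_stage r a D \<Phi> dt y l) b - formal_stage r a dt (emb y) l b \<in> trunc_ideal q"
proof (induction l arbitrary: b rule: less_induct)
  case (less l)
  note J = diff_ideal_trunc_ideal[of q]
  have "emb (mdrk_stage r a D \<Phi> dt y l) b - formal_update r dt (\<lambda>k \<nu>. a k l \<nu>) {1..<l}
      (\<lambda>\<nu>. emb (mdrk_stage r a D \<Phi> dt y \<nu>)) (emb y) b \<in> trunc_ideal q"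
    by (rule emb_update[OF less.prems]) (rule mdrk_stage.simps)
  moreover have "formal_update r dt (\<lambda>k \<nu>. a k l \<nu>) {1..<l}
      (\<lambda>\<nu>. emb (mdrk_stage r a D \<Phi> dt y \<nu>)) (emb y) b - formal_stage r a dt (emb y) l b \<in> trunc_ideal q"
    by (subst formal_stage_eq_update, rule formal_update_cong[OF J])
      (use less diff_idealD(1)[OF J] in auto)
  ultimately show ?case using diff_idealD(2)[OF J] by fastforce
qed

lemma emb_mdrk_step:
  assumes "b \<in> I"
  shows "emb (mdrk_step r s a c D \<Phi> dt y) b -
    formal_update r dt c {1..s} (formal_stage r a dt (emb y)) (emb y) b \<in> trunc_ideal q"
proof -
  note J = diff_ideal_trunc_ideal[of q]
  have "emb (mdrk_step r s a c D \<Phi> dt y) b - formal_update r dt c {1..s}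
      (\<lambda>\<nu>. emb (mdrk_stage r a D \<Phi> dt y \<nu>)) (emb y) b \<in> trunc_ideal q"
    by (rule emb_update[OF assms]) (rule mdrk_step_def)
  moreover have "formal_update r dt c {1..s} (\<lambda>\<nu>. emb (mdrk_stage r a D \<Phi> dt y \<nu>)) (emb y) b -
      formal_update r dt c {1..s} (formal_stage r a dt (emb y)) (emb y) b \<in> trunc_ideal q"
    by (rule formal_update_cong[OF J]) (use assms emb_mdrk_stage diff_idealD(1)[OF J] in auto)
  ultimately show ?thesis using diff_idealD(2)[OF J] by fastforce
qed

text \<open>The formal solution and the formal method respect \<open>trunc_ideal q\<close>, so
  \<open>w\<close> may be replaced by its truncation \<open>y\<close>, a state of the system to
  whose flow the order hypothesis applies.\<close>

lemma formal_order_bigo: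
  assumes "mdrk_has_order r s a c q" "b \<in> I" "j + n \<le> q"
  shows "(\<lambda>dt. coeff2 (\<Sum>m\<le>q. dt ^ m *\<^sub>R U w m b) j n -
      coeff2 (formal_update r dt c {1..s} (formal_stage r a dt w) w b) j n) \<in> O[at_right 0](\<lambda>dt. dt ^ (q + 1))"
proof -
  note J = diff_ideal_trunc_ideal[of q]
  define y where "y i = (if i < D then case e i of (b, j, n) \<Rightarrow> coeff2 (w b) j n else 0)" for i
  have w: "emb y b - w b \<in> trunc_ideal q" if "b \<in> I" for b
    using ix[OF that] by (auto simp: trunc_ideal_def coeff2_emb y_def)
  \<comment> \<open>The flow exists for all times; any positive horizon serves, as the bound
    concerns small \<open>dt\<close>.\<close>
  have ode: "ode_solution D \<Phi> 1 (flow y)"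
    unfolding ode_solution_def
    by (intro ballI conjI allI impI flow_has_derivative) (auto simp: Rd_def flow_def y_def)
  have "(\<lambda>dt. flow y dt (ix b j n) - mdrk_step r s a c D \<Phi> dt (flow y 0) (ix b j n)) \<in>
      O[at_right 0](\<lambda>dt. dt ^ (q + 1))"
    using ix[OF assms(2,3)]
    by (intro assms(1)[unfolded mdrk_has_order_def, rule_format, OF smooth_system_\<Phi> zero_less_one ode]) simp
  moreover have "flow y dt (ix b j n) = coeff2 (\<Sum>m\<le>q. dt ^ m *\<^sub>R U w m b) j n" for dt
  proof -
    have "(\<Sum>m\<le>q. dt ^ m *\<^sub>R U (emb y) m b) - (\<Sum>m\<le>q. dt ^ m *\<^sub>R U w m b) =
        (\<Sum>m\<le>q. dt ^ m *\<^sub>R (U (emb y) m b - U w m b))"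
      by (simp add: scaleR_diff_right sum_subtractf)
    also have "\<dots> \<in> trunc_ideal q"
      by (intro diff_ideal_sum[OF J] diff_idealD(5)[OF J] U_cong[OF J w assms(2)])
    finally show ?thesis
      using trunc_ideal_coeff2 assms ix[OF assms(2,3)] by (simp add: flow_def poly_flow_poly)
  qed
  moreover have "mdrk_step r s a c D \<Phi> dt (flow y 0) (ix b j n) =
      coeff2 (formal_update r dt c {1..s} (formal_stage r a dt w) w b) j n" for dt
  proof -
    have stage: "formal_stage r a dt (emb y) l b - formal_stage r a dt w l b \<in> trunc_ideal q" if "b \<in> I" for l b
      using that
    proof (induction l arbitrary: b rule: less_induct)
      case (less l)
      show ?case
        unfolding formal_stage_eq_update[of r a dt _ l]
        by (rule formal_update_cong[OF J]) (use less w in auto)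
    qed
    have "formal_update r dt c {1..s} (formal_stage r a dt (emb y)) (emb y) b -
        formal_update r dt c {1..s} (formal_stage r a dt w) w b \<in> trunc_ideal q"
      by (rule formal_update_cong[OF J]) (use stage w assms in auto)
    from diff_idealD(2)[OF J emb_mdrk_step[OF assms(2), of r s a c dt y] this]
    have "emb (mdrk_step r s a c D \<Phi> dt y) b -
        formal_update r dt c {1..s} (formal_stage r a dt w) w b \<in> trunc_ideal q" by simp
    from trunc_ideal_coeff2[OF this assms(3)] show ?thesis
      using assms by (simp add: coeff2_emb flow_0)
  qed
  ultimately show ?thesis by simp
qed

end

text \<open>The bound of \<open>formal_order_bigo\<close> becomes an identity by homogeneity in the
  step; \<open>w\<close> is free of \<open>h\<close>, so scaling \<open>h\<close> leaves it
  fixed.\<close>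

lemma (in polynomial_flux) formal_order:
  assumes "finite I" "mdrk_has_order r s a c q" "b \<in> I" "j + n \<le> q" "0 < \<sigma>"
    and w: "\<And>b j n. 0 < n \<Longrightarrow> coeff2 (w b) j n = 0"
  shows "coeff2 (formal_update r \<sigma> c {1..s} (formal_stage r a \<sigma> w) w b) j n =
    coeff2 (\<Sum>m\<le>q. \<sigma> ^ m *\<^sub>R U w m b) j n"
proof -
  \<comment> \<open>Positions of the retained coefficients; enumerating this finite set gives the
    coordinates of the truncated system.\<close>
  define X where "X = I \<times> {(j, n). j + n \<le> q}"
  have "{(j, n). j + n \<le> q} \<subseteq> {..q} \<times> {..q}" by auto
  then have "finite X" unfolding X_def using assms(1) by (intro finite_cartesian_product) (auto intro: finite_subset)
  then obtain e where e: "bij_betw e {0..<card X} X" using ex_bij_betw_nat_finite by blast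
  interpret truncated_system I N C q "card X" e "\<lambda>b j n. inv_into {0..<card X} e (b, j, n)"
  proof
    fix i b j n assume i: "i < card X" "e i = (b, j, n)"
    then have "e i \<in> X" using bij_betw_apply[OF e, of i] by simp
    then show "b \<in> I \<and> j + n \<le> q \<and> inv_into {0..<card X} e (b, j, n) = i"
      using i bij_betw_inv_into_left[OF e, of i] by (auto simp: X_def)
  next
    fix b j n assume "b \<in> I" "j + n \<le> q"
    then have "(b, j, n) \<in> X" by (auto simp: X_def)
    then show "inv_into {0..<card X} e (b, j, n) < card X \<and> e (inv_into {0..<card X} e (b, j, n)) = (b, j, n)"
      using bij_betw_inv_into_right[OF e] bij_betw_inv_into[OF e] by (auto simp: bij_betw_def)
  qed
  define \<rho> where "\<rho> \<mu> = coeff2 (\<Sum>m\<le>q. \<mu> ^ m *\<^sub>R U w m b) j n -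
      coeff2 (formal_update r \<mu> c {1..s} (formal_stage r a \<mu> w) w b) j n" for \<mu>
  have w': "coeff2 (w b) j n = \<mu> ^ n * coeff2 (w b) j n" for \<mu> b j n by (cases "n = 0") (auto simp: w)
  have U: "coeff2 (\<Sum>m\<le>q. \<mu> ^ m *\<^sub>R U w m b) j n = \<mu> ^ n * coeff2 (\<Sum>m\<le>q. 1 ^ m *\<^sub>R U w m b) j n" for \<mu>
    unfolding coeff_sum coeff_scaleR sum_distrib_left real_scaleR_def power_one mult_1
    by (rule sum.cong[OF refl], rule U_homogeneous, rule w')
  have F: "coeff2 (formal_update r \<mu> c {1..s} (formal_stage r a \<mu> w) w b) j n =
      \<mu> ^ n * coeff2 (formal_update r 1 c {1..s} (formal_stage r a 1 w) w b) j n" for \<mu>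
    by (rule formal_update_homogeneous, rule formal_stage_homogeneous, rule w', rule w')
  have \<rho>: "\<rho> \<mu> = \<mu> ^ n * \<rho> 1" for \<mu>
    unfolding \<rho>_def by (subst U, subst F) (rule right_diff_distrib[symmetric])
  have "\<rho> 1 = 0"
  proof (rule ccontr)
    assume *: "\<rho> 1 \<noteq> 0"
    have eq: "\<rho> = (\<lambda>\<mu>. \<mu> ^ n * \<rho> 1)" by (rule ext) (rule \<rho>)
    have "\<rho> \<in> O[at_right 0](\<lambda>dt. dt ^ (q + 1))"
      using formal_order_bigo[OF assms(2-4), of w] unfolding \<rho>_def .
    then have "(\<lambda>\<mu>. \<mu> ^ n * \<rho> 1) \<in> O[at_right 0](\<lambda>dt. dt ^ (q + 1))"
      by (subst eq[symmetric])
    then have "(\<lambda>\<mu>::real. \<mu> ^ n) \<in> O[at_right 0](\<lambda>dt. dt ^ (q + 1))"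
      using * by (simp add: mult.commute)
    \<comment> \<open>With \<open>n < q + 1\<close> this makes \<open>\<mu> ^ n\<close> negligible
      against itself.\<close>
    moreover have "(\<lambda>dt::real. dt ^ (q + 1)) \<in> o[at_right 0](\<lambda>\<mu>. \<mu> ^ n)"
    proof (rule smalloI_tendsto)
      have "((\<lambda>x::real. x ^ (q + 1 - n)) \<longlongrightarrow> 0 ^ (q + 1 - n)) (at_right 0)" by (intro tendsto_intros)
      then have "((\<lambda>x::real. x ^ (q + 1 - n)) \<longlongrightarrow> 0) (at_right 0)" using assms(4) by (simp add: power_0_left)
      moreover have "\<forall>\<^sub>F x::real in at_right 0. x ^ (q + 1 - n) = x ^ (q + 1) / x ^ n"
        using eventually_at_right_less[of "0::real"]
        by eventually_elim (use assms(4) in \<open>simp add: power_diff\<close>)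
      ultimately show "((\<lambda>x::real. x ^ (q + 1) / x ^ n) \<longlongrightarrow> 0) (at_right 0)" by (rule Lim_transform_eventually)
      show "\<forall>\<^sub>F x::real in at_right 0. x ^ n \<noteq> 0"
        using eventually_at_right_less[of "0::real"] by eventually_elim auto
    qed
    ultimately have "(\<lambda>\<mu>::real. \<mu> ^ n) \<in> o[at_right 0](\<lambda>\<mu>. \<mu> ^ n)"
      by (rule landau_o.big_small_trans)
    then have "\<forall>\<^sub>F x::real in at_right 0. x ^ n = 0" by (simp add: landau_o.small_refl_iff)
    moreover have "\<forall>\<^sub>F x::real in at_right 0. x ^ n \<noteq> 0"
      using eventually_at_right_less[of "0::real"] by eventually_elim auto
    ultimately have "\<forall>\<^sub>F x::real in at_right 0. False" by eventually_elim simp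
    then show False by simp
  qed
  then have "\<rho> \<sigma> = 0" by (subst \<rho>) simp
  then show ?thesis by (simp add: \<rho>_def)
qed

section \<open>Jets of exact solutions\<close>

text \<open>In \<open>p\<close> the variable \<open>h\<close> stands for time, and the assumption
  \<open>jet\<close> is the conservation law written for coefficients. Trading time derivatives for
  \<open>hD\<close> puts \<open>h ^ m\<close> beside \<open>t ^ m\<close>, so the formal solution
  started from the part of \<open>p\<close> at time zero is \<open>p\<close> sorted by powers of
  \<open>h\<close>.\<close>

lemma (in polynomial_flux) U_jet:
  assumes jet: "\<And>b j n. b \<in> I \<Longrightarrow> 0 < n \<Longrightarrow> j + n \<le> M \<Longrightarrow>
      real n * coeff2 (p b) j n = - (real (Suc j) * coeff2 (P2 p b) (Suc j) (n - 1))"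
    and w: "\<And>b j n. coeff2 (w b) j n = (if n = 0 then coeff2 (p b) j 0 else 0)"
    and "b \<in> I" "j + n \<le> M"
  shows "coeff2 (U w m b) j n = (if n = m then coeff2 (p b) j n else 0)"
  using assms(3,4)
proof (induction m arbitrary: b j n rule: less_induct)
  case (less m)
  show ?case
  proof (cases m)
    case 0
    then show ?thesis by (simp add: w)
  next
    case (Suc k)
    \<comment> \<open>Up to total degree \<open>M\<close>, the coefficient of \<open>t ^ i\<close>
      in the first polynomial is the part of the second with \<open>h ^ i\<close>.\<close>
    let ?rel = "\<lambda>x y. \<forall>i\<le>k. \<forall>j n. j + n \<le> M \<longrightarrow> coeff2 (coeff x i) j n = (if n = i then coeff2 y j n else 0)"
    have "?rel (P3 (Upoly w k) b) (P2 p b)"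
      unfolding P3_def P2_def
    proof (rule pmap_param[where rel = ?rel])
      fix x x' :: "real poly poly poly" and y y' :: "real poly poly"
      assume x: "?rel x y" and x': "?rel x' y'"
      show "?rel (x * x') (y * y')"
      proof (intro allI impI)
        fix i j n :: nat assume i: "i \<le> k" and jn: "j + n \<le> M"
        have "coeff2 (coeff (x * x') i) j n = (\<Sum>i'\<le>i. \<Sum>j'\<le>j. \<Sum>n'\<le>n.
            coeff2 (coeff x i') j' n' * coeff2 (coeff x' (i - i')) (j - j') (n - n'))"
          by (simp add: coeff_mult[of x] coeff_sum coeff2_mult)
        also have "\<dots> = (\<Sum>i'\<le>i. \<Sum>j'\<le>j. \<Sum>n'\<le>n.
            if n' = i' then (if n = i then coeff2 y j' n' * coeff2 y' (j - j') (n - n') else 0) else 0)"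
        proof (intro sum.cong refl)
          fix i' j' n' assume *: "i' \<in> {..i}" "j' \<in> {..j}" "n' \<in> {..n}"
          show "coeff2 (coeff x i') j' n' * coeff2 (coeff x' (i - i')) (j - j') (n - n') =
              (if n' = i' then (if n = i then coeff2 y j' n' * coeff2 y' (j - j') (n - n') else 0) else 0)"
            using * i jn x[rule_format, of i' j' n'] x'[rule_format, of "i - i'" "j - j'" "n - n'"] by auto
        qed
        also have "\<dots> = (\<Sum>j'\<le>j. \<Sum>n'\<le>n. \<Sum>i'\<le>i.
            if n' = i' then (if n = i then coeff2 y j' n' * coeff2 y' (j - j') (n - n') else 0) else 0)"
          by (subst sum.swap, intro sum.cong refl sum.swap)
        also have "\<dots> = (if n = i then coeff2 (y * y') j n else 0)"
          by (cases "n = i") (auto simp: coeff2_mult intro!: sum.cong sum.neutral)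
        finally show "coeff2 (coeff (x * x') i) j n = (if n = i then coeff2 (y * y') j n else 0)" .
      qed
    qed (use less Suc in \<open>auto simp: coeff_Upoly one_pCons coeff_pCons split: nat.splits\<close>)
    then have G: "coeff2 (G w k b) (Suc j) (n - 1) = (if n - 1 = k then coeff2 (P2 p b) (Suc j) (n - 1) else 0)"
      if "0 < n"
      using that less.prems by (simp add: G_def)
    show ?thesis
    proof (cases "n = Suc k")
      case True
      then have "real (Suc k) * coeff2 (p b) j n = - (real (Suc j) * coeff2 (P2 p b) (Suc j) k)"
        using jet[OF less.prems(1), of n j] less.prems by simp
      then have "coeff2 (p b) j n = - (real (Suc j) * coeff2 (P2 p b) (Suc j) k) / real (Suc k)"
        by (simp add: field_simps del: of_nat_Suc)
      then show ?thesis using True G by (simp add: Suc U_Suc coeff2_hD del: of_nat_Suc)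
    next
      case False
      then show ?thesis using G by (auto simp: Suc U_Suc coeff2_hD)
    qed
  qed
qed

section \<open>Expansions of families of vectors\<close>

text \<open>Substituting \<open>x = \<alpha> * h\<close> turns total degree into order of vanishing;
  under \<open>translate i\<close> the slope 0 becomes the slope \<open>i\<close>
  (\<open>ev_translate\<close>).\<close>

definition ev :: "real \<Rightarrow> real \<Rightarrow> real poly poly \<Rightarrow> real" where
  "ev \<alpha> z g = poly (poly g [:0, \<alpha>:]) z"

lemma ev_simps [simp]: "ev \<alpha> z 0 = 0" "ev \<alpha> z 1 = 1" "ev \<alpha> z (g + g') = ev \<alpha> z g + ev \<alpha> z g'"
  "ev \<alpha> z (g * g') = ev \<alpha> z g * ev \<alpha> z g'" "ev \<alpha> z [:[:c:]:] = c" "ev \<alpha> z (c *\<^sub>R g) = c * ev \<alpha> z g"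
  "ev \<alpha> z (g - g') = ev \<alpha> z g - ev \<alpha> z g'"
  by (simp_all add: ev_def scaleR_eq_smult)

lemma ev_translate: "ev 0 z (translate i g) = ev (of_int i) z g"
  by (simp add: ev_def translate_def poly_pcompose)

definition bidegree_le :: "nat \<Rightarrow> real poly poly \<Rightarrow> bool" where
  "bidegree_le D g \<longleftrightarrow> (\<forall>j n. D < j \<or> D < n \<longrightarrow> coeff2 g j n = 0)"

lemma ev_expand:
  assumes "bidegree_le D g"
  shows "ev \<alpha> z g = (\<Sum>j\<le>D. \<Sum>n\<le>D. \<alpha> ^ j * coeff2 g j n * z ^ (j + n))"
proof -
  have "degree g \<le> D"
    using assms by (intro degree_le) (auto simp: bidegree_le_def poly_eq_iff)
  then have "poly g [:0, \<alpha>:] = (\<Sum>j\<le>D. coeff g j * [:0, \<alpha>:] ^ j)"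
    unfolding poly_altdef by (intro sum.mono_neutral_left) (auto simp: coeff_eq_0)
  moreover have "poly (coeff g j) z = (\<Sum>n\<le>D. coeff2 g j n * z ^ n)" for j
  proof -
    have "degree (coeff g j) \<le> D"
      using assms by (intro degree_le) (auto simp: bidegree_le_def)
    then show ?thesis unfolding poly_altdef by (intro sum.mono_neutral_left) (auto simp: coeff_eq_0)
  qed
  ultimately show ?thesis
    by (simp add: ev_def poly_sum power_mult_distrib power_add sum_distrib_left sum_distrib_right mult_ac)
qed

lemma bidegree_le_add: "bidegree_le D g \<Longrightarrow> bidegree_le D' g' \<Longrightarrow> bidegree_le (max D D') (g + g')"
  by (simp add: bidegree_le_def)

lemma bidegree_le_mult: "bidegree_le D g \<Longrightarrow> bidegree_le D' g' \<Longrightarrow> bidegree_le (D + D') (g * g')"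
  unfolding bidegree_le_def coeff2_mult
proof (intro allI impI sum.neutral ballI)
  fix j n i k
  assume g: "\<forall>j n. D < j \<or> D < n \<longrightarrow> coeff2 g j n = 0" "\<forall>j n. D' < j \<or> D' < n \<longrightarrow> coeff2 g' j n = 0"
    and jn: "D + D' < j \<or> D + D' < n"
  have "D < i \<or> D < k \<or> D' < j - i \<or> D' < n - k" using jn by auto
  then show "coeff2 g i k * coeff2 g' (j - i) (n - k) = 0" using g by auto
qed

text \<open>With one degree bound for the whole family, asymptotic statements about values reduce to
  finitely many coefficients.\<close>

definition bounded_family :: "'o filter \<Rightarrow> ('o \<Rightarrow> real poly poly) \<Rightarrow> bool" where
  "bounded_family F g \<longleftrightarrow> (\<exists>D. \<forall>\<omega>. bidegree_le D (g \<omega>)) \<and>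
     (\<forall>j n. (\<lambda>\<omega>. coeff2 (g \<omega>) j n) \<in> O[F](\<lambda>_. 1))"

lemma bounded_family_add:
  "bounded_family F g \<Longrightarrow> bounded_family F g' \<Longrightarrow> bounded_family F (\<lambda>\<omega>. g \<omega> + g' \<omega>)"
  unfolding bounded_family_def by (auto intro!: sum_in_bigo) (metis bidegree_le_add)

lemma bounded_family_mult:
  "bounded_family F g \<Longrightarrow> bounded_family F g' \<Longrightarrow> bounded_family F (\<lambda>\<omega>. g \<omega> * g' \<omega>)"
  unfolding bounded_family_def coeff2_mult
  by (auto intro!: big_sum_in_bigo landau_o.big.mult_in_1) (metis bidegree_le_mult)

lemma bounded_family_const:
  assumes "c \<in> O[F](\<lambda>_. 1)"
  shows "bounded_family F (\<lambda>\<omega>. [:[:c \<omega>:]:])"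
proof -
  have "bidegree_le 0 [:[:c \<omega>:]:]" for \<omega> by (auto simp: bidegree_le_def coeff_pCons split: nat.splits)
  moreover have "(\<lambda>\<omega>. coeff2 [:[:c \<omega>:]:] j n) \<in> O[F](\<lambda>_. 1)" for j n
    using assms by (cases j; cases n) auto
  ultimately show ?thesis unfolding bounded_family_def by blast
qed

lemma bounded_family_scaleR:
  assumes "c \<in> O[F](\<lambda>_. 1)" "bounded_family F g"
  shows "bounded_family F (\<lambda>\<omega>. c \<omega> *\<^sub>R g \<omega>)"
  using bounded_family_mult[OF bounded_family_const[OF assms(1)] assms(2)]
  by (simp add: scaleR_eq_smult)

lemma bounded_family_hD: "bounded_family F g \<Longrightarrow> bounded_family F (\<lambda>\<omega>. hD (g \<omega>))"
proof -
  assume g: "bounded_family F g"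
  then obtain D where D: "\<And>\<omega>. bidegree_le D (g \<omega>)" unfolding bounded_family_def by blast
  have "bidegree_le (Suc D) (hD (g \<omega>))" for \<omega>
    using D[of \<omega>] by (auto simp: bidegree_le_def coeff2_hD)
  moreover have "(\<lambda>\<omega>. coeff2 (hD (g \<omega>)) j n) \<in> O[F](\<lambda>_. 1)" for j n
    using g by (cases "n = 0") (auto simp: bounded_family_def coeff2_hD)
  ultimately show ?thesis unfolding bounded_family_def by blast
qed

lemma bounded_family_sum:
  "(\<And>i. i \<in> A \<Longrightarrow> bounded_family F (g i)) \<Longrightarrow> bounded_family F (\<lambda>\<omega>. \<Sum>i\<in>A. g i \<omega>)"
  by (induction A rule: infinite_finite_induct)
    (use bounded_family_const[of "\<lambda>_. 0"] in \<open>auto intro: bounded_family_add\<close>)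

lemma bounded_family_translate:
  assumes "bounded_family F g"
  shows "bounded_family F (\<lambda>\<omega>. translate i (g \<omega>))"
proof -
  obtain D where D: "\<And>\<omega>. bidegree_le D (g \<omega>)" using assms unfolding bounded_family_def by blast
  have "degree (g \<omega>) \<le> D" for \<omega>
    using D[of \<omega>] by (intro degree_le) (auto simp: bidegree_le_def poly_eq_iff)
  then have "(\<lambda>\<omega>. translate i (g \<omega>)) = (\<lambda>\<omega>. \<Sum>n\<le>D. (of_int i ^ n / fact n) *\<^sub>R (hD ^^ n) (g \<omega>))"
    by (intro ext translate_taylor)
  moreover have hD: "bounded_family F (\<lambda>\<omega>. (hD ^^ n) (g \<omega>))" for n
    by (induction n) (auto intro: assms bounded_family_hD)
  ultimately show ?thesis
    by (simp only:) (intro bounded_family_sum bounded_family_scaleR[OF bigo_const] hD)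
qed

text \<open>A family of vectors \<open>y\<close>, close to zero, is represented by a bounded family of polynomials whose
  values on the ray of slope \<open>\<alpha>\<close> at step size \<open>h\<close> agree with it to order \<open>N + 1\<close>.\<close>

locale expansion =
  fixes F :: "'o filter" and h :: "'o \<Rightarrow> real" and \<alpha> :: real and N :: nat
  assumes h_pos: "\<forall>\<^sub>F \<omega> in F. 0 < h \<omega>" and h_lim: "(h \<longlongrightarrow> 0) F"
begin

lemma h_power_bigo: "m \<le> n \<Longrightarrow> (\<lambda>\<omega>. h \<omega> ^ n) \<in> O[F](\<lambda>\<omega>. h \<omega> ^ m)"
proof -
  assume "m \<le> n"
  have "\<forall>\<^sub>F \<omega> in F. h \<omega> < 1" using order_tendstoD(2)[OF h_lim] by simp
  then have "\<forall>\<^sub>F \<omega> in F. norm (h \<omega> ^ n) \<le> 1 * norm (h \<omega> ^ m)"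
    using h_pos by eventually_elim (use \<open>m \<le> n\<close> in \<open>auto intro: power_decreasing\<close>)
  then show ?thesis by (rule bigoI)
qed

text \<open>For \<open>\<alpha> = 0\<close> the convention \<open>0 ^ 0 = 1\<close> leaves only the
  coefficients with \<open>j = 0\<close>; the final estimate uses this case, at the node
  itself.\<close>

lemma ev_bigo:
  assumes "bounded_family F g"
    and "\<And>j n. j + n < k \<Longrightarrow> \<forall>\<^sub>F \<omega> in F. \<alpha> ^ j * coeff2 (g \<omega>) j n = 0"
  shows "(\<lambda>\<omega>. ev \<alpha> (h \<omega>) (g \<omega>)) \<in> O[F](\<lambda>\<omega>. h \<omega> ^ k)"
proof -
  obtain D where D: "\<And>\<omega>. bidegree_le D (g \<omega>)" using assms unfolding bounded_family_def by blast
  have "(\<lambda>\<omega>. ev \<alpha> (h \<omega>) (g \<omega>)) =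
      (\<lambda>\<omega>. \<Sum>j\<le>D. \<Sum>n\<le>D. \<alpha> ^ j * coeff2 (g \<omega>) j n * h \<omega> ^ (j + n))"
    by (intro ext ev_expand D)
  also have "\<dots> \<in> O[F](\<lambda>\<omega>. h \<omega> ^ k)"
  proof (intro big_sum_in_bigo)
    fix j n
    show "(\<lambda>\<omega>. \<alpha> ^ j * coeff2 (g \<omega>) j n * h \<omega> ^ (j + n)) \<in> O[F](\<lambda>\<omega>. h \<omega> ^ k)"
    proof (cases "j + n < k")
      case True
      from assms(2)[OF True]
      have "\<forall>\<^sub>F \<omega> in F. norm (\<alpha> ^ j * coeff2 (g \<omega>) j n * h \<omega> ^ (j + n)) \<le> 0 * norm (h \<omega> ^ k)"
        by eventually_elim simp
      then show ?thesis by (rule bigoI)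
    next
      case False
      have "(\<lambda>\<omega>. \<alpha> ^ j * coeff2 (g \<omega>) j n) \<in> O[F](\<lambda>_. 1)"
        using assms(1) unfolding bounded_family_def by (intro landau_o.big.mult_in_1) auto
      from landau_o.big.mult[OF this h_power_bigo[of k "j + n"]] False show ?thesis by simp
    qed
  qed
  finally show ?thesis .
qed

text \<open>The vanishing constant coefficient makes \<open>y\<close> of size \<open>h\<close>, so
  that a Taylor remainder of order \<open>N + 1\<close> in \<open>y\<close> is one in
  \<open>h\<close>.\<close>

definition rep :: "('o \<Rightarrow> 'a::euclidean_space) \<Rightarrow> ('o \<Rightarrow> 'a \<Rightarrow> real poly poly) \<Rightarrow> bool" where
  "rep y g \<longleftrightarrow> (\<forall>b\<in>Basis. bounded_family F (\<lambda>\<omega>. g \<omega> b) \<and> (\<forall>\<omega>. coeff2 (g \<omega> b) 0 0 = 0) \<and>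
     (\<lambda>\<omega>. y \<omega> \<bullet> b - ev \<alpha> (h \<omega>) (g \<omega> b)) \<in> O[F](\<lambda>\<omega>. h \<omega> ^ (N + 1)))"

lemma repD:
  assumes "rep y g" "b \<in> Basis"
  shows "bounded_family F (\<lambda>\<omega>. g \<omega> b)" "coeff2 (g \<omega> b) 0 0 = 0"
    "(\<lambda>\<omega>. y \<omega> \<bullet> b - ev \<alpha> (h \<omega>) (g \<omega> b)) \<in> O[F](\<lambda>\<omega>. h \<omega> ^ (N + 1))"
  using assms unfolding rep_def by auto

lemma rep_ev_bigo:
  assumes "rep y g" "b \<in> Basis"
  shows "(\<lambda>\<omega>. ev \<alpha> (h \<omega>) (g \<omega> b)) \<in> O[F](h)"
  using ev_bigo[of "\<lambda>\<omega>. g \<omega> b" 1] repD[OF assms] by simp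

lemma rep_inner_bigo:
  assumes "rep y g" "b \<in> Basis"
  shows "(\<lambda>\<omega>. y \<omega> \<bullet> b) \<in> O[F](h)"
proof -
  have "(\<lambda>\<omega>. y \<omega> \<bullet> b - ev \<alpha> (h \<omega>) (g \<omega> b)) \<in> O[F](h)"
    using landau_o.big_trans[OF repD(3)[OF assms] h_power_bigo[of 1 "N + 1"]] by simp
  from sum_in_bigo(1)[OF this rep_ev_bigo[OF assms]] show ?thesis by simp
qed

lemma rep_norm_bigo:
  assumes "rep y g"
  shows "(\<lambda>\<omega>. norm (y \<omega>)) \<in> O[F](h)"
proof -
  have "(\<lambda>\<omega>. \<Sum>b\<in>Basis. norm (y \<omega> \<bullet> b)) \<in> O[F](h)"
    by (intro big_sum_in_bigo) (simp add: rep_inner_bigo[OF assms])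
  moreover have "(\<lambda>\<omega>. norm (y \<omega>)) \<in> O[F](\<lambda>\<omega>. \<Sum>b\<in>Basis. norm (y \<omega> \<bullet> b))"
    using norm_le_l1 by (intro landau_o.big_mono always_eventually allI) (auto intro: order.trans abs_ge_self)
  ultimately show ?thesis using landau_o.big_trans by blast
qed

text \<open>The remainder is treated by \<open>rep_norm_bigo\<close>. For the polynomial part,
  agreement up to \<open>h ^ (N + 1)\<close> survives ring operations on bounded quantities;
  \<open>C \<omega> c [] = 0\<close> keeps the constant coefficient zero.\<close>

lemma rep_flux:
  fixes \<phi> :: "'o \<Rightarrow> 'a::euclidean_space \<Rightarrow> 'a"
  assumes taylor: "\<forall>\<^sub>F \<omega> in F. \<forall>\<delta>. norm \<delta> \<le> 1 \<longrightarrow> (\<forall>c\<in>Basis.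
      \<bar>\<phi> \<omega> \<delta> \<bullet> c - pmap Basis N (C \<omega>) (\<lambda>b. \<delta> \<bullet> b) c\<bar> \<le> B * norm \<delta> ^ (N + 1))"
    and C: "\<And>c bs. (\<lambda>\<omega>. C \<omega> c bs) \<in> O[F](\<lambda>_. 1)" "\<And>\<omega> c. C \<omega> c [] = 0"
    and y: "rep y g"
  shows "rep (\<lambda>\<omega>. \<phi> \<omega> (y \<omega>)) (\<lambda>\<omega>. polynomial_flux.P2 Basis N (C \<omega>) (g \<omega>))"
  unfolding rep_def
proof (intro ballI conjI allI)
  fix c :: 'a assume c: "c \<in> Basis"
  have "bounded_family F (pmap Basis N (\<lambda>c bs \<omega>. [:[:C \<omega> c bs:]:]) (\<lambda>b \<omega>. g \<omega> b) c)"
  proof (rule pmap_param[where rel = "\<lambda>x y. bounded_family F x"])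
    show "bounded_family F 0" "bounded_family F 1"
      using bounded_family_const[of "\<lambda>_. 0" F] bounded_family_const[of "\<lambda>_. 1" F]
      by (simp_all add: zero_fun_def one_fun_def one_pCons)
  qed (auto simp: plus_fun_def times_fun_def intro: bounded_family_add bounded_family_mult
      bounded_family_const C repD[OF y])
  then show "bounded_family F (\<lambda>\<omega>. polynomial_flux.P2 Basis N (C \<omega>) (g \<omega>) c)"
    by (simp add: polynomial_flux.P2_def pmap_apply[abs_def])
  fix \<omega>
  have "coeff2 (pmap Basis N (\<lambda>c bs. [:[:C \<omega> c bs:]:]) (g \<omega>) c) 0 0 = pmap Basis N (C \<omega>) (\<lambda>_. 0) c"
    by (rule pmap_param[where rel = "\<lambda>x y. coeff2 x 0 0 = y"])
      (use repD(2)[OF y] in \<open>auto simp: coeff2_mult\<close>)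
  also have "\<dots> = 0"
    unfolding pmap_def
  proof (intro sum.neutral ballI)
    fix bs show "C \<omega> c bs * prod_list (map (\<lambda>_. 0) bs) = 0" by (cases bs) (simp_all add: C(2))
  qed
  finally show "coeff2 (polynomial_flux.P2 Basis N (C \<omega>) (g \<omega>) c) 0 0 = 0"
    by (simp add: polynomial_flux.P2_def)
next
  fix c :: 'a assume c: "c \<in> Basis"
  note y_norm = rep_norm_bigo[OF y]
  have h_O1: "h \<in> O[F](\<lambda>_. 1)" using h_power_bigo[of 0 1] by simp
  obtain c0 where "\<forall>\<^sub>F \<omega> in F. norm (norm (y \<omega>)) \<le> c0 * norm (h \<omega>)"
    using y_norm by (elim landau_o.bigE)
  moreover have "\<forall>\<^sub>F \<omega> in F. c0 * h \<omega> < 1"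
    using order_tendstoD(2)[OF tendsto_mult_right_zero[OF h_lim, of c0], of 1] by simp
  ultimately have "\<forall>\<^sub>F \<omega> in F. norm (y \<omega>) \<le> 1" using h_pos by eventually_elim auto
  then have "\<forall>\<^sub>F \<omega> in F. norm (\<phi> \<omega> (y \<omega>) \<bullet> c - pmap Basis N (C \<omega>) (\<lambda>b. y \<omega> \<bullet> b) c) \<le> B * norm (norm (y \<omega>) ^ (N + 1))"
    using taylor by eventually_elim (use c in auto)
  then have 1: "(\<lambda>\<omega>. \<phi> \<omega> (y \<omega>) \<bullet> c - pmap Basis N (C \<omega>) (\<lambda>b. y \<omega> \<bullet> b) c) \<in> O[F](\<lambda>\<omega>. h \<omega> ^ (N + 1))"
    by (intro landau_o.big_trans[OF bigoI landau_o.big_power[OF y_norm]])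
  let ?C = "\<lambda>c bs \<omega>. C \<omega> c bs"
  let ?rel = "\<lambda>x x'. x \<in> O[F](\<lambda>_. 1) \<and> x' \<in> O[F](\<lambda>_. 1) \<and> (\<lambda>\<omega>. x \<omega> - x' \<omega>) \<in> O[F](\<lambda>\<omega>. h \<omega> ^ (N + 1))"
  have "?rel (pmap Basis N ?C (\<lambda>b \<omega>. y \<omega> \<bullet> b) c) (pmap Basis N ?C (\<lambda>b \<omega>. ev \<alpha> (h \<omega>) (g \<omega> b)) c)"
  proof (rule pmap_param[where rel = ?rel])
    fix x x' z z' assume x: "?rel x x'" and z: "?rel z z'"
    have "(\<lambda>\<omega>. (x \<omega> - x' \<omega>) + (z \<omega> - z' \<omega>)) \<in> O[F](\<lambda>\<omega>. h \<omega> ^ (N + 1))"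
      using x z by (intro sum_in_bigo(1)) (blast+)
    moreover have "(x \<omega> - x' \<omega>) + (z \<omega> - z' \<omega>) = (x + z) \<omega> - (x' + z') \<omega>" for \<omega> by simp
    moreover have "x + z \<in> O[F](\<lambda>_. 1)" "x' + z' \<in> O[F](\<lambda>_. 1)"
      unfolding plus_fun_def using x z by (blast intro: sum_in_bigo)+
    ultimately show "?rel (x + z) (x' + z')" by simp
    have "(\<lambda>\<omega>. x \<omega> * (z \<omega> - z' \<omega>)) \<in> O[F](\<lambda>\<omega>. 1 * h \<omega> ^ (N + 1))"
      "(\<lambda>\<omega>. (x \<omega> - x' \<omega>) * z' \<omega>) \<in> O[F](\<lambda>\<omega>. h \<omega> ^ (N + 1) * 1)"
      using x z by (intro landau_o.big.mult; simp)+
    then have "(\<lambda>\<omega>. x \<omega> * (z \<omega> - z' \<omega>) + (x \<omega> - x' \<omega>) * z' \<omega>) \<in> O[F](\<lambda>\<omega>. h \<omega> ^ (N + 1))"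
      by (intro sum_in_bigo) auto
    moreover have "x \<omega> * (z \<omega> - z' \<omega>) + (x \<omega> - x' \<omega>) * z' \<omega> = (x * z) \<omega> - (x' * z') \<omega>" for \<omega>
      by (simp add: algebra_simps)
    moreover have "x * z \<in> O[F](\<lambda>_. 1)" "x' * z' \<in> O[F](\<lambda>_. 1)"
      unfolding times_fun_def using x z by (blast intro: landau_o.big.mult_in_1)+
    ultimately show "?rel (x * z) (x' * z')" by simp
  next
    fix b :: 'a assume b: "b \<in> Basis"
    show "?rel (\<lambda>\<omega>. y \<omega> \<bullet> b) (\<lambda>\<omega>. ev \<alpha> (h \<omega>) (g \<omega> b))"
      using repD(3)[OF y b] landau_o.big_trans[OF rep_inner_bigo[OF y b] h_O1]
        landau_o.big_trans[OF rep_ev_bigo[OF y b] h_O1] by blast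
  qed (auto simp: C zero_fun_def one_fun_def)
  then have 2: "(\<lambda>\<omega>. pmap Basis N (C \<omega>) (\<lambda>b. y \<omega> \<bullet> b) c - pmap Basis N (C \<omega>) (\<lambda>b. ev \<alpha> (h \<omega>) (g \<omega> b)) c)
      \<in> O[F](\<lambda>\<omega>. h \<omega> ^ (N + 1))"
    by (simp add: pmap_apply)
  have 3: "pmap Basis N (C \<omega>) (\<lambda>b. ev \<alpha> (h \<omega>) (g \<omega> b)) c =
      ev \<alpha> (h \<omega>) (polynomial_flux.P2 Basis N (C \<omega>) (g \<omega>) c)" for \<omega>
    unfolding polynomial_flux.P2_def by (rule pmap_param[where rel = "\<lambda>x y. x = ev \<alpha> (h \<omega>) y"]) auto
  show "(\<lambda>\<omega>. \<phi> \<omega> (y \<omega>) \<bullet> c - ev \<alpha> (h \<omega>) (polynomial_flux.P2 Basis N (C \<omega>) (g \<omega>) c)) \<in> O[F](\<lambda>\<omega>. h \<omega> ^ (N + 1))"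
    using sum_in_bigo(1)[OF 1 2] by (simp add: 3)
qed

lemma cat_relation_rep:
  fixes \<phi> :: "'o \<Rightarrow> 'a::euclidean_space \<Rightarrow> 'a"
  assumes "\<forall>\<^sub>F \<omega> in F. \<forall>\<delta>. norm \<delta> \<le> 1 \<longrightarrow> (\<forall>c\<in>Basis.
      \<bar>\<phi> \<omega> \<delta> \<bullet> c - pmap Basis N (C \<omega>) (\<lambda>b. \<delta> \<bullet> b) c\<bar> \<le> B * norm \<delta> ^ (N + 1))"
    and "\<And>c bs. (\<lambda>\<omega>. C \<omega> c bs) \<in> O[F](\<lambda>_. 1)" "\<And>\<omega> c. C \<omega> c [] = 0"
    and "\<sigma> \<in> O[F](\<lambda>_. 1)" "(\<lambda>\<omega>. 1 / \<sigma> \<omega>) \<in> O[F](\<lambda>_. 1)"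
  shows "cat_relation rep {c. c \<in> O[F](\<lambda>_. 1)} \<phi> (\<lambda>\<omega>. polynomial_flux.P2 Basis N (C \<omega>)) \<sigma>"
proof
  show "rep (\<lambda>_. 0 :: 'a) (\<lambda>_. 0)"
    using bounded_family_const[of "\<lambda>_. 0" F] by (simp add: rep_def)
next
  fix x x' :: "'o \<Rightarrow> 'a" and y y' assume x: "rep x y" and x': "rep x' y'"
  show "rep (\<lambda>\<omega>. x \<omega> + x' \<omega>) (\<lambda>\<omega>. y \<omega> + y' \<omega>)"
    unfolding rep_def
  proof (intro ballI conjI allI)
    fix b :: 'a assume b: "b \<in> Basis"
    show "(\<lambda>\<omega>. (x \<omega> + x' \<omega>) \<bullet> b - ev \<alpha> (h \<omega>) ((y \<omega> + y' \<omega>) b)) \<in> O[F](\<lambda>\<omega>. h \<omega> ^ (N + 1))"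
      using sum_in_bigo(1)[OF repD(3)[OF x b] repD(3)[OF x' b]] by (simp add: algebra_simps)
  qed (use x x' in \<open>auto simp: repD intro!: bounded_family_add\<close>)
next
  fix c :: "'o \<Rightarrow> real" and x :: "'o \<Rightarrow> 'a" and y assume c: "c \<in> {c. c \<in> O[F](\<lambda>_. 1)}" and x: "rep x y"
  show "rep (\<lambda>\<omega>. c \<omega> *\<^sub>R x \<omega>) (\<lambda>\<omega>. c \<omega> *\<^sub>R y \<omega>)"
    unfolding rep_def
  proof (intro ballI conjI allI)
    fix b :: 'a assume b: "b \<in> Basis"
    show "(\<lambda>\<omega>. (c \<omega> *\<^sub>R x \<omega>) \<bullet> b - ev \<alpha> (h \<omega>) ((c \<omega> *\<^sub>R y \<omega>) b)) \<in> O[F](\<lambda>\<omega>. h \<omega> ^ (N + 1))"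
      using landau_o.big.mult[OF CollectD[OF c] repD(3)[OF x b]] by (simp add: algebra_simps)
  qed (use x c in \<open>auto simp: repD intro!: bounded_family_scaleR\<close>)
next
  show "rep (\<lambda>\<omega>. \<phi> \<omega> (x \<omega>)) (\<lambda>\<omega>. polynomial_flux.P2 Basis N (C \<omega>) (y \<omega>))" if "rep x y" for x y
    using rep_flux[OF assms(1-3) that] .
qed (use assms in \<open>auto intro: landau_o.big.mult_in_1\<close>)

end

section \<open>Taylor expansions of smooth maps\<close>

definition dird :: "'a::euclidean_space \<Rightarrow> ('a \<Rightarrow> 'b::real_normed_vector) \<Rightarrow> 'a \<Rightarrow> 'b" where
  "dird v g x = frechet_derivative g (at x) v"

lemma smooth_on_dird: "smooth_on S g \<Longrightarrow> smooth_on S (dird v g)"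
  unfolding smooth_on_def dird_def[abs_def] by (metis C_k_on.simps(2))

lemma smooth_on_differentiable: "smooth_on S g \<Longrightarrow> x \<in> S \<Longrightarrow> g differentiable (at x)"
  unfolding smooth_on_def by (metis C_k_on.simps(2))

lemma smooth_on_continuous_on: "smooth_on S g \<Longrightarrow> continuous_on S g"
  unfolding smooth_on_def by (metis C_k_on.simps(1))

lemma smooth_on_dird_power: "smooth_on S g \<Longrightarrow> smooth_on S ((dird v ^^ n) g)"
  by (induction n) (auto intro: smooth_on_dird)

lemma dird_scaleR: "g differentiable (at x) \<Longrightarrow> dird (c *\<^sub>R v) g x = c *\<^sub>R dird v g x"
  unfolding dird_def by (intro linear_scale linear_frechet_derivative)

lemma dird_Basis:
  assumes "g differentiable (at x)"
  shows "dird v g x = (\<Sum>b\<in>Basis. (v \<bullet> b) *\<^sub>R dird b g x)"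
proof -
  note lin = linear_frechet_derivative[OF assms]
  have "dird v g x = frechet_derivative g (at x) (\<Sum>b\<in>Basis. (v \<bullet> b) *\<^sub>R b)"
    by (simp add: dird_def euclidean_representation)
  also have "\<dots> = (\<Sum>b\<in>Basis. (v \<bullet> b) *\<^sub>R dird b g x)"
    by (simp add: dird_def linear_sum[OF lin] linear_scale[OF lin])
  finally show ?thesis .
qed

lemma dird_curve:
  assumes "g differentiable (at (z + s *\<^sub>R v))"
  shows "((\<lambda>s. g (z + s *\<^sub>R v)) has_vector_derivative dird v g (z + s *\<^sub>R v)) (at s)"
proof -
  have "((\<lambda>s. z + s *\<^sub>R v) has_derivative (\<lambda>s. s *\<^sub>R v)) (at s)"
    by (auto intro!: derivative_eq_intros)
  moreover have "(g has_derivative (\<lambda>v. dird v g (z + s *\<^sub>R v0))) (at (z + s *\<^sub>R v0))"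
    if "v0 = v" for v0
    using assms that unfolding dird_def frechet_derivative_works by simp
  ultimately have "((\<lambda>s. g (z + s *\<^sub>R v)) has_derivative (\<lambda>t. dird (t *\<^sub>R v) g (z + s *\<^sub>R v))) (at s)"
    using has_derivative_compose by blast
  then show ?thesis
    by (simp add: has_vector_derivative_def dird_scaleR[OF assms])
qed

lemma dird_curve_inner:
  assumes "g differentiable (at (z + s *\<^sub>R v))"
  shows "((\<lambda>s. g (z + s *\<^sub>R v) \<bullet> c) has_real_derivative dird v g (z + s *\<^sub>R v) \<bullet> c) (at s)"
  using bounded_linear.has_vector_derivative[OF bounded_linear_inner_left dird_curve[OF assms], of c]
  by (simp add: has_real_derivative_iff_has_vector_derivative)

lemma compact_norm_bound:
  assumes "smooth_on S g" "compact K" "K \<subseteq> S"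
  obtains M where "M \<ge> 0" "\<And>z. z \<in> K \<Longrightarrow> norm (g z) \<le> M"
proof -
  have "compact (g ` K)"
    using assms smooth_on_continuous_on continuous_on_subset by (blast intro: compact_continuous_image)
  then obtain M where "\<forall>x\<in>g ` K. norm x \<le> M" using compact_imp_bounded bounded_iff by metis
  then show ?thesis by (intro that[of "max M 0"]) auto
qed

lemma taylor_unit_interval:
  assumes "\<And>m t. m \<le> N \<Longrightarrow> 0 \<le> t \<Longrightarrow> t \<le> 1 \<Longrightarrow> (\<psi> m has_real_derivative \<psi> (Suc m) t) (at t)"
    and "\<And>t. 0 \<le> t \<Longrightarrow> t \<le> 1 \<Longrightarrow> \<bar>\<psi> (Suc N) t\<bar> \<le> B"
  shows "\<bar>\<psi> 0 1 - (\<Sum>m\<le>N. \<psi> m 0 / fact m)\<bar> \<le> B"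
proof -
  obtain t where t: "0 < t" "t < 1"
    "\<psi> 0 1 = (\<Sum>m<Suc N. (\<psi> m 0 / fact m) * 1 ^ m) + \<psi> (Suc N) t / fact (Suc N) * 1 ^ Suc N"
    using Maclaurin[of 1 "Suc N" \<psi> "\<psi> 0"] assms(1) by (auto simp: less_Suc_eq_le)
  then have "\<bar>\<psi> 0 1 - (\<Sum>m\<le>N. \<psi> m 0 / fact m)\<bar> = \<bar>\<psi> (Suc N) t\<bar> / fact (Suc N)"
    by (simp add: lessThan_Suc_atMost del: fact_Suc sum.lessThan_Suc)
  also have "\<dots> \<le> \<bar>\<psi> (Suc N) t\<bar> / 1"
    by (intro divide_left_mono) (auto simp: fact_ge_1 simp del: fact_Suc)
  also have "\<dots> \<le> B" using assms(2)[of t] t by simp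
  finally show ?thesis .
qed

text \<open>The intermediate point of the Lagrange remainder depends on the component, so components
  are estimated separately; summing them costs the factor \<open>DIM('b)\<close>.\<close>

lemma directional_taylor:
  fixes g :: "'a::euclidean_space \<Rightarrow> 'b::euclidean_space"
  assumes g: "smooth_on S g" and K: "compact K" "K \<subseteq> S"
  shows "\<exists>B\<ge>0. \<forall>z \<tau>. (\<forall>s. 0 \<le> s \<longrightarrow> s \<le> 1 \<longrightarrow> z + (s * \<tau>) *\<^sub>R v \<in> K) \<longrightarrow>
    norm (g (z + \<tau> *\<^sub>R v) - (\<Sum>n\<le>N. (\<tau> ^ n / fact n) *\<^sub>R (dird v ^^ n) g z)) \<le> B * \<bar>\<tau>\<bar> ^ (N + 1)"
proof -
  obtain M where M: "M \<ge> 0" "\<And>z. z \<in> K \<Longrightarrow> norm ((dird v ^^ Suc N) g z) \<le> M"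
    using compact_norm_bound[OF smooth_on_dird_power[OF g] K] by metis
  have "norm (g (z + \<tau> *\<^sub>R v) - (\<Sum>n\<le>N. (\<tau> ^ n / fact n) *\<^sub>R (dird v ^^ n) g z)) \<le>
      (real DIM('b) * M) * \<bar>\<tau>\<bar> ^ (N + 1)"
    if z: "\<forall>s. 0 \<le> s \<longrightarrow> s \<le> 1 \<longrightarrow> z + (s * \<tau>) *\<^sub>R v \<in> K" for z \<tau>
  proof -
    let ?R = "g (z + \<tau> *\<^sub>R v) - (\<Sum>n\<le>N. (\<tau> ^ n / fact n) *\<^sub>R (dird v ^^ n) g z)"
    have "\<bar>?R \<bullet> c\<bar> \<le> M * \<bar>\<tau>\<bar> ^ (N + 1)" if c: "c \<in> Basis" for c
    proof -
      define \<psi> where "\<psi> n s = \<tau> ^ n * ((dird v ^^ n) g (z + s *\<^sub>R (\<tau> *\<^sub>R v)) \<bullet> c)" for n s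
      have "\<bar>\<psi> 0 1 - (\<Sum>m\<le>N. \<psi> m 0 / fact m)\<bar> \<le> M * \<bar>\<tau>\<bar> ^ (N + 1)"
      proof (rule taylor_unit_interval)
        fix m and t :: real assume t: "0 \<le> t" "t \<le> 1"
        then have zt: "z + t *\<^sub>R (\<tau> *\<^sub>R v) \<in> S" using z K by auto
        have diff: "(dird v ^^ m) g differentiable (at (z + t *\<^sub>R (\<tau> *\<^sub>R v)))"
          using smooth_on_differentiable[OF smooth_on_dird_power[OF g] zt] .
        have "((\<lambda>s. (dird v ^^ m) g (z + s *\<^sub>R (\<tau> *\<^sub>R v)) \<bullet> c) has_real_derivative
            \<tau> * ((dird v ^^ Suc m) g (z + t *\<^sub>R (\<tau> *\<^sub>R v)) \<bullet> c)) (at t)"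
          using dird_curve_inner[OF diff, of c] by (simp only: dird_scaleR[OF diff] inner_scaleR_left funpow.simps o_apply)
        from DERIV_cmult[OF this, of "\<tau> ^ m"]
        show "(\<psi> m has_real_derivative \<psi> (Suc m) t) (at t)"
          by (simp only: \<psi>_def[abs_def] power_Suc2 mult.assoc)
      next
        fix t :: real assume t: "0 \<le> t" "t \<le> 1"
        then have "z + t *\<^sub>R (\<tau> *\<^sub>R v) \<in> K" using z by simp
        from M(2)[OF this] have "\<bar>(dird v ^^ Suc N) g (z + t *\<^sub>R (\<tau> *\<^sub>R v)) \<bullet> c\<bar> \<le> M"
          using Basis_le_norm[OF c] order.trans by blast
        from mult_left_mono[OF this, of "\<bar>\<tau>\<bar> ^ (N + 1)"]
        show "\<bar>\<psi> (Suc N) t\<bar> \<le> M * \<bar>\<tau>\<bar> ^ (N + 1)"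
          by (simp add: \<psi>_def abs_mult power_abs mult_ac del: funpow.simps)
      qed
      moreover have "?R \<bullet> c = \<psi> 0 1 - (\<Sum>m\<le>N. \<psi> m 0 / fact m)"
        by (simp add: \<psi>_def inner_diff_left inner_sum_left)
      ultimately show ?thesis by simp
    qed
    then have "(\<Sum>c\<in>Basis. \<bar>?R \<bullet> c\<bar>) \<le> (\<Sum>c\<in>(Basis::'b set). M * \<bar>\<tau>\<bar> ^ (N + 1))"
      by (intro sum_mono)
    also have "\<dots> = (real DIM('b) * M) * \<bar>\<tau>\<bar> ^ (N + 1)" by simp
    finally show ?thesis using norm_le_l1[of ?R] by linarith
  qed
  then show ?thesis using M(1) by (intro exI[of _ "real DIM('b) * M"]) auto
qed

section \<open>Taylor polynomials of the flux in several variables\<close>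

fun dird_list :: "'a::euclidean_space list \<Rightarrow> ('a \<Rightarrow> 'b::real_normed_vector) \<Rightarrow> 'a \<Rightarrow> 'b" where
  "dird_list [] g = g"
| "dird_list (b # bs) g = dird b (dird_list bs g)"

lemma smooth_on_dird_list: "smooth_on S g \<Longrightarrow> smooth_on S (dird_list bs g)"
  by (induction bs) (auto intro: smooth_on_dird)

text \<open>The empty word gets 0 because the flux is centred at \<open>f w\<close>.\<close>

definition taylor_coeff :: "('a::euclidean_space \<Rightarrow> 'b::euclidean_space) \<Rightarrow> 'a \<Rightarrow> 'b \<Rightarrow> 'a list \<Rightarrow> real" where
  "taylor_coeff f w c bs = (if bs = [] then 0 else (dird_list bs f w \<bullet> c) / fact (length bs))"

text \<open>\<open>\<psi> n\<close> is the derivative of order \<open>n\<close> of the component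
  \<open>c\<close> of \<open>f\<close> along the segment from \<open>w\<close> to
  \<open>w + \<delta>\<close>, expanded over words; each differentiation prepends a basis vector by
  \<open>dird_Basis\<close>.\<close>

lemma taylor_polynomial_map:
  fixes f :: "'a::euclidean_space \<Rightarrow> 'a"
  assumes f: "smooth_on UNIV f" and W: "compact W"
  shows "\<exists>B. \<forall>w\<in>W. \<forall>\<delta>. norm \<delta> \<le> 1 \<longrightarrow> (\<forall>c\<in>Basis.
    \<bar>(f (w + \<delta>) - f w) \<bullet> c - pmap Basis N (taylor_coeff f w) (\<lambda>b. \<delta> \<bullet> b) c\<bar> \<le> B * norm \<delta> ^ (N + 1))"
proof -
  let ?L = "\<lambda>n. {bs. set bs \<subseteq> (Basis :: 'a set) \<and> length bs = n}"
  have fin: "finite (?L n)" for n by (rule finite_lists_length_eq) simp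
  \<comment> \<open>Compact set containing every segment of length at most 1 that starts in
    \<open>W\<close>; the derivative bounds are taken on it.\<close>
  define W' where "W' = (\<Union>x\<in>W. \<Union>y\<in>cball 0 1. {x + y})"
  have W': "compact W'" unfolding W'_def using W by (intro compact_sums') auto
  have "\<exists>M. \<forall>bs. 0 \<le> M bs \<and> (\<forall>z\<in>W'. norm (dird_list bs f z) \<le> M bs)"
    using compact_norm_bound[OF smooth_on_dird_list[OF f] W'] by (intro choice allI) (metis subset_UNIV)
  then obtain M where M: "\<And>bs. 0 \<le> M bs" "\<And>bs z. z \<in> W' \<Longrightarrow> norm (dird_list bs f z) \<le> M bs" by blast
  define B where "B = (\<Sum>bs\<in>?L (Suc N). M bs)"
  have "\<bar>(f (w + \<delta>) - f w) \<bullet> c - pmap Basis N (taylor_coeff f w) (\<lambda>b. \<delta> \<bullet> b) c\<bar> \<le> B * norm \<delta> ^ (N + 1)"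
    if w: "w \<in> W" and \<delta>: "norm \<delta> \<le> 1" and c: "c \<in> Basis" for w \<delta> c
  proof -
    define \<pi> where "\<pi> bs = prod_list (map (\<lambda>b. \<delta> \<bullet> b) bs)" for bs
    define \<psi> where "\<psi> n s = (\<Sum>bs\<in>?L n. \<pi> bs * (dird_list bs f (w + s *\<^sub>R \<delta>) \<bullet> c))" for n s
    have \<pi>: "\<bar>\<pi> bs\<bar> \<le> norm \<delta> ^ length bs" if "set bs \<subseteq> Basis" for bs
      using that
    proof (induction bs)
      case (Cons b bs)
      then show ?case by (auto simp: \<pi>_def abs_mult Basis_le_norm intro!: mult_mono)
    qed (simp add: \<pi>_def)
    have "\<bar>\<psi> 0 1 - (\<Sum>m\<le>N. \<psi> m 0 / fact m)\<bar> \<le> B * norm \<delta> ^ (N + 1)"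
    proof (rule taylor_unit_interval)
      fix m and t :: real
      have "((\<lambda>s. \<pi> bs * (dird_list bs f (w + s *\<^sub>R \<delta>) \<bullet> c)) has_real_derivative
          (\<Sum>b\<in>Basis. \<pi> (b # bs) * (dird_list (b # bs) f (w + t *\<^sub>R \<delta>) \<bullet> c))) (at t)" for bs
      proof -
        have diff: "dird_list bs f differentiable (at (w + t *\<^sub>R \<delta>))"
          using smooth_on_differentiable[OF smooth_on_dird_list[OF f]] by simp
        have "\<pi> bs * (dird \<delta> (dird_list bs f) (w + t *\<^sub>R \<delta>) \<bullet> c) =
            (\<Sum>b\<in>Basis. \<pi> (b # bs) * (dird_list (b # bs) f (w + t *\<^sub>R \<delta>) \<bullet> c))"
          by (subst dird_Basis[OF diff]) (simp add: inner_sum_left sum_distrib_left \<pi>_def mult_ac)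
        with DERIV_cmult[OF dird_curve_inner[OF diff], of "\<pi> bs" c] show ?thesis by simp
      qed
      then have "(\<psi> m has_real_derivative
          (\<Sum>bs\<in>?L m. \<Sum>b\<in>Basis. \<pi> (b # bs) * (dird_list (b # bs) f (w + t *\<^sub>R \<delta>) \<bullet> c))) (at t)"
        unfolding \<psi>_def[abs_def] by (intro DERIV_sum)
      also have "(\<Sum>bs\<in>?L m. \<Sum>b\<in>Basis. \<pi> (b # bs) * (dird_list (b # bs) f (w + t *\<^sub>R \<delta>) \<bullet> c)) = \<psi> (Suc m) t"
        unfolding \<psi>_def lists_length_Suc_eq sum.cartesian_product
        by (subst sum.reindex) (auto simp: inj_on_def case_prod_beta intro!: sum.cong)
      finally show "(\<psi> m has_real_derivative \<psi> (Suc m) t) (at t)" .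
    next
      fix t :: real assume t: "0 \<le> t" "t \<le> 1"
      have "norm (t *\<^sub>R \<delta>) \<le> 1" using t \<delta> by (simp add: mult_le_one)
      then have zt: "w + t *\<^sub>R \<delta> \<in> W'" using w by (force simp: W'_def)
      have "\<bar>\<psi> (Suc N) t\<bar> \<le> (\<Sum>bs\<in>?L (Suc N). \<bar>\<pi> bs\<bar> * \<bar>dird_list bs f (w + t *\<^sub>R \<delta>) \<bullet> c\<bar>)"
        unfolding \<psi>_def by (rule order.trans[OF sum_abs]) (simp add: abs_mult)
      also have "\<dots> \<le> (\<Sum>bs\<in>?L (Suc N). norm \<delta> ^ Suc N * M bs)"
      proof (intro sum_mono mult_mono)
        fix bs assume bs: "bs \<in> ?L (Suc N)"
        show "\<bar>\<pi> bs\<bar> \<le> norm \<delta> ^ Suc N" using \<pi>[of bs] bs by simp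
        show "\<bar>dird_list bs f (w + t *\<^sub>R \<delta>) \<bullet> c\<bar> \<le> M bs"
          using M(2)[OF zt, of bs] Basis_le_norm[OF c, of "dird_list bs f (w + t *\<^sub>R \<delta>)"] by linarith
      qed auto
      finally show "\<bar>\<psi> (Suc N) t\<bar> \<le> B * norm \<delta> ^ (N + 1)"
        by (simp add: B_def sum_distrib_left mult_ac)
    qed
    moreover have "\<psi> 0 s = f (w + s *\<^sub>R \<delta>) \<bullet> c" for s
      by (simp add: \<psi>_def \<pi>_def conj_commute cong: conj_cong)
    moreover have "pmap Basis N (taylor_coeff f w) (\<lambda>b. \<delta> \<bullet> b) c =
        (\<Sum>n\<le>N. \<Sum>bs\<in>?L n. taylor_coeff f w c bs * \<pi> bs)"
    proof -
      have "finite {bs. set bs \<subseteq> (Basis :: 'a set) \<and> length bs \<le> N}" by (rule finite_lists_length_le) simp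
      then have "(\<Sum>n\<le>N. \<Sum>bs\<in>{bs \<in> {bs. set bs \<subseteq> Basis \<and> length bs \<le> N}. length bs = n}. taylor_coeff f w c bs * \<pi> bs) =
          pmap Basis N (taylor_coeff f w) (\<lambda>b. \<delta> \<bullet> b) c"
        unfolding pmap_def \<pi>_def by (intro sum.group) auto
      moreover have "(\<Sum>n\<le>N. \<Sum>bs\<in>{bs \<in> {bs. set bs \<subseteq> Basis \<and> length bs \<le> N}. length bs = n}. taylor_coeff f w c bs * \<pi> bs) =
          (\<Sum>n\<le>N. \<Sum>bs\<in>?L n. taylor_coeff f w c bs * \<pi> bs)"
        by (intro sum.cong) auto
      ultimately show ?thesis by simp
    qed
    moreover have "(\<Sum>n\<le>N. \<Sum>bs\<in>?L n. taylor_coeff f w c bs * \<pi> bs) = (\<Sum>n\<le>N. if n = 0 then 0 else \<psi> n 0 / fact n)"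
      by (intro sum.cong refl) (auto simp: \<psi>_def taylor_coeff_def sum_divide_distrib intro!: sum.cong)
    moreover have "(\<Sum>n\<le>N. \<psi> n 0 / fact n) = \<psi> 0 0 + (\<Sum>n\<le>N. if n = 0 then 0 else \<psi> n 0 / fact n)"
      by (simp add: sum.atMost_shift)
    ultimately show ?thesis by (simp add: inner_diff_left algebra_simps)
  qed
  then show ?thesis by blast
qed

text \<open>Taylor coefficient of \<open>x ^ j * t ^ m\<close>. Time derivatives are innermost,
  matching the expansion first in time and then in space in \<open>taylor2_bound\<close>.\<close>

definition jetc :: "(real \<times> real \<Rightarrow> 'a::euclidean_space) \<Rightarrow> nat \<Rightarrow> nat \<Rightarrow> real \<times> real \<Rightarrow> 'a" where
  "jetc u j m z = (1 / (fact j * fact m)) *\<^sub>R (dird (1, 0) ^^ j) ((dird (0, 1) ^^ m) u) z"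

definition taylor2 :: "nat \<Rightarrow> (real \<times> real \<Rightarrow> 'a::euclidean_space) \<Rightarrow> real \<times> real \<Rightarrow> real \<Rightarrow> real \<Rightarrow> 'a" where
  "taylor2 N u z x t = (\<Sum>m\<le>N. \<Sum>j\<le>N - m. (x ^ j * t ^ m) *\<^sub>R jetc u j m z)"

lemma smooth_on_jetc: "smooth_on S u \<Longrightarrow> continuous_on S (jetc u j m)"
  unfolding jetc_def[abs_def]
  by (intro continuous_intros smooth_on_continuous_on smooth_on_dird_power)

lemma jetc_0_0 [simp]: "jetc u 0 0 z = u z"
  by (simp add: jetc_def)

lemma jetc_dird: "jetc (dird (0, 1) u) j m z = real (Suc m) *\<^sub>R jetc u j (Suc m) z"
  by (simp add: jetc_def funpow_swap1 del: of_nat_Suc)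

text \<open>Expand in time over the point shifted by \<open>x\<close>, then expand the time
  derivative of order \<open>m\<close> in space to the complementary degree \<open>N - m\<close>;
  every remainder has total order \<open>N + 1\<close>.\<close>

lemma taylor2_bound:
  fixes u :: "real \<times> real \<Rightarrow> 'a::euclidean_space"
  assumes u: "smooth_on \<Omega> u" and \<Omega>: "open \<Omega>" and K: "compact K" "K \<subseteq> \<Omega>"
  shows "\<exists>\<epsilon>>0. \<exists>B\<ge>0. \<forall>z\<in>K. \<forall>x t. \<bar>x\<bar> \<le> \<epsilon> \<longrightarrow> \<bar>t\<bar> \<le> \<epsilon> \<longrightarrow> z + (x, t) \<in> \<Omega> \<and>
    norm (u (z + (x, t)) - taylor2 N u z x t) \<le> B * (\<bar>x\<bar> + \<bar>t\<bar>) ^ (N + 1)"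
proof -
  obtain e where e: "0 < e" "(\<Union>x\<in>K. ball x e) \<subseteq> \<Omega>"
    using compact_subset_open_imp_ball_epsilon_subset[OF K(1) \<Omega> K(2)] by metis
  define K' where "K' = (\<Union>x\<in>K. \<Union>y\<in>cball 0 (e / 2). {x + y})"
  have K': "compact K'" unfolding K'_def using K by (intro compact_sums') auto
  have K'\<Omega>: "K' \<subseteq> \<Omega>"
  proof
    fix y assume "y \<in> K'"
    then obtain x d where "x \<in> K" "norm d \<le> e / 2" "y = x + d" by (auto simp: K'_def)
    then have "y \<in> ball x e" using e(1) by (auto simp: dist_norm)
    then show "y \<in> \<Omega>" using e(2) \<open>x \<in> K\<close> by blast
  qed
  \<comment> \<open>Bounding both coordinates by \<open>e / 4\<close> keeps the norm below
    \<open>e / 2\<close> by the triangle inequality.\<close>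
  have near: "z + (x, t) \<in> K'" if "z \<in> K" "\<bar>x\<bar> \<le> e / 4" "\<bar>t\<bar> \<le> e / 4" for z x t
  proof -
    have "norm (x, t) \<le> e / 2" using norm_Pair_le[of x t] that by simp
    then show ?thesis using that(1) by (force simp: K'_def)
  qed
  obtain B0 where B0: "B0 \<ge> 0" "\<And>z \<tau>. (\<forall>s. 0 \<le> s \<longrightarrow> s \<le> 1 \<longrightarrow> z + (s * \<tau>) *\<^sub>R (0, 1) \<in> K') \<Longrightarrow>
      norm (u (z + \<tau> *\<^sub>R (0, 1)) - (\<Sum>n\<le>N. (\<tau> ^ n / fact n) *\<^sub>R (dird (0, 1) ^^ n) u z)) \<le> B0 * \<bar>\<tau>\<bar> ^ (N + 1)"
    using directional_taylor[OF u K' K'\<Omega>, of "(0, 1)" N] by blast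
  have "\<exists>B. \<forall>m. 0 \<le> B m \<and> (\<forall>z \<tau>. (\<forall>s. 0 \<le> s \<longrightarrow> s \<le> 1 \<longrightarrow> z + (s * \<tau>) *\<^sub>R (1, 0) \<in> K') \<longrightarrow>
      norm ((dird (0, 1) ^^ m) u (z + \<tau> *\<^sub>R (1, 0)) -
        (\<Sum>n\<le>N - m. (\<tau> ^ n / fact n) *\<^sub>R (dird (1, 0) ^^ n) ((dird (0, 1) ^^ m) u) z)) \<le> B m * \<bar>\<tau>\<bar> ^ (N - m + 1))"
    using directional_taylor[OF smooth_on_dird_power[OF u] K' K'\<Omega>] by (intro choice allI) blast
  then obtain B where B: "\<And>m. B m \<ge> 0" "\<And>m z \<tau>. (\<forall>s. 0 \<le> s \<longrightarrow> s \<le> 1 \<longrightarrow> z + (s * \<tau>) *\<^sub>R (1, 0) \<in> K') \<Longrightarrow>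
      norm ((dird (0, 1) ^^ m) u (z + \<tau> *\<^sub>R (1, 0)) -
        (\<Sum>n\<le>N - m. (\<tau> ^ n / fact n) *\<^sub>R (dird (1, 0) ^^ n) ((dird (0, 1) ^^ m) u) z)) \<le> B m * \<bar>\<tau>\<bar> ^ (N - m + 1)"
    by blast
  have scale: "\<bar>s * y\<bar> \<le> e / 4" if "0 \<le> s" "s \<le> 1" "\<bar>y\<bar> \<le> e / 4" for s y :: real
    using that mult_right_mono[of s 1 "\<bar>y\<bar>"] by (simp add: abs_mult)
  have "norm (u (z + (x, t)) - taylor2 N u z x t) \<le> (B0 + (\<Sum>m\<le>N. B m)) * (\<bar>x\<bar> + \<bar>t\<bar>) ^ (N + 1)"
    if z: "z \<in> K" and x: "\<bar>x\<bar> \<le> e / 4" and t: "\<bar>t\<bar> \<le> e / 4" for z x t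
  proof -
    define \<rho> where "\<rho> = \<bar>x\<bar> + \<bar>t\<bar>"
    have \<rho>: "\<bar>x\<bar> \<le> \<rho>" "\<bar>t\<bar> \<le> \<rho>" "0 \<le> \<rho>" by (auto simp: \<rho>_def)
    define R0 where "R0 = u (z + (x, t)) - (\<Sum>m\<le>N. (t ^ m / fact m) *\<^sub>R (dird (0, 1) ^^ m) u (z + (x, 0)))"
    define R where "R m = (dird (0, 1) ^^ m) u (z + (x, 0)) -
        (\<Sum>n\<le>N - m. (x ^ n / fact n) *\<^sub>R (dird (1, 0) ^^ n) ((dird (0, 1) ^^ m) u) z)" for m
    have "norm R0 \<le> B0 * \<bar>t\<bar> ^ (N + 1)"
      using B0(2)[of "z + (x, 0)" t] near[OF z x scale[OF _ _ t]]
      by (simp add: R0_def add.assoc)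
    also have "\<dots> \<le> B0 * \<rho> ^ (N + 1)" using B0(1) \<rho> by (intro mult_left_mono power_mono) auto
    finally have R0: "norm R0 \<le> B0 * \<rho> ^ (N + 1)" .
    have R: "norm ((t ^ m / fact m) *\<^sub>R R m) \<le> B m * \<rho> ^ (N + 1)" if "m \<le> N" for m
    proof -
      have "norm (R m) \<le> B m * \<bar>x\<bar> ^ (N - m + 1)"
        using B(2)[of z x m] near[OF z scale[OF _ _ x], of _ 0] e(1) by (simp add: R_def)
      also have "\<dots> \<le> B m * \<rho> ^ (N - m + 1)" using B(1) \<rho> by (intro mult_left_mono power_mono) auto
      finally have "norm (R m) \<le> B m * \<rho> ^ (N - m + 1)" .
      moreover have "\<bar>t ^ m / fact m\<bar> \<le> \<rho> ^ m / 1"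
        unfolding abs_divide power_abs using \<rho> fact_ge_1[of m, where 'a = real]
        by (intro frac_le power_mono) auto
      ultimately have "norm ((t ^ m / fact m) *\<^sub>R R m) \<le> \<rho> ^ m * (B m * \<rho> ^ (N - m + 1))"
        unfolding norm_scaleR using B(1) \<rho> by (intro mult_mono) auto
      also have "\<dots> = B m * \<rho> ^ (m + (N - m + 1))" by (simp only: power_add mult_ac)
      also have "m + (N - m + 1) = N + 1" using that by simp
      finally show ?thesis .
    qed
    have "taylor2 N u z x t =
        (\<Sum>m\<le>N. (t ^ m / fact m) *\<^sub>R (\<Sum>n\<le>N - m. (x ^ n / fact n) *\<^sub>R (dird (1, 0) ^^ n) ((dird (0, 1) ^^ m) u) z))"
      by (simp add: taylor2_def jetc_def scaleR_sum_right mult_ac)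
    then have "u (z + (x, t)) - taylor2 N u z x t = R0 + (\<Sum>m\<le>N. (t ^ m / fact m) *\<^sub>R R m)"
      by (simp add: R0_def R_def scaleR_diff_right sum_subtractf)
    also have "norm \<dots> \<le> B0 * \<rho> ^ (N + 1) + (\<Sum>m\<le>N. B m * \<rho> ^ (N + 1))"
      using R R0 by (intro norm_triangle_le add_mono sum_norm_le) auto
    also have "\<dots> = (B0 + (\<Sum>m\<le>N. B m)) * \<rho> ^ (N + 1)" by (simp add: distrib_right sum_distrib_right)
    finally show ?thesis by (simp only: \<rho>_def)
  qed
  moreover have "0 \<le> B0 + (\<Sum>m\<le>N. B m)" using B0(1) B(1) by (simp add: sum_nonneg)
  moreover have "z + (x, t) \<in> \<Omega>" if "z \<in> K" "\<bar>x\<bar> \<le> e / 4" "\<bar>t\<bar> \<le> e / 4" for z x t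
    using near[OF that] K'\<Omega> by blast
  moreover have "0 < e / 4" using e(1) by simp
  ultimately show ?thesis by blast
qed

section \<open>The jet of an exact solution satisfies the conservation law\<close>

lemma poly_bigo_imp_coeff_0:
  assumes "(\<lambda>x. poly P x) \<in> O[at_right 0](\<lambda>x::real. x ^ K)" "k < K"
  shows "coeff P k = 0"
  using assms
proof (induction K arbitrary: P k)
  case (Suc K)
  obtain c where "\<forall>\<^sub>F x in at_right 0. norm (poly P x) \<le> c * norm (x ^ Suc K)"
    using Suc.prems(1) by (elim landau_o.bigE)
  moreover have "((\<lambda>x::real. c * norm (x ^ Suc K)) \<longlongrightarrow> c * norm (0 ^ Suc K :: real)) (at_right 0)"
    by (intro tendsto_intros)
  moreover have "((\<lambda>x. norm (poly P x)) \<longlongrightarrow> norm (poly P 0)) (at_right 0)"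
    by (intro tendsto_intros)
  ultimately have "norm (poly P 0) \<le> c * norm (0 ^ Suc K :: real)"
    by (intro tendsto_le[of "at_right 0" "\<lambda>x::real. c * norm (x ^ Suc K)" _ "\<lambda>x. norm (poly P x)"]) auto
  then have P0: "coeff P 0 = 0" by (simp add: poly_0_coeff_0)
  define Q where "Q = poly_shift 1 P"
  have PQ: "P = pCons 0 Q"
    using P0 by (intro poly_eqI) (auto simp: Q_def coeff_pCons coeff_poly_shift split: nat.splits)
  have "(\<lambda>x. x * poly Q x) \<in> O[at_right 0](\<lambda>x. x * x ^ K)" using Suc.prems(1) by (simp add: PQ)
  moreover have "\<forall>\<^sub>F x::real in at_right 0. x \<noteq> 0"
    using eventually_at_right_less[of "0::real"] by eventually_elim auto
  ultimately have Q: "(\<lambda>x. poly Q x) \<in> O[at_right 0](\<lambda>x. x ^ K)"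
    by (subst (asm) landau_o.big.mult_cancel_left) auto
  show ?case
  proof (cases "k = 0")
    case False
    then have "k - 1 < K" using Suc.prems(2) by simp
    then have "coeff Q (k - 1) = 0" by (rule Suc.IH[OF Q])
    moreover have "coeff Q (k - 1) = coeff P k" unfolding Q_def coeff_poly_shift using False by simp
    ultimately show ?thesis by argo
  next
    case True
    show ?thesis unfolding True by (rule P0)
  qed
next
  case 0
  from 0(2) show ?case by simp
qed

text \<open>Along a ray the coefficient of \<open>z ^ k\<close> is a polynomial in the slope with
  coefficients \<open>coeff2 g j (k - j)\<close>. It vanishes for all positive slopes, hence
  identically.\<close>

lemma trunc_ideal_if_ev_bigo:
  assumes "\<And>\<alpha>. 0 < \<alpha> \<Longrightarrow> (\<lambda>z. ev \<alpha> z g) \<in> O[at_right 0](\<lambda>z. z ^ (N + 1))"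
  shows "g \<in> trunc_ideal N"
proof -
  have "coeff2 g j (k - j) = 0" if k: "k \<le> N" and j: "j \<le> k" for j k
  proof -
    define Q where "Q = (\<Sum>j\<le>k. monom (coeff2 g j (k - j)) j)"
    have "poly Q \<alpha> = 0" if "0 < \<alpha>" for \<alpha>
    proof -
      define D where "D = max k (degree g)"
      have "coeff (coeff g j * [:0, \<alpha>:] ^ j) k = (if j \<le> k then coeff2 g j (k - j) * \<alpha> ^ j else 0)" for j
      proof -
        have "[:0, \<alpha>:] = monom \<alpha> 1" by (simp add: monom_altdef)
        then show ?thesis by (simp add: monom_power mult.commute[of "coeff g j"] coeff_monom_mult)
      qed
      moreover have "poly g [:0, \<alpha>:] = (\<Sum>j\<le>D. coeff g j * [:0, \<alpha>:] ^ j)"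
        unfolding poly_altdef by (intro sum.mono_neutral_left) (auto simp: coeff_eq_0 D_def)
      ultimately have "coeff (poly g [:0, \<alpha>:]) k = (\<Sum>j\<le>D. if j \<le> k then coeff2 g j (k - j) * \<alpha> ^ j else 0)"
        by (simp add: coeff_sum)
      also have "\<dots> = (\<Sum>j\<le>k. coeff2 g j (k - j) * \<alpha> ^ j)"
        by (rule sum.mono_neutral_cong_right) (auto simp: D_def)
      also have "\<dots> = poly Q \<alpha>" by (simp add: Q_def poly_sum poly_monom)
      finally show ?thesis
        using poly_bigo_imp_coeff_0[of "poly g [:0, \<alpha>:]" "N + 1" k] assms[OF that] k
        by (simp add: ev_def)
    qed
    then have "{0<..} \<subseteq> {x. poly Q x = 0}" by auto
    then have "infinite {x. poly Q x = 0}" using infinite_Ioi[of "0::real"] finite_subset by blast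
    then have "Q = 0" using poly_roots_finite by blast
    then have "coeff Q j = 0" by simp
    then show ?thesis using j by (simp add: Q_def coeff_sum)
  qed
  from this[of "j + n" j for j n] show ?thesis by (auto simp: trunc_ideal_def)
qed

text \<open>Jet of the increment from \<open>u z\<close> at time offset \<open>\<sigma> * h\<close>,
  hence the missing constant term and the factor \<open>\<sigma> ^ m\<close>. Three values of
  \<sigma> occur: 0 gives the data at the old time level, 1 lets \<open>h\<close> stand for time as
  in \<open>U_jet\<close>, and \<open>dt / dx\<close> gives the exact solution at the new time
  level.\<close>

definition jet :: "nat \<Rightarrow> (real \<times> real \<Rightarrow> 'a::euclidean_space) \<Rightarrow> real \<Rightarrow> real \<times> real \<Rightarrow> 'a \<Rightarrow> real poly poly" where
  "jet N u \<sigma> z b = (\<Sum>m\<le>N. \<Sum>j\<le>N - m.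
     monom (monom (if j = 0 \<and> m = 0 then 0 else \<sigma> ^ m * (jetc u j m z \<bullet> b)) m) j)"

lemma coeff2_monom: "coeff2 (monom (monom c m') j') j m = (if m' = m then (if j' = j then c else 0) else 0)"
  by simp

lemma coeff2_jet:
  "coeff2 (jet N u \<sigma> z b) j m = (if j + m \<le> N \<and> 0 < j + m then \<sigma> ^ m * (jetc u j m z \<bullet> b) else 0)"
proof -
  define c where "c j m = (if j = 0 \<and> m = 0 then 0 else \<sigma> ^ m * (jetc u j m z \<bullet> b))" for j m
  have "coeff2 (jet N u \<sigma> z b) j m =
      (\<Sum>m'\<le>N. if m' = m then (\<Sum>j'\<le>N - m'. if j' = j then c j' m' else 0) else 0)"
    unfolding jet_def c_def[symmetric] coeff_sum coeff2_monom by (intro sum.cong refl) auto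
  then show ?thesis by (auto simp: c_def)
qed

lemma bidegree_le_jet: "bidegree_le N (jet N u \<sigma> z b)"
  by (auto simp: bidegree_le_def coeff2_jet)

lemma ev_monom: "ev \<alpha> h (monom (monom c m) j) = c * h ^ m * (\<alpha> * h) ^ j"
  by (simp add: ev_def poly_monom mult_ac)

lemma ev_sum: "ev \<alpha> h (sum g A) = (\<Sum>i\<in>A. ev \<alpha> h (g i))"
  by (simp add: ev_def poly_sum)

lemma ev_jet: "ev \<alpha> h (jet N u \<sigma> z b) = (taylor2 N u z (\<alpha> * h) (\<sigma> * h) - u z) \<bullet> b"
proof -
  let ?t = "\<lambda>j m. ((\<alpha> * h) ^ j * (\<sigma> * h) ^ m) * (jetc u j m z \<bullet> b)"
  have "(\<Sum>m\<le>N. \<Sum>j\<le>N - m. ?t j m) - ev \<alpha> h (jet N u \<sigma> z b) =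
      (\<Sum>m\<le>N. \<Sum>j\<le>N - m. if j = 0 \<and> m = 0 then u z \<bullet> b else 0)"
    unfolding jet_def ev_sum ev_monom sum_subtractf[symmetric]
    by (intro sum.cong refl) (auto simp: power_mult_distrib)
  also have "\<dots> = (\<Sum>m\<le>N. if m = 0 then (\<Sum>j\<le>N - m. if j = 0 then u z \<bullet> b else 0) else 0)"
    by (intro sum.cong refl) auto
  also have "\<dots> = u z \<bullet> b" by simp
  finally show ?thesis by (simp add: taylor2_def inner_diff_left inner_sum_left)
qed

lemma compact_inner_bigo:
  assumes "continuous_on S g" "compact K" "K \<subseteq> S" "\<forall>\<^sub>F \<omega> in F. z \<omega> \<in> K"
  shows "(\<lambda>\<omega>. g (z \<omega>) \<bullet> b) \<in> O[F](\<lambda>_. 1)"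
proof -
  have "compact ((\<lambda>z. g z \<bullet> b) ` K)"
    using assms continuous_on_subset by (intro compact_continuous_image continuous_intros) auto
  then obtain M where "\<forall>x\<in>(\<lambda>z. g z \<bullet> b) ` K. norm x \<le> M" using compact_imp_bounded bounded_iff by metis
  then have "\<forall>\<^sub>F \<omega> in F. norm (g (z \<omega>) \<bullet> b) \<le> M * norm (1::real)"
    using assms(4) by (auto elim: eventually_mono)
  then show ?thesis by (rule bigoI)
qed

lemma coeff2_translate_0: "coeff2 (translate i g) j 0 = coeff2 g j 0"
proof -
  have "hh ^ 1 dvd translate i g - translate 0 g" using hh_dvd_translate_diff[of i g 0] by simp
  then show ?thesis unfolding hh_power_dvd_iff by simp
qed

section \<open>Jets represent increments of the exact solution\<close>

context expansion
begin

lemma bounded_family_jet: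
  assumes "smooth_on \<Omega> u" "compact K" "K \<subseteq> \<Omega>" "\<forall>\<^sub>F \<omega> in F. z \<omega> \<in> K" "\<sigma> \<in> O[F](\<lambda>_. 1)"
  shows "bounded_family F (\<lambda>\<omega>. jet N u (\<sigma> \<omega>) (z \<omega>) b)"
proof -
  have "(\<lambda>\<omega>. \<sigma> \<omega> ^ m * (jetc u j m (z \<omega>) \<bullet> b)) \<in> O[F](\<lambda>_. 1)" for j m
    using landau_o.big.mult[OF landau_o.big_power[OF assms(5), of m]
        compact_inner_bigo[OF smooth_on_jetc[OF assms(1)] assms(2-4)]] by simp
  then have "(\<lambda>\<omega>. coeff2 (jet N u (\<sigma> \<omega>) (z \<omega>) b) j m) \<in> O[F](\<lambda>_. 1)" for j m
    by (cases "j + m \<le> N \<and> 0 < j + m") (simp_all only: coeff2_jet if_True if_False simp_thms, simp)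
  then show ?thesis unfolding bounded_family_def using bidegree_le_jet by blast
qed

text \<open>The slope \<beta> is independent of \<alpha>: at \<open>\<alpha> = 0\<close> the value
  at node \<open>i\<close> is read off the untranslated jet on the ray of slope
  \<open>i\<close>.\<close>

lemma jet_bigo:
  assumes u: "smooth_on \<Omega> u" and \<Omega>: "open \<Omega>" and K: "compact K" "K \<subseteq> \<Omega>"
    and z: "\<forall>\<^sub>F \<omega> in F. z \<omega> \<in> K" and \<sigma>: "\<sigma> \<in> O[F](\<lambda>_. 1)" and b: "b \<in> Basis"
  shows "(\<lambda>\<omega>. (u (z \<omega> + (\<beta> * h \<omega>, \<sigma> \<omega> * h \<omega>)) - u (z \<omega>)) \<bullet> b - ev \<beta> (h \<omega>) (jet N u (\<sigma> \<omega>) (z \<omega>) b))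
    \<in> O[F](\<lambda>\<omega>. h \<omega> ^ (N + 1))"
proof -
  obtain \<epsilon> B where eB: "\<epsilon> > 0" "B \<ge> 0" "\<And>z x t. z \<in> K \<Longrightarrow> \<bar>x\<bar> \<le> \<epsilon> \<Longrightarrow> \<bar>t\<bar> \<le> \<epsilon> \<Longrightarrow>
      norm (u (z + (x, t)) - taylor2 N u z x t) \<le> B * (\<bar>x\<bar> + \<bar>t\<bar>) ^ (N + 1)"
    using taylor2_bound[OF u \<Omega> K, of N] by blast
  obtain c where c: "c > 0" "\<forall>\<^sub>F \<omega> in F. norm (\<sigma> \<omega>) \<le> c * norm (1::real)"
    using \<sigma> by (elim landau_o.bigE)
  have lim: "((\<lambda>\<omega>. (\<bar>\<beta>\<bar> + c) * h \<omega>) \<longlongrightarrow> 0) F" by (rule tendsto_mult_right_zero[OF h_lim])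
  have "\<forall>\<^sub>F \<omega> in F. norm ((u (z \<omega> + (\<beta> * h \<omega>, \<sigma> \<omega> * h \<omega>)) - u (z \<omega>)) \<bullet> b -
      ev \<beta> (h \<omega>) (jet N u (\<sigma> \<omega>) (z \<omega>) b)) \<le> (B * (\<bar>\<beta>\<bar> + c) ^ (N + 1)) * norm (h \<omega> ^ (N + 1))"
    using z c(2) h_pos order_tendstoD(2)[OF lim eB(1)]
  proof eventually_elim
    case (elim \<omega>)
    have 1: "\<bar>\<sigma> \<omega> * h \<omega>\<bar> \<le> c * h \<omega>" using elim by (simp add: abs_mult)
    have 2: "\<bar>\<beta> * h \<omega>\<bar> = \<bar>\<beta>\<bar> * h \<omega>" using elim by (simp add: abs_mult)
    have 3: "\<bar>\<beta> * h \<omega>\<bar> + \<bar>\<sigma> \<omega> * h \<omega>\<bar> \<le> (\<bar>\<beta>\<bar> + c) * h \<omega>"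
      using 1 2 by (simp add: distrib_right)
    then have small: "\<bar>\<beta> * h \<omega>\<bar> \<le> \<epsilon>" "\<bar>\<sigma> \<omega> * h \<omega>\<bar> \<le> \<epsilon>" using elim(4) by linarith+
    have "norm (u (z \<omega> + (\<beta> * h \<omega>, \<sigma> \<omega> * h \<omega>)) - taylor2 N u (z \<omega>) (\<beta> * h \<omega>) (\<sigma> \<omega> * h \<omega>)) \<le>
        B * (\<bar>\<beta> * h \<omega>\<bar> + \<bar>\<sigma> \<omega> * h \<omega>\<bar>) ^ (N + 1)"
      by (rule eB(3)[OF elim(1) small])
    also have "\<dots> \<le> B * ((\<bar>\<beta>\<bar> + c) * h \<omega>) ^ (N + 1)"
      using 3 eB(2) by (intro mult_left_mono power_mono) auto
    also have "\<dots> = (B * (\<bar>\<beta>\<bar> + c) ^ (N + 1)) * norm (h \<omega> ^ (N + 1))"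
      using elim(3) by (simp only: power_mult_distrib) (simp add: mult_ac)
    finally have "norm (u (z \<omega> + (\<beta> * h \<omega>, \<sigma> \<omega> * h \<omega>)) - taylor2 N u (z \<omega>) (\<beta> * h \<omega>) (\<sigma> \<omega> * h \<omega>)) \<le>
      (B * (\<bar>\<beta>\<bar> + c) ^ (N + 1)) * norm (h \<omega> ^ (N + 1))" .
    moreover have "(u (z \<omega> + (\<beta> * h \<omega>, \<sigma> \<omega> * h \<omega>)) - u (z \<omega>)) \<bullet> b - ev \<beta> (h \<omega>) (jet N u (\<sigma> \<omega>) (z \<omega>) b) =
        (u (z \<omega> + (\<beta> * h \<omega>, \<sigma> \<omega> * h \<omega>)) - taylor2 N u (z \<omega>) (\<beta> * h \<omega>) (\<sigma> \<omega> * h \<omega>)) \<bullet> b"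
      by (simp add: ev_jet inner_diff_left)
    ultimately show ?case using Basis_le_norm[OF b] order.trans by fastforce
  qed
  then show ?thesis by (rule bigoI)
qed

lemma rep_jet:
  assumes "smooth_on \<Omega> u" "open \<Omega>" "compact K" "K \<subseteq> \<Omega>" "\<forall>\<^sub>F \<omega> in F. z \<omega> \<in> K" "\<sigma> \<in> O[F](\<lambda>_. 1)"
  shows "rep (\<lambda>\<omega>. u (z \<omega> + (\<alpha> * h \<omega>, \<sigma> \<omega> * h \<omega>)) - u (z \<omega>)) (\<lambda>\<omega>. jet N u (\<sigma> \<omega>) (z \<omega>))"
  unfolding rep_def using bounded_family_jet[OF assms(1,3-6)] jet_bigo[OF assms]
  by (auto simp: coeff2_jet)

lemma rep_jet_translate:
  assumes "smooth_on \<Omega> u" "open \<Omega>" "compact K" "K \<subseteq> \<Omega>" "\<forall>\<^sub>F \<omega> in F. z \<omega> \<in> K" "\<sigma> \<in> O[F](\<lambda>_. 1)" "\<alpha> = 0"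
  shows "rep (\<lambda>\<omega>. u (z \<omega> + (of_int i * h \<omega>, \<sigma> \<omega> * h \<omega>)) - u (z \<omega>)) (\<lambda>\<omega> b. translate i (jet N u (\<sigma> \<omega>) (z \<omega>) b))"
  unfolding rep_def using bounded_family_translate[OF bounded_family_jet[OF assms(1,3-6)]] jet_bigo[OF assms(1-6)]
  by (auto simp: coeff2_jet coeff2_translate_0 \<open>\<alpha> = 0\<close> ev_translate)

end

lemma expansion_at_right_0: "expansion (at_right 0) (\<lambda>x. x)"
  by unfold_locales (auto simp: eventually_at_right_less tendsto_ident_at)

text \<open>\<open>vector_derivative\<close> is meaningful only where a derivative exists;
  smoothness and the chain rule provide it and turn the equation in \<open>exact_solution\<close>
  into a derivative statement.\<close>

lemma flux_has_derivative:
  fixes f :: "'a::euclidean_space \<Rightarrow> 'a" and w :: "real \<Rightarrow> real \<Rightarrow> 'a"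
  defines "u \<equiv> \<lambda>(x, t). w x t"
  assumes f: "smooth_on UNIV f" and u: "smooth_on \<Omega> u" and sol: "exact_solution f w \<Omega>"
    and z: "z + (x, 0) \<in> \<Omega>"
  shows "((\<lambda>x. f (u (z + (x, 0)))) has_vector_derivative - dird (0, 1) u (z + (x, 0))) (at x)"
proof -
  let ?D = "frechet_derivative f (at (u (z + (x, 0)))) (dird (1, 0) u (z + (x, 0)))"
  \<comment> \<open>The base point is free because it is used twice: with \<open>(0, t')\<close> to
    match the equation, and with \<open>z\<close> for the conclusion.\<close>
  have deriv: "((\<lambda>s. f (u (z' + s *\<^sub>R (1, 0)))) has_vector_derivative ?D) (at s)"
    if "z' + s *\<^sub>R (1, 0) = z + (x, 0)" for z' s
  proof -
    have "((\<lambda>s. u (z' + s *\<^sub>R (1, 0))) has_vector_derivative dird (1, 0) u (z' + s *\<^sub>R (1, 0))) (at s)"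
      using smooth_on_differentiable[OF u z] that by (intro dird_curve) simp
    moreover have "(f has_derivative frechet_derivative f (at (u (z + (x, 0))))) (at (u (z' + s *\<^sub>R (1, 0))))"
      using smooth_on_differentiable[OF f] that by (simp add: frechet_derivative_works)
    ultimately show ?thesis
      using vector_derivative_diff_chain_within[of "\<lambda>s. u (z' + s *\<^sub>R (1, 0))" _ s UNIV f] that
      by (auto simp: o_def intro: has_derivative_at_withinI)
  qed
  obtain x' t' where z': "z + (x, 0) = (x', t')" by (cases "z + (x, 0)")
  have "vector_derivative (\<lambda>x. f (w x t')) (at x') = ?D"
    using deriv[of "(0, t')" x'] z' by (intro vector_derivative_at) (simp add: u_def)
  moreover have "vector_derivative (\<lambda>t. w x' t) (at t') = dird (0, 1) u (z + (x, 0))"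
    using dird_curve[of u "(x', 0)" t' "(0, 1)"] smooth_on_differentiable[OF u z] z'
    by (intro vector_derivative_at) (simp add: u_def)
  ultimately have "?D = - dird (0, 1) u (z + (x, 0))"
    using sol z unfolding exact_solution_def z' by (auto simp: eq_neg_iff_add_eq_0 add.commute)
  then show ?thesis using deriv[of z x] by simp
qed

text \<open>Integrating the equation in space expresses the flux increment along a horizontal
  segment by the time derivative of \<open>w\<close>. Expanding both sides along rays and comparing
  gives the coefficients, so repeated differentiation of \<open>f\<close> composed with
  \<open>w\<close> is avoided.\<close>

lemma jet_conservation_law:
  fixes f :: "'a::euclidean_space \<Rightarrow> 'a" and w :: "real \<Rightarrow> real \<Rightarrow> 'a"
  defines "u \<equiv> \<lambda>(x, t). w x t"
  assumes f: "smooth_on UNIV f" and \<Omega>: "open \<Omega>" and u: "smooth_on \<Omega> u" and sol: "exact_solution f w \<Omega>"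
    and z: "z \<in> \<Omega>" and b: "b \<in> Basis" and n: "0 < n" "j + n \<le> N"
  shows "real n * coeff2 (jet N u 1 z b) j n =
    - (real (Suc j) * coeff2 (polynomial_flux.P2 Basis N (taylor_coeff f (u z)) (jet N u 1 z) b) (Suc j) (n - 1))"
proof -
  define g where "g = polynomial_flux.P2 Basis N (taylor_coeff f (u z)) (jet N u 1 z) b"
  define Du where "Du = dird (0, 1) u"
  \<comment> \<open>Coefficients of the antiderivative in \<open>x\<close>, vanishing at
    \<open>x = 0\<close>, of the Taylor polynomial of degree \<open>N - 1\<close> of the time
    derivative.\<close>
  define q where "q j m = jetc Du j m z \<bullet> b / real (Suc j)" for j m
  define Q where "Q = (\<Sum>m\<le>N - 1. \<Sum>j\<le>N - 1 - m. monom (monom (q j m) m) (Suc j))"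
  define Qr where "Qr x t = (\<Sum>m\<le>N - 1. \<Sum>j\<le>N - 1 - m. q j m * t ^ m * x ^ Suc j)" for x t
  have evQ: "ev \<alpha> t Q = Qr (\<alpha> * t) t" for \<alpha> t
    by (simp only: Q_def Qr_def ev_sum ev_monom)
  have Du: "smooth_on \<Omega> Du" unfolding Du_def by (rule smooth_on_dird[OF u])
  have zK: "compact {z}" "{z} \<subseteq> \<Omega>" using z by auto
  obtain \<epsilon> B where eB: "\<epsilon> > 0" "B \<ge> 0" "\<And>x t. \<bar>x\<bar> \<le> \<epsilon> \<Longrightarrow> \<bar>t\<bar> \<le> \<epsilon> \<Longrightarrow> z + (x, t) \<in> \<Omega> \<and>
      norm (Du (z + (x, t)) - taylor2 (N - 1) Du z x t) \<le> B * (\<bar>x\<bar> + \<bar>t\<bar>) ^ N"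
    using taylor2_bound[OF Du \<Omega> zK, of "N - 1"] n by auto
  have flux: "(\<lambda>t. (f (u (z + (\<beta> * t, t))) - f (u z)) \<bullet> b - ev \<beta> t g) \<in> O[at_right 0](\<lambda>t. t ^ (N + 1))" for \<beta>
  proof -
    interpret expansion "at_right 0" "\<lambda>t. t" \<beta> N by (rule expansion_at_right_0)
    obtain B where B: "\<forall>\<delta>. norm \<delta> \<le> 1 \<longrightarrow> (\<forall>c\<in>Basis. \<bar>(f (u z + \<delta>) - f (u z)) \<bullet> c -
        pmap Basis N (taylor_coeff f (u z)) (\<lambda>b. \<delta> \<bullet> b) c\<bar> \<le> B * norm \<delta> ^ (N + 1))"
      using taylor_polynomial_map[OF f, of "{u z}" N] by auto
    have "rep (\<lambda>t. u (z + (\<beta> * t, 1 * t)) - u z) (\<lambda>t. jet N u 1 z)"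
      by (rule rep_jet[OF u \<Omega> zK]) auto
    from rep_flux[of "\<lambda>_ \<delta>. f (u z + \<delta>) - f (u z)" "\<lambda>_. taylor_coeff f (u z)" B, OF _ _ _ this]
    have "rep (\<lambda>t. f (u (z + (\<beta> * t, t))) - f (u z))
        (\<lambda>t. polynomial_flux.P2 Basis N (taylor_coeff f (u z)) (jet N u 1 z))"
      using B by (simp add: taylor_coeff_def)
    from repD(3)[OF this b] show ?thesis by (simp add: g_def)
  qed
  \<comment> \<open>\<open>[:coeff g 0:]\<close> is the part of \<open>g\<close> free of
    \<open>x\<close>, the formal flux on the line \<open>x = 0\<close>.\<close>
  have "g - [:coeff g 0:] + Q \<in> trunc_ideal N"
  proof (rule trunc_ideal_if_ev_bigo)
    fix \<alpha> :: real assume \<alpha>: "0 < \<alpha>"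
    have lim: "((\<lambda>t. (\<alpha> + 1) * t) \<longlongrightarrow> 0) (at_right 0)"
      by (rule tendsto_mult_right_zero) (rule tendsto_ident_at)
    have "\<forall>\<^sub>F t in at_right 0. norm (f (u (z + (\<alpha> * t, t))) \<bullet> b + Qr (\<alpha> * t) t - f (u (z + (0, t))) \<bullet> b) \<le>
        (\<alpha> * B * (\<alpha> + 1) ^ N) * norm (t ^ (N + 1))"
      using eventually_at_right_less[of "0::real"] order_tendstoD(2)[OF lim eB(1)]
    proof eventually_elim
      case (elim t)
      define \<psi> where "\<psi> x = f (u (z + (0, t) + (x, 0))) \<bullet> b + Qr x t" for x
      have small: "\<bar>x\<bar> \<le> \<epsilon>" "\<bar>t\<bar> \<le> \<epsilon>" if "0 \<le> x" "x \<le> \<alpha> * t" for x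
        using that elim mult_pos_pos[OF \<alpha> elim(1)] by (auto simp: algebra_simps)
      have \<psi>': "(\<psi> has_real_derivative - (Du (z + (x, t)) \<bullet> b) + taylor2 (N - 1) Du z x t \<bullet> b) (at x)"
        if "0 \<le> x" "x \<le> \<alpha> * t" for x
      proof -
        have "z + (0, t) + (x, 0) \<in> \<Omega>" using eB(3)[OF small[OF that]] by (simp add: add.assoc)
        from flux_has_derivative[OF f u[unfolded u_def] sol this, folded u_def]
        have "((\<lambda>x. f (u (z + (0, t) + (x, 0))) \<bullet> b) has_real_derivative - (Du (z + (x, t)) \<bullet> b)) (at x)"
          using bounded_linear.has_vector_derivative[OF bounded_linear_inner_left[of b]]
          by (fastforce simp: has_real_derivative_iff_has_vector_derivative Du_def add.assoc)
        moreover have "((\<lambda>x. Qr x t) has_real_derivative taylor2 (N - 1) Du z x t \<bullet> b) (at x)"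
        proof -
          have "((\<lambda>x. q j m * t ^ m * x ^ Suc j) has_real_derivative q j m * t ^ m * (real (Suc j) * x ^ j)) (at x)" for j m
            using DERIV_cmult[OF DERIV_pow[of "Suc j" x UNIV], of "q j m * t ^ m"]
            by (simp del: power_Suc of_nat_Suc)
          then have "((\<lambda>x. Qr x t) has_real_derivative
              (\<Sum>m\<le>N - 1. \<Sum>j\<le>N - 1 - m. q j m * t ^ m * (real (Suc j) * x ^ j))) (at x)"
            unfolding Qr_def by (intro DERIV_sum)
          also have "(\<Sum>m\<le>N - 1. \<Sum>j\<le>N - 1 - m. q j m * t ^ m * (real (Suc j) * x ^ j)) = taylor2 (N - 1) Du z x t \<bullet> b"
            unfolding taylor2_def inner_sum_left q_def
            by (intro sum.cong refl) (simp del: of_nat_Suc)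
          finally show ?thesis .
        qed
        ultimately show ?thesis unfolding \<psi>_def by (rule DERIV_add)
      qed
      have "0 < \<alpha> * t" using \<alpha> elim(1) by simp
      \<comment> \<open>The derivative of \<open>\<psi>\<close> is a Taylor remainder of order
        \<open>N\<close>; the length \<open>\<alpha> * t\<close> of the interval supplies the
        missing order.\<close>
      from MVT2[OF this \<psi>'] obtain \<xi> where \<xi>: "0 < \<xi>" "\<xi> < \<alpha> * t"
        "\<psi> (\<alpha> * t) - \<psi> 0 = (\<alpha> * t - 0) * (- (Du (z + (\<xi>, t)) \<bullet> b) + taylor2 (N - 1) Du z \<xi> t \<bullet> b)"
        by blast
      have "\<bar>- (Du (z + (\<xi>, t)) \<bullet> b) + taylor2 (N - 1) Du z \<xi> t \<bullet> b\<bar> =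
          \<bar>(Du (z + (\<xi>, t)) - taylor2 (N - 1) Du z \<xi> t) \<bullet> b\<bar>"
        by (simp add: inner_diff_left)
      also have "\<dots> \<le> norm (Du (z + (\<xi>, t)) - taylor2 (N - 1) Du z \<xi> t)" by (rule Basis_le_norm[OF b])
      also have "\<dots> \<le> B * (\<bar>\<xi>\<bar> + \<bar>t\<bar>) ^ N" using eB(3)[OF small(1,2)[of \<xi>]] \<xi> by simp
      also have "\<dots> \<le> B * ((\<alpha> + 1) * t) ^ N"
        using \<xi> elim eB(2) by (intro mult_left_mono power_mono) (auto simp: algebra_simps)
      finally have bound: "\<bar>- (Du (z + (\<xi>, t)) \<bullet> b) + taylor2 (N - 1) Du z \<xi> t \<bullet> b\<bar> \<le> B * ((\<alpha> + 1) * t) ^ N" .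
      have "\<bar>\<psi> (\<alpha> * t) - \<psi> 0\<bar> = (\<alpha> * t) * \<bar>- (Du (z + (\<xi>, t)) \<bullet> b) + taylor2 (N - 1) Du z \<xi> t \<bullet> b\<bar>"
        using \<alpha> elim(1) unfolding \<xi>(3) abs_mult by simp
      also have "\<dots> \<le> (\<alpha> * t) * (B * ((\<alpha> + 1) * t) ^ N)"
        using bound \<alpha> elim(1) by (intro mult_left_mono) auto
      also have "\<dots> = (\<alpha> * B * (\<alpha> + 1) ^ N) * norm (t ^ (N + 1))"
        using elim(1) by (simp add: power_mult_distrib mult_ac)
      finally show ?case by (simp add: \<psi>_def add.assoc Qr_def)
    qed
    then have mvt: "(\<lambda>t. f (u (z + (\<alpha> * t, t))) \<bullet> b + Qr (\<alpha> * t) t - f (u (z + (0, t))) \<bullet> b) \<in>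
        O[at_right 0](\<lambda>t. t ^ (N + 1))"
      by (rule bigoI)
    have eq: "ev \<alpha> t (g - [:coeff g 0:] + Q) =
        (f (u (z + (\<alpha> * t, t))) \<bullet> b + Qr (\<alpha> * t) t - f (u (z + (0, t))) \<bullet> b) -
        ((f (u (z + (\<alpha> * t, t))) - f (u z)) \<bullet> b - ev \<alpha> t g) +
        ((f (u (z + (0 * t, t))) - f (u z)) \<bullet> b - ev 0 t g)" for t
    proof -
      have "ev \<alpha> t [:coeff g 0:] = ev 0 t g" by (simp add: ev_def poly_0_coeff_0)
      then show ?thesis by (simp add: evQ inner_diff_left)
    qed
    show "(\<lambda>t. ev \<alpha> t (g - [:coeff g 0:] + Q)) \<in> O[at_right 0](\<lambda>t. t ^ (N + 1))"
      unfolding eq by (rule sum_in_bigo(1)[OF sum_in_bigo(2)[OF mvt flux[of \<alpha>]] flux[of 0]])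
  qed
  then have "coeff2 (g - [:coeff g 0:] + Q) (Suc j) (n - 1) = 0"
    unfolding trunc_ideal_def mem_Collect_eq using n by (elim allE[of _ "Suc j"] allE[of _ "n - 1"]) simp
  moreover have "coeff2 Q (Suc j) (n - 1) = q j (n - 1)"
  proof -
    have "coeff2 Q (Suc j) (n - 1) =
        (\<Sum>m\<le>N - 1. if m = n - 1 then (\<Sum>j'\<le>N - 1 - m. if j' = j then q j' m else 0) else 0)"
      unfolding Q_def coeff_sum coeff2_monom by (intro sum.cong refl) auto
    also have "\<dots> = q j (n - 1)" using n by auto
    finally show ?thesis .
  qed
  ultimately have "coeff2 g (Suc j) (n - 1) = - q j (n - 1)" by simp
  moreover have "q j (n - 1) = real n * (jetc u j n z \<bullet> b) / real (Suc j)"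
    using n(1) by (simp add: q_def Du_def jetc_dird del: of_nat_Suc)
  ultimately show ?thesis
    using n by (simp add: g_def[symmetric] coeff2_jet del: of_nat_Suc)
qed

section \<open>Consistency of the MDRKCAT method\<close>

text \<open>The three symmetries move node \<open>i\<close> to 0, the grid size to 1 and the
  solution value to the origin.\<close>

lemma mdrkcat_residual_normal_form:
  fixes f :: "'a::real_normed_vector \<Rightarrow> 'a" and w :: "real \<Rightarrow> real \<Rightarrow> 'a"
  defines "u \<equiv> \<lambda>(x, t). w x t"
  assumes "1 \<le> p" "dx \<noteq> 0" "dt \<noteq> 0"
    and z: "z = (\<xi> + of_int i * dx, t)"
    and \<phi>: "\<phi> = (\<lambda>y. f (u z + y) - f (u z))"
    and v: "v = (\<lambda>m. u (z + (of_int m * dx, 0)) - u z)"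
  shows "mdrkcat_residual p r s a b f w dx dt \<xi> t i =
    (u (z + (0, dt)) - u z) -
    mdrkcat_update p r \<phi> 1 (dt / dx) b {1..s} (mdrkcat_stage p r a \<phi> 1 (dt / dx) v) v 0"
proof -
  define U where "U = (\<lambda>i::int. w (\<xi> + of_int i * dx) t)"
  define U' where "U' = (\<lambda>m. U (m + i))"
  have v': "v = (\<lambda>m. U' m - u z)"
    by (simp add: v U'_def U_def u_def z algebra_simps)
  have stage: "mdrkcat_stage p r a f dx dt U \<nu> (m + i) =
      mdrkcat_stage p r a \<phi> 1 (dt / dx) v \<nu> m + u z" for \<nu> m
    unfolding mdrkcat_stage_shift_nodes U'_def[symmetric] mdrkcat_stage_rescale[OF assms(3,4)]
      mdrkcat_stage_shift_origin[OF assms(2), of r a f _ _ _ _ _ "u z"] \<phi> v' ..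
  have "mdrkcat_update p r f dx dt b {1..s} (mdrkcat_stage p r a f dx dt U) U (0 + i) =
      mdrkcat_update p r f dx dt b {1..s} (\<lambda>\<nu> m. mdrkcat_stage p r a f dx dt U \<nu> (m + i)) U' 0"
    unfolding U'_def by (rule mdrkcat_update_shift_nodes)
  also have "\<dots> = mdrkcat_update p r \<phi> 1 (dt / dx) b {1..s} (mdrkcat_stage p r a \<phi> 1 (dt / dx) v) v 0 + u z"
    unfolding stage mdrkcat_update_rescale[OF assms(3,4)]
      mdrkcat_update_shift_origin[OF assms(2), of r f _ _ _ _ _ _ _ "u z"] by (simp add: \<phi> v')
  finally show ?thesis
    unfolding mdrkcat_residual_def Let_def mdrkcat_final_flux_def
    by (simp add: mdrkcat_update_def U_def u_def z algebra_simps)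
qed

text \<open>Only powers free of \<open>x\<close> are compared, the residual being read at the node
  itself. The bound \<open>n \<le> 2 * p\<close> replaces the numerical method by the formal one,
  and \<open>n \<le> q\<close> replaces the latter by the formal solution, which
  \<open>U_jet\<close> identifies with the jet of \<open>w\<close>.\<close>

lemma formal_residual_vanishes:
  fixes f :: "'a::euclidean_space \<Rightarrow> 'a" and w :: "real \<Rightarrow> real \<Rightarrow> 'a" and p q :: nat
  defines "u \<equiv> \<lambda>(x, t). w x t" and "N \<equiv> min (2 * p) q"
  assumes p: "1 \<le> p" and ord: "mdrk_has_order r s a b q"
    and f: "smooth_on UNIV f" and \<Omega>: "open \<Omega>" and u: "smooth_on \<Omega> u" and sol: "exact_solution f w \<Omega>"
    and z: "z \<in> \<Omega>" and \<sigma>: "0 < \<sigma>" and c: "c \<in> Basis" and n: "n \<le> N"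
    and \<phi>: "\<phi> = polynomial_flux.P2 Basis N (taylor_coeff f (u z))"
    and v: "v = (\<lambda>i c. translate i (jet N u 0 z c))"
  shows "coeff2 (mdrkcat_update p r \<phi> 1 \<sigma> b {1..s} (mdrkcat_stage p r a \<phi> 1 \<sigma> v) v 0 c) 0 n =
    coeff2 (jet N u \<sigma> z c) 0 n"
proof -
  interpret polynomial_flux "Basis :: 'a set" N "taylor_coeff f (u z)" .
  let ?w = "jet N u 0 z"
  have "hh ^ (2 * p + 1) dvd mdrkcat_update p r \<phi> 1 \<sigma> b {1..s} (mdrkcat_stage p r a \<phi> 1 \<sigma> v) v 0 c -
      formal_update r \<sigma> b {1..s} (formal_stage r a \<sigma> ?w) ?w c"
    unfolding \<phi> v using mdrkcat_final_formal[OF p _ c, of \<sigma>] \<sigma> by simp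
  moreover have "n < 2 * p + 1" using n by (simp add: N_def)
  ultimately have "coeff2 (mdrkcat_update p r \<phi> 1 \<sigma> b {1..s} (mdrkcat_stage p r a \<phi> 1 \<sigma> v) v 0 c) 0 n =
      coeff2 (formal_update r \<sigma> b {1..s} (formal_stage r a \<sigma> ?w) ?w c) 0 n"
    unfolding hh_power_dvd_iff by simp
  also have "\<dots> = coeff2 (\<Sum>m\<le>q. \<sigma> ^ m *\<^sub>R U ?w m c) 0 n"
    by (rule formal_order[OF finite_Basis ord c _ \<sigma>]) (use n in \<open>auto simp: N_def coeff2_jet\<close>)
  also have "\<dots> = (\<Sum>m\<le>q. \<sigma> ^ m * (if n = m then coeff2 (jet N u 1 z c) 0 n else 0))"
  proof -
    have "coeff2 (U ?w m c) 0 n = (if n = m then coeff2 (jet N u 1 z c) 0 n else 0)" for m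
    proof (rule U_jet[where M = N])
      show "real n * coeff2 (jet N u 1 z b) j n = - (real (Suc j) * coeff2 (P2 (jet N u 1 z) b) (Suc j) (n - 1))"
        if "b \<in> Basis" "0 < n" "j + n \<le> N" for b j n
        using jet_conservation_law[OF f \<Omega> u[unfolded u_def] sol z that] unfolding u_def .
    qed (use c n in \<open>auto simp: coeff2_jet\<close>)
    then show ?thesis by (simp add: coeff_sum)
  qed
  \<comment> \<open>Only \<open>m = n\<close> survives, in range since \<open>n \<le> q\<close>; its
    factor turns the jet with parameter 1 into the one with parameter \<sigma>.\<close>
  also have "\<dots> = \<sigma> ^ n * coeff2 (jet N u 1 z c) 0 n"
    using n by (simp add: N_def if_distrib[where f = "\<lambda>x. _ * x"] cong: if_cong)
  also have "\<dots> = coeff2 (jet N u \<sigma> z c) 0 n" by (simp add: coeff2_jet)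
  finally show ?thesis .
qed

theorem theorem1:
  fixes f :: "'a::euclidean_space \<Rightarrow> 'a" and w :: "real \<Rightarrow> real \<Rightarrow> 'a"
    and \<Omega> K :: "(real \<times> real) set" and \<tau> :: "real \<Rightarrow> real"
    and a :: "nat \<Rightarrow> nat \<Rightarrow> nat \<Rightarrow> real" and b :: "nat \<Rightarrow> nat \<Rightarrow> real"
    and p q r s :: nat
  assumes "1 \<le> p"
    and "mdrk_has_order r s a b q"
    and "smooth_on UNIV f"
    and "open \<Omega>" and "smooth_on \<Omega> (\<lambda>(x, t). w x t)"
    and "exact_solution f w \<Omega>"
    and "compact K" and "K \<subseteq> \<Omega>"
    and "\<forall>\<^sub>F dx in at_right 0. 0 < \<tau> dx"
    and "O[at_right 0](\<tau>) = O[at_right 0](\<lambda>dx. dx)"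
  shows "mdrkcat_residual_bounded_by p r s a b f w \<tau> K (\<lambda>dx. dx ^ (min (2 * p) q + 1)) \<and>
    mdrkcat_residual_bounded_by p r s a b f w \<tau> K (\<lambda>dx. \<tau> dx ^ (q + 1) + dx ^ (2 * p + 1))"
proof -
  define u where "u = (\<lambda>(x, t). w x t)"
  define N where "N = min (2 * p) q"
  \<comment> \<open>A configuration \<open>(dx, x0, t, i)\<close> indexes all families. Along
    \<open>F\<close> the step size tends to 0 while the node stays in \<open>K\<close>, so estimates
    along \<open>F\<close> are uniform over the grid points.\<close>
  define h :: "real \<times> real \<times> real \<times> int \<Rightarrow> real" where "h = fst"
  define z :: "real \<times> real \<times> real \<times> int \<Rightarrow> real \<times> real" where "z = (\<lambda>(dx, x0, t, i). (x0 + of_int i * dx, t))"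
  define F where "F = inf (filtercomap h (at_right 0)) (principal {\<omega>. z \<omega> \<in> K})"
  define \<sigma> where "\<sigma> \<omega> = \<tau> (h \<omega>) / h \<omega>" for \<omega>
  define res where "res = (\<lambda>(dx, x0, t, i). mdrkcat_residual p r s a b f w dx (\<tau> dx) x0 t i)"
  note u = assms(5)[folded u_def]
  have F: "\<forall>\<^sub>F \<omega> in F. P (h \<omega>)" if "eventually P (at_right 0)" for P
    unfolding F_def eventually_inf_principal
    by (rule eventually_mono[OF eventually_filtercomapI[OF that]]) simp
  have zK: "\<forall>\<^sub>F \<omega> in F. z \<omega> \<in> K" by (simp add: F_def eventually_inf_principal)
  have "filterlim h (at_right 0) F"
    unfolding F_def by (rule filterlim_mono[OF filterlim_filtercomap order.refl]) simp
  then have h_lim: "(h \<longlongrightarrow> 0) F" by (rule filterlim_mono) (auto simp: at_within_le_nhds)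
  interpret expansion F h 0 N
    by unfold_locales (rule F[OF eventually_at_right_less], rule h_lim)
  \<comment> \<open>The two inclusions in the comparability assumption bound \<sigma> and
    \<open>1 / \<sigma>\<close>, whose powers are the variable coefficients of the method.\<close>
  have "\<tau> \<in> O[at_right 0](\<lambda>dx. dx)" using assms(10) landau_o.big_refl by blast
  then obtain c1 where c1: "\<forall>\<^sub>F dx in at_right 0. norm (\<tau> dx) \<le> c1 * norm dx" by (elim landau_o.bigE)
  have "(\<lambda>dx. dx) \<in> O[at_right 0](\<tau>)" using assms(10) landau_o.big_refl by blast
  then obtain c2 where c2: "\<forall>\<^sub>F dx in at_right 0. norm dx \<le> c2 * norm (\<tau> dx)" by (elim landau_o.bigE)
  have "\<forall>\<^sub>F \<omega> in F. norm (\<sigma> \<omega>) \<le> c1 * norm (1::real)"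
    using F[OF c1] h_pos by eventually_elim (simp add: \<sigma>_def field_simps)
  then have \<sigma>: "\<sigma> \<in> O[F](\<lambda>_. 1)" by (rule bigoI)
  have "\<forall>\<^sub>F \<omega> in F. norm (1 / \<sigma> \<omega>) \<le> c2 * norm (1::real)"
    using F[OF c2] F[OF assms(9)] h_pos by eventually_elim (simp add: \<sigma>_def field_simps)
  then have \<sigma>_inv: "(\<lambda>\<omega>. 1 / \<sigma> \<omega>) \<in> O[F](\<lambda>_. 1)" by (rule bigoI)
  define \<phi> where "\<phi> \<omega> y = f (u (z \<omega>) + y) - f (u (z \<omega>))" for \<omega> y
  define P where "P \<omega> = polynomial_flux.P2 Basis N (taylor_coeff f (u (z \<omega>)))" for \<omega>
  define v where "v \<omega> m = u (z \<omega> + (of_int m * h \<omega>, 0)) - u (z \<omega>)" for \<omega> and m :: int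
  define v' where "v' \<omega> = (\<lambda>m c. translate m (jet N u 0 (z \<omega>) c))" for \<omega>
  define Z where "Z \<omega> = mdrkcat_update p r (\<phi> \<omega>) 1 (\<sigma> \<omega>) b {1..s} (mdrkcat_stage p r a (\<phi> \<omega>) 1 (\<sigma> \<omega>) (v \<omega>)) (v \<omega>) 0" for \<omega>
  define Z' where "Z' \<omega> = mdrkcat_update p r (P \<omega>) 1 (\<sigma> \<omega>) b {1..s} (mdrkcat_stage p r a (P \<omega>) 1 (\<sigma> \<omega>) (v' \<omega>)) (v' \<omega>) 0" for \<omega>
  define J where "J \<omega> c = translate 0 (jet N u (\<sigma> \<omega>) (z \<omega>) c)" for \<omega> c
  have uK: "compact (u ` K)"
    using smooth_on_continuous_on[OF u] assms(7,8) continuous_on_subset by (blast intro: compact_continuous_image)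
  obtain B where "\<forall>y\<in>u ` K. \<forall>\<delta>. norm \<delta> \<le> 1 \<longrightarrow> (\<forall>c\<in>Basis.
      \<bar>(f (y + \<delta>) - f y) \<bullet> c - pmap Basis N (taylor_coeff f y) (\<lambda>b. \<delta> \<bullet> b) c\<bar> \<le> B * norm \<delta> ^ (N + 1))"
    using taylor_polynomial_map[OF assms(3) uK] by blast
  then have taylor: "\<forall>\<^sub>F \<omega> in F. \<forall>\<delta>. norm \<delta> \<le> 1 \<longrightarrow> (\<forall>c\<in>Basis.
      \<bar>\<phi> \<omega> \<delta> \<bullet> c - pmap Basis N (taylor_coeff f (u (z \<omega>))) (\<lambda>b. \<delta> \<bullet> b) c\<bar> \<le> B * norm \<delta> ^ (N + 1))"
    using zK by (auto elim!: eventually_mono simp: \<phi>_def)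
  have coeff: "(\<lambda>\<omega>. taylor_coeff f (u (z \<omega>)) c bs) \<in> O[F](\<lambda>_. 1)" for c bs
  proof -
    have "\<forall>\<^sub>F \<omega> in F. u (z \<omega>) \<in> u ` K" using zK by (auto elim: eventually_mono)
    then have "(\<lambda>\<omega>. dird_list bs f (u (z \<omega>)) \<bullet> c) \<in> O[F](\<lambda>_. 1)"
      using smooth_on_continuous_on[OF smooth_on_dird_list[OF assms(3)]] uK by (intro compact_inner_bigo) auto
    then show ?thesis by (cases bs) (simp_all add: taylor_coeff_def)
  qed
  interpret R: cat_relation rep "{c. c \<in> O[F](\<lambda>_. 1)}" \<phi> P \<sigma>
    unfolding P_def by (rule cat_relation_rep[OF taylor coeff _ \<sigma> \<sigma>_inv]) (simp add: taylor_coeff_def)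
  have v: "rep (\<lambda>\<omega>. v \<omega> m) (\<lambda>\<omega>. v' \<omega> m)" for m
    using rep_jet_translate[OF u assms(4,7,8) zK, of "\<lambda>_. 0" m] by (simp add: v_def v'_def)
  have "rep Z Z'"
    unfolding Z_def[abs_def] Z'_def[abs_def] by (intro R.mdrkcat_update R.mdrkcat_stage v)
  moreover have "rep (\<lambda>\<omega>. u (z \<omega> + (0, \<sigma> \<omega> * h \<omega>)) - u (z \<omega>)) J"
    using rep_jet_translate[OF u assms(4,7,8) zK \<sigma>, of 0] by (simp add: J_def[abs_def])
  ultimately have rep: "rep (\<lambda>\<omega>. (u (z \<omega> + (0, \<sigma> \<omega> * h \<omega>)) - u (z \<omega>)) - Z \<omega>) (\<lambda>\<omega>. J \<omega> - Z' \<omega>)"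
    by (intro R.diff)
  have res: "\<forall>\<^sub>F \<omega> in F. res \<omega> = (u (z \<omega> + (0, \<sigma> \<omega> * h \<omega>)) - u (z \<omega>)) - Z \<omega>"
    using h_pos F[OF assms(9)]
  proof eventually_elim
    case (elim \<omega>)
    obtain dx x0 t i where \<omega>: "\<omega> = (dx, x0, t, i)" by (cases \<omega>)
    have "dx \<noteq> 0" "\<tau> dx \<noteq> 0" using elim by (auto simp: \<omega> h_def)
    from mdrkcat_residual_normal_form[OF assms(1) this, where \<xi> = x0 and i = i and t = t and f = f and w = w,
        folded u_def, OF refl refl refl, of r s a b]
    show ?case using \<open>dx \<noteq> 0\<close>
      by (simp add: \<omega> res_def Z_def \<phi>_def[abs_def] v_def[abs_def] z_def h_def \<sigma>_def)
  qed
  have "(\<lambda>\<omega>. ((u (z \<omega> + (0, \<sigma> \<omega> * h \<omega>)) - u (z \<omega>)) - Z \<omega>) \<bullet> c) \<in> O[F](\<lambda>\<omega>. h \<omega> ^ (N + 1))"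
    if c: "c \<in> Basis" for c
  proof -
    have "(\<lambda>\<omega>. ev 0 (h \<omega>) ((J \<omega> - Z' \<omega>) c)) \<in> O[F](\<lambda>\<omega>. h \<omega> ^ (N + 1))"
    proof (rule ev_bigo[OF repD(1)[OF rep c]])
      fix j n assume jn: "j + n < N + 1"
      show "\<forall>\<^sub>F \<omega> in F. 0 ^ j * coeff2 ((J \<omega> - Z' \<omega>) c) j n = 0"
        using zK h_pos F[OF assms(9)]
      proof eventually_elim
        case (elim \<omega>)
        have "0 < \<sigma> \<omega>" using elim by (simp add: \<sigma>_def)
        moreover have "z \<omega> \<in> \<Omega>" using elim assms(8) by blast
        ultimately have "coeff2 (Z' \<omega> c) 0 n = coeff2 (jet N u (\<sigma> \<omega>) (z \<omega>) c) 0 n" if "n \<le> N"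
          using formal_residual_vanishes[OF assms(1-6) _ _ c, folded u_def N_def, OF _ _ that P_def v'_def]
          unfolding Z'_def by simp
        then show ?case using jn by (cases j) (auto simp: J_def)
      qed
    qed
    from sum_in_bigo(1)[OF repD(3)[OF rep c] this] show ?thesis by simp
  qed
  then have "(\<lambda>\<omega>. \<Sum>c\<in>Basis. norm (((u (z \<omega> + (0, \<sigma> \<omega> * h \<omega>)) - u (z \<omega>)) - Z \<omega>) \<bullet> c)) \<in> O[F](\<lambda>\<omega>. h \<omega> ^ (N + 1))"
    by (intro big_sum_in_bigo) simp
  then obtain C where C: "C > 0" "\<forall>\<^sub>F \<omega> in F.
      norm (\<Sum>c\<in>Basis. norm (((u (z \<omega> + (0, \<sigma> \<omega> * h \<omega>)) - u (z \<omega>)) - Z \<omega>) \<bullet> c)) \<le> C * norm (h \<omega> ^ (N + 1))"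
    by (elim landau_o.bigE)
  have "\<forall>\<^sub>F \<omega> in F. norm (res \<omega>) \<le> C * h \<omega> ^ (N + 1)"
    using C(2) res h_pos
  proof eventually_elim
    case (elim \<omega>)
    have "norm (res \<omega>) \<le> (\<Sum>c\<in>Basis. \<bar>res \<omega> \<bullet> c\<bar>)" by (rule norm_le_l1)
    also have "\<dots> \<le> C * norm (h \<omega> ^ (N + 1))" using elim(1) unfolding elim(2) by (simp add: sum_nonneg)
    also have "norm (h \<omega> ^ (N + 1)) = h \<omega> ^ (N + 1)" using elim(3) by simp
    finally show ?case .
  qed
  \<comment> \<open>Unfolding \<open>F\<close> yields a condition on the step size alone, uniform in
    \<open>x0\<close>, \<open>t\<close> and \<open>i\<close>.\<close>
  then obtain Q where Q: "eventually Q (at_right 0)"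
    "\<And>\<omega>. Q (h \<omega>) \<Longrightarrow> z \<omega> \<in> K \<Longrightarrow> norm (res \<omega>) \<le> C * h \<omega> ^ (N + 1)"
    unfolding F_def eventually_inf_principal eventually_filtercomap by auto
  have main: "norm (mdrkcat_residual p r s a b f w dx (\<tau> dx) x0 t i) \<le> C * dx ^ (N + 1)"
    if "Q dx" "(x0 + of_int i * dx, t) \<in> K" for dx x0 t i
    using Q(2)[of "(dx, x0, t, i)"] that by (simp add: h_def z_def res_def)
  have "mdrkcat_residual_bounded_by p r s a b f w \<tau> K (\<lambda>dx. dx ^ (min (2 * p) q + 1))"
    unfolding mdrkcat_residual_bounded_by_def N_def[symmetric]
    using main by (intro exI[of _ C] eventually_mono[OF Q(1)]) blast
  moreover have "mdrkcat_residual_bounded_by p r s a b f w \<tau> K (\<lambda>dx. \<tau> dx ^ (q + 1) + dx ^ (2 * p + 1))"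
    unfolding mdrkcat_residual_bounded_by_def
  \<comment> \<open>For \<open>2 * p \<le> q\<close> the factor 1 suffices; otherwise
    \<open>dx \<le> c2 * \<tau> dx\<close> converts \<open>dx ^ (q + 1)\<close> into
    \<open>\<tau> dx ^ (q + 1)\<close>.\<close>
  proof (intro exI[of _ "C * max 1 (c2 ^ (q + 1))"])
    show "\<forall>\<^sub>F dx in at_right 0. \<forall>x0 t i. (x0 + of_int i * dx, t) \<in> K \<longrightarrow>
        norm (mdrkcat_residual p r s a b f w dx (\<tau> dx) x0 t i) \<le>
          C * max 1 (c2 ^ (q + 1)) * (\<tau> dx ^ (q + 1) + dx ^ (2 * p + 1))"
      using Q(1) c2 assms(9) eventually_at_right_less[of "0::real"]
    proof eventually_elim
      case (elim dx)
      have "dx ^ (N + 1) \<le> max 1 (c2 ^ (q + 1)) * (\<tau> dx ^ (q + 1) + dx ^ (2 * p + 1))"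
      proof (cases "2 * p \<le> q")
        case True
        then have "dx ^ (N + 1) \<le> 1 * (\<tau> dx ^ (q + 1) + dx ^ (2 * p + 1))" using elim by (simp add: N_def)
        also have "\<dots> \<le> max 1 (c2 ^ (q + 1)) * (\<tau> dx ^ (q + 1) + dx ^ (2 * p + 1))"
          using elim by (intro mult_right_mono) auto
        finally show ?thesis .
      next
        case False
        then have "dx ^ (N + 1) = dx ^ (q + 1)" by (simp add: N_def)
        also have "\<dots> \<le> (c2 * \<tau> dx) ^ (q + 1)" using elim by (intro power_mono) auto
        also have "\<dots> = c2 ^ (q + 1) * \<tau> dx ^ (q + 1)" by (rule power_mult_distrib)
        also have "\<dots> \<le> max 1 (c2 ^ (q + 1)) * (\<tau> dx ^ (q + 1) + dx ^ (2 * p + 1))"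
          using elim by (intro mult_mono) auto
        finally show ?thesis .
      qed
      then have "C * dx ^ (N + 1) \<le> C * max 1 (c2 ^ (q + 1)) * (\<tau> dx ^ (q + 1) + dx ^ (2 * p + 1))"
        unfolding mult.assoc using C(1) by (intro mult_left_mono) auto
      with main[OF elim(1)] show ?case by (blast intro: order.trans)
    qed
  qed
  ultimately show ?thesis by blast
qed

end
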